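(* Let $G$ be a simple multipartite graph of type $(q_1,\dots,q_k)$ with $n$ nodes and odd tulgeity $\tau_0$. If $j(I(G))\neq0$, then $$2^{\tau_0}\leq j(I(G))\leq 2^{n}-2\sum_{i=1}^k\sum_{j=1}^{q_i}\binom{n-1}{j-1}.$$
   Context: A simple graph $G$ has finite non-empty node set $V(G)=\{x_1,\dots,x_n\}$ and edge set $E(G)$ consisting of $2$-element subsets of $V(G)$. It is multipartite of type $(q_1,\dots,q_k)$ (with $q_i\ge1$, $q_1+\dots+q_k=n$) if $V(G)$ can be partitioned into sets $V_1,\dots,V_k$ with $|V_i|=q_i$ such that no edge has both ends in the same $V_i$. The odd tulgeity $\tau_0$ of $G$ is the maximum number of pairwise node-disjoint odd cycles in $G$. Fix a field $\Bbbk$ and view nodes as indeterminates. The edge ideal is $I(G)=(x_ix_j:\{x_i,x_j\}\in E(G))\subset R=\Bbbk[x_1,\dots,x_n]_{(x_1,\dots,x_n)}$. For an ideal $I$ in a Noetherian local ring $(R,\mathfrak m)$ of dimension $n\ge1$, the $j$-multiplicity is $j(I)=(n-1)!\lim_{t\to\infty}\lambda_R(\Gamma_{\mathfrak m}(I^t/I^{t+1}))/t^{n-1}$, where $\lambda_R$ is length and $\Gamma_{\mathfrak m}$ is the zeroth local cohomology. *)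

theory Defs
  imports
    "HOL-Algebra.Ideal_Product"
    "HOL-Algebra.Module"
    "HOL-Algebra.QuotRing"
    "HOL-Library.Poly_Mapping"
    "HOL-Library.Disjoint_Sets"
    "HOL-Library.Extended_Real"
begin

section \<open>Graphs\<close>

definition simple_graph :: "'v set \<Rightarrow> 'v set set \<Rightarrow> bool" where
  "simple_graph V E \<longleftrightarrow> finite V \<and> V \<noteq> {} \<and> (\<forall>e\<in>E. e \<subseteq> V \<and> card e = 2)"

text \<open>The type \<open>(q\<^sub>1, \<dots>, q\<^sub>k)\<close> is given by \<open>k\<close> and the values of \<open>q\<close> on \<open>{1..k}\<close>.\<close>

definition multipartite :: "'v set \<Rightarrow> 'v set set \<Rightarrow> nat \<Rightarrow> (nat \<Rightarrow> nat) \<Rightarrow> bool" where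
  "multipartite V E k q \<longleftrightarrow>
     (\<forall>i\<in>{1..k}. 1 \<le> q i) \<and>
     (\<exists>W :: nat \<Rightarrow> 'v set.
        (\<Union>i\<in>{1..k}. W i) = V \<and> disjoint_family_on W {1..k} \<and>
        (\<forall>i\<in>{1..k}. card (W i) = q i \<and> (\<forall>e\<in>E. \<not> e \<subseteq> W i)))"

text \<open>A cycle is represented by the list of its nodes, in cyclic order.\<close>

definition cycle_in :: "'v set set \<Rightarrow> 'v list \<Rightarrow> bool" where
  "cycle_in E c \<longleftrightarrow> 3 \<le> length c \<and> distinct c \<and>
     (\<forall>i<length c. {c ! i, c ! (Suc i mod length c)} \<in> E)"

definition odd_tulgeity :: "'v set set \<Rightarrow> nat" where
  "odd_tulgeity E = Max {card C | C.
     (\<forall>c\<in>C. cycle_in E c \<and> odd (length c)) \<and>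
     pairwise (\<lambda>c d. set c \<inter> set d = {}) C}"


section \<open>Localization at a prime ideal\<close>

definition loc_rel :: "('a, 'b) ring_scheme \<Rightarrow> 'a set \<Rightarrow> (('a \<times> 'a) \<times> ('a \<times> 'a)) set" where
  "loc_rel A P = {((a, s), (b, t)).
     a \<in> carrier A \<and> b \<in> carrier A \<and> s \<in> carrier A - P \<and> t \<in> carrier A - P \<and>
     (\<exists>u\<in>carrier A - P. u \<otimes>\<^bsub>A\<^esub> (a \<otimes>\<^bsub>A\<^esub> t) = u \<otimes>\<^bsub>A\<^esub> (b \<otimes>\<^bsub>A\<^esub> s))}"

text \<open>The class of the fraction \<open>a / s\<close>.\<close>

definition loc_frac :: "('a, 'b) ring_scheme \<Rightarrow> 'a set \<Rightarrow> 'a \<Rightarrow> 'a \<Rightarrow> ('a \<times> 'a) set" where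
  "loc_frac A P a s = loc_rel A P `` {(a, s)}"

text \<open>As in \<^const>\<open>rcoset_mult\<close>, operations on classes are unions over representatives;
  all members of such a union coincide.\<close>

definition localization :: "('a, 'b) ring_scheme \<Rightarrow> 'a set \<Rightarrow> ('a \<times> 'a) set ring" where
  "localization A P =
     \<lparr>carrier = {loc_frac A P a s | a s. a \<in> carrier A \<and> s \<in> carrier A - P},
      mult = (\<lambda>F G. \<Union>x\<in>F. \<Union>y\<in>G. loc_frac A P (fst x \<otimes>\<^bsub>A\<^esub> fst y) (snd x \<otimes>\<^bsub>A\<^esub> snd y)),
      one = loc_frac A P \<one>\<^bsub>A\<^esub> \<one>\<^bsub>A\<^esub>,
      zero = loc_frac A P \<zero>\<^bsub>A\<^esub> \<one>\<^bsub>A\<^esub>,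
      add = (\<lambda>F G. \<Union>x\<in>F. \<Union>y\<in>G.
               loc_frac A P ((fst x \<otimes>\<^bsub>A\<^esub> snd y) \<oplus>\<^bsub>A\<^esub> (fst y \<otimes>\<^bsub>A\<^esub> snd x)) (snd x \<otimes>\<^bsub>A\<^esub> snd y))\<rparr>"


section \<open>The j-multiplicity\<close>

definition krull_dim :: "('a, 'b) ring_scheme \<Rightarrow> enat" where
  "krull_dim R = Sup {enat l | l. \<exists>P :: nat \<Rightarrow> 'a set.
     (\<forall>i\<le>l. primeideal (P i) R) \<and> (\<forall>i<l. P i \<subset> P (Suc i))}"

definition module_length :: "('a, 'b) ring_scheme \<Rightarrow> ('a, 'm) module \<Rightarrow> enat" where
  "module_length R M = Sup {enat l | l. \<exists>N :: nat \<Rightarrow> 'm set.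
     (\<forall>i\<le>l. submodule (N i) R M) \<and> (\<forall>i<l. N i \<subset> N (Suc i))}"

definition ideal_pow :: "('a, 'b) ring_scheme \<Rightarrow> 'a set \<Rightarrow> nat \<Rightarrow> 'a set" where
  "ideal_pow R I t = I [^]\<^bsub>ideals_set R\<^esub> t"

text \<open>The \<open>R\<close>-module \<open>I / J\<close> for ideals \<open>J \<subseteq> I\<close>.  The record type of modules extends
  that of rings, so \<^const>\<open>mult\<close> and \<^const>\<open>one\<close> need values, but they play no role in the
  module structure.\<close>

definition quot_module :: "('a, 'b) ring_scheme \<Rightarrow> 'a set \<Rightarrow> 'a set \<Rightarrow> ('a, 'a set) module" where
  "quot_module R I J =
     \<lparr>carrier = {J +>\<^bsub>R\<^esub> a | a. a \<in> I},
      mult = rcoset_mult R J,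
      one = J +>\<^bsub>R\<^esub> \<one>\<^bsub>R\<^esub>,
      zero = J,
      add = set_add R,
      smult = (\<lambda>r C. \<Union>x\<in>C. J +>\<^bsub>R\<^esub> (r \<otimes>\<^bsub>R\<^esub> x))\<rparr>"

text \<open>The zeroth local cohomology \<open>\<Gamma>\<^sub>m(M)\<close>: the submodule of elements killed by a power of \<open>m\<close>.\<close>

definition local_cohomology0 ::
    "('a, 'b) ring_scheme \<Rightarrow> 'a set \<Rightarrow> ('a, 'm) module \<Rightarrow> ('a, 'm) module" where
  "local_cohomology0 R m M =
     M\<lparr>carrier := {x \<in> carrier M. \<exists>s. \<forall>r\<in>ideal_pow R m s. r \<odot>\<^bsub>M\<^esub> x = \<zero>\<^bsub>M\<^esub>}\<rparr>"

text \<open>Meant for Noetherian local rings \<open>R\<close> of dimension at least 1, where the maximal ideal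
  is unique.  The limit is taken in the
  extended reals so that lengths need not be assumed finite.\<close>

definition j_multiplicity :: "('a, 'b) ring_scheme \<Rightarrow> 'a set \<Rightarrow> ereal" where
  "j_multiplicity R I =
     (let d = the_enat (krull_dim R); m = (THE m. maximalideal m R) in
      ereal (fact (d - 1)) *
      lim (\<lambda>t. ereal_of_enat
                 (module_length R
                    (local_cohomology0 R m
                       (quot_module R (ideal_pow R I t) (ideal_pow R I (t + 1)))))
               / ereal (real t ^ (d - 1))))"


section \<open>Edge ideals\<close>

text \<open>A polynomial is a finitely supported map from monomials to coefficients, and a monomial is
  a finitely supported map from indeterminates to exponents.\<close>

type_synonym ('v, 'k) mpoly = "('v \<Rightarrow>\<^sub>0 nat) \<Rightarrow>\<^sub>0 'k"

definition poly_ring :: "'k::field itself \<Rightarrow> 'v set \<Rightarrow> ('v, 'k) mpoly ring" where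
  "poly_ring _ V =
     \<lparr>carrier = {p. \<forall>m\<in>Poly_Mapping.keys p. Poly_Mapping.keys m \<subseteq> V},
      mult = (*), one = 1, zero = 0, add = (+)\<rparr>"

definition indet :: "'v \<Rightarrow> ('v, 'k::field) mpoly" where
  "indet v = Poly_Mapping.single (Poly_Mapping.single v 1) 1"

definition origin_ideal :: "'k::field itself \<Rightarrow> 'v set \<Rightarrow> ('v, 'k) mpoly set" where
  "origin_ideal K V = genideal (poly_ring K V) (indet ` V)"

definition node_ring :: "'k::field itself \<Rightarrow> 'v set \<Rightarrow> (('v, 'k) mpoly \<times> ('v, 'k) mpoly) set ring" where
  "node_ring K V = localization (poly_ring K V) (origin_ideal K V)"

definition edge_ideal ::
    "'k::field itself \<Rightarrow> 'v set \<Rightarrow> 'v set set \<Rightarrow> (('v, 'k) mpoly \<times> ('v, 'k) mpoly) set set" where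
  "edge_ideal K V E = genideal (node_ring K V)
     {loc_frac (poly_ring K V) (origin_ideal K V) (indet v * indet w) 1 | v w. {v, w} \<in> E}"

end

theory Submission
  imports
    Defs
    "HOL-Computational_Algebra.Polynomial"
    "HOL-Real_Asymp.Real_Asymp"
    "HOL-Analysis.Extended_Real_Limits"
begin

text \<open>The powers of the edge ideal \<open>I\<close> are spanned by monomials, so the local cohomology of
  \<open>I\<^sup>t / I\<^sup>t\<^sup>+\<^sup>1\<close> has a composition series with one factor for every monomial of \<open>I\<^sup>t\<close> outside \<open>I\<^sup>t\<^sup>+\<^sup>1\<close>
  that all sufficiently large monomials multiply into \<open>I\<^sup>t\<^sup>+\<^sup>1\<close>. By Dickson's lemma these monomials are
  finitely generated over the monoid spanned by the edges; choosing lexicographically least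
  representations turns their number \<open>N(t)\<close> into a sum of counting functions of down-sets. Hence \<open>N\<close> is
  eventually polynomial, and \<open>N(t) / t\<^sup>n\<^sup>-\<^sup>1\<close> has a limit \<open>L\<close> with \<open>j(I) = (n - 1)! L\<close>.

  Upper bound: up to a constant, at most half of the degree of such a monomial lies in one part, and
  the monomials with more than half of their degree in a given part can be counted.

  Lower bound: if some component is bipartite, its bipartition gives a linear functional that is bounded
  on the monomials in question, and \<open>L = 0\<close>. Otherwise every node can be joined to a maximal family of
  disjoint odd cycles. Following the cycles, and moving closer to them elsewhere, defines a map
  \<open>f : V \<rightarrow> V\<close>. The vectors \<open>e\<^sub>v + e\<^sub>f\<^sub>v\<close> are linearly independent, and parities distinguish \<open>2\<^sup>\<tau>\<close> cosets of the
  lattice that they span, each of which contributes about \<open>t\<^sup>n\<^sup>-\<^sup>1 / (n - 1)!\<close> monomials.\<close>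

section \<open>Monomials\<close>

text \<open>Origin of the constants. About \<open>(2 t) ^ (n - 1) / (n - 1)!\<close> monomials have
  degree \<open>2 * t\<close>, and on average two degrees, one even and one odd, belong to each
  order \<open>t\<close>; this gives \<open>2 * 2 ^ (n - 1) = 2 ^ n\<close>. A part takes away the
  monomials with more than half of their degree in it. Those for which half of the degree is passed
  at the \<open>j\<close>-th node of the part make up about \<open>(n - 1) choose (j - 1)\<close>
  out of \<open>2 ^ (n - 1)\<close>. The number \<open>2 ^ \<tau>\<close> is a lattice index: around
  an odd cycle the vectors \<open>e\<^sub>v + e\<^sub>f\<^sub>v\<close> have determinant 2, and the
  trees attached to the cycles do not change this. Obstacle: \<open>j_multiplicity\<close> is
  written with \<open>lim\<close>, about which nothing can be said unless the limit exists, and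
  averaging over degrees bounds the limit but no single term. Hence eventual polynomiality comes
  before all estimates. Existence is shown in the extended reals; finiteness is a consequence of the
  upper bound.\<close>

abbreviation mkeys where "mkeys \<equiv> Poly_Mapping.keys"
abbreviation mlookup where "mlookup \<equiv> Poly_Mapping.lookup"

text \<open>Dickson's lemma for points with coordinates \<open>\<phi> x i\<close>, stated for a
  general \<open>\<phi>\<close> so that it serves monomials and pairs of monomials alike. Induction
  on the coordinates: a basis \<open>F0\<close> for the others settles every \<open>x\<close> whose
  coordinate \<open>s\<close> is at least the largest value \<open>N\<close> on \<open>F0\<close>,
  and each of the finitely many smaller values gets a basis of its own.\<close>

lemma finite_dickson_basis:
  fixes \<phi> :: "'a \<Rightarrow> 'i \<Rightarrow> nat"
  assumes "finite S"
  shows "\<exists>F. finite F \<and> F \<subseteq> X \<and> (\<forall>x\<in>X. \<exists>f\<in>F. \<forall>i\<in>S. \<phi> f i \<le> \<phi> x i)"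
  using assms
proof (induction S arbitrary: X rule: finite_induct)
  case empty
  show ?case
  proof (cases "X = {}")
    case False
    then obtain x where "x \<in> X" by blast
    then show ?thesis by (intro exI[of _ "{x}"]) auto
  qed auto
next
  case (insert s S)
  obtain F0 where F0: "finite F0" "F0 \<subseteq> X" "\<forall>x\<in>X. \<exists>f\<in>F0. \<forall>i\<in>S. \<phi> f i \<le> \<phi> x i"
    using insert.IH[of X] by blast
  have "\<forall>j. \<exists>F. finite F \<and> F \<subseteq> {x\<in>X. \<phi> x s = j} \<and>
      (\<forall>x\<in>{x\<in>X. \<phi> x s = j}. \<exists>f\<in>F. \<forall>i\<in>S. \<phi> f i \<le> \<phi> x i)"
    using insert.IH by blast
  then obtain G where G: "\<And>j. finite (G j)" "\<And>j. G j \<subseteq> {x\<in>X. \<phi> x s = j}"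
     "\<And>j. \<forall>x\<in>{x\<in>X. \<phi> x s = j}. \<exists>f\<in>G j. \<forall>i\<in>S. \<phi> f i \<le> \<phi> x i"
    by metis
  define N where "N = Max (insert 0 ((\<lambda>f. \<phi> f s) ` F0))"
  have N: "\<phi> f s \<le> N" if "f \<in> F0" for f
    using F0(1) that by (auto simp: N_def intro!: Max_ge)
  show ?case
  proof (intro exI[of _ "F0 \<union> (\<Union>j<N. G j)"] conjI ballI)
    show "finite (F0 \<union> (\<Union>j<N. G j))" using F0 G by auto
    show "F0 \<union> (\<Union>j<N. G j) \<subseteq> X" using F0(2) G(2) by blast
    fix x assume x: "x \<in> X"
    show "\<exists>f\<in>F0 \<union> (\<Union>j<N. G j). \<forall>i\<in>insert s S. \<phi> f i \<le> \<phi> x i"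
    proof (cases "\<phi> x s < N")
      case True
      obtain f where f: "f \<in> G (\<phi> x s)" "\<forall>i\<in>S. \<phi> f i \<le> \<phi> x i"
        using G(3)[of "\<phi> x s"] x by auto
      moreover have "\<phi> f s = \<phi> x s" using G(2)[of "\<phi> x s"] f by auto
      ultimately show ?thesis using True by (intro bexI[of _ f]) auto
    next
      case False
      obtain f where f: "f \<in> F0" "\<forall>i\<in>S. \<phi> f i \<le> \<phi> x i"
        using F0(3) x by blast
      then show ?thesis using False N[of f] by (intro bexI[of _ f]) auto
    qed
  qed
qed

section \<open>Degree, restriction and number of monomials\<close>

definition mdeg :: "('a \<Rightarrow>\<^sub>0 nat) \<Rightarrow> nat" where
  "mdeg a = (\<Sum>i\<in>mkeys a. mlookup a i)"

lemma mdeg_sum: "finite S \<Longrightarrow> mkeys a \<subseteq> S \<Longrightarrow> mdeg a = (\<Sum>i\<in>S. mlookup a i)"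
  unfolding mdeg_def by (rule sum.mono_neutral_left) (auto simp: in_keys_iff)

lemma keys_add_nat: "mkeys (a + b :: 'a \<Rightarrow>\<^sub>0 nat) = mkeys a \<union> mkeys b"
  by (auto simp: in_keys_iff lookup_add)

lemma mdeg_add [simp]: "mdeg (a + b) = mdeg a + mdeg b"
proof -
  let ?S = "mkeys a \<union> mkeys b"
  have "finite ?S" by simp
  then show ?thesis
    by (simp add: mdeg_sum[of ?S] keys_add_nat lookup_add sum.distrib)
qed

lemma mdeg_0 [simp]: "mdeg 0 = 0" by (simp add: mdeg_def)

lemma mdeg_single [simp]: "mdeg (Poly_Mapping.single i k) = k"
  by (cases "k = 0") (auto simp: mdeg_def)

lemma mdeg_eq_0_iff [simp]: "mdeg a = 0 \<longleftrightarrow> a = 0"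
  by (auto simp: mdeg_def in_keys_iff simp flip: keys_eq_empty) 

lemma lookup_le_mdeg: "mlookup a i \<le> mdeg a"
  by (cases "i \<in> mkeys a") (auto simp: mdeg_def in_keys_iff intro: member_le_sum)

lemma add_diff_lookup:
  fixes a b :: "'a \<Rightarrow>\<^sub>0 nat"
  assumes "\<And>i. mlookup a i \<le> mlookup b i"
  shows "b = a + (b - a)"
  by (rule poly_mapping_eqI) (simp add: lookup_add lookup_minus assms)

definition restr :: "'a set \<Rightarrow> ('a \<Rightarrow>\<^sub>0 nat) \<Rightarrow> ('a \<Rightarrow>\<^sub>0 nat)" where
  "restr S a = Poly_Mapping.mapp (\<lambda>k v. if k \<in> S then v else 0) a"

lemma lookup_restr [simp]: "mlookup (restr S a) i = (if i \<in> S then mlookup a i else 0)"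
  by (auto simp: restr_def lookup_mapp when_def in_keys_iff)

lemma keys_restr: "mkeys (restr S a) = mkeys a \<inter> S"
  by (auto simp: in_keys_iff split: if_splits)

lemma mdeg_restr: "finite S \<Longrightarrow> mdeg (restr S a) = (\<Sum>i\<in>S. mlookup a i)"
  by (subst mdeg_sum[of S]) (auto simp: keys_restr)

definition mons :: "'a set \<Rightarrow> ('a \<Rightarrow>\<^sub>0 nat) set" where
  "mons S = {a. mkeys a \<subseteq> S}"

lemma mons_iff: "a \<in> mons S \<longleftrightarrow> mkeys a \<subseteq> S" by (simp add: mons_def)
lemma mons_0 [simp]: "0 \<in> mons S" by (simp add: mons_def)
lemma mons_add [simp]: "a + b \<in> mons S \<longleftrightarrow> a \<in> mons S \<and> b \<in> mons S"
  by (simp add: mons_def keys_add_nat)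
lemma mons_single: "x \<in> S \<Longrightarrow> Poly_Mapping.single x k \<in> mons S"
  by (simp add: mons_def)
lemma mons_lookup: "a \<in> mons S \<Longrightarrow> x \<notin> S \<Longrightarrow> mlookup a x = 0"
  by (auto simp: mons_def in_keys_iff)
lemma mons_empty [simp]: "mons {} = {0}" by (auto simp: mons_def)

lemma mons_decomp_single:
  assumes "y \<in> mons S" "y \<noteq> 0"
  shows "\<exists>i\<in>S. \<exists>y'\<in>mons S. y = Poly_Mapping.single i (Suc 0) + y' \<and> mdeg y = Suc (mdeg y')"
proof -
  obtain i where i: "i \<in> mkeys y" using assms(2) by (metis ex_in_conv keys_eq_empty)
  then have iS: "i \<in> S" using assms(1) by (auto simp: mons_iff)
  define b where "b = y - Poly_Mapping.single i (Suc 0)"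
  have e: "y = Poly_Mapping.single i (Suc 0) + b"
    unfolding b_def using i by (intro add_diff_lookup) (auto simp: lookup_single when_def in_keys_iff)
  have "b \<in> mons S" using assms(1) e by (metis mons_add)
  moreover have "mdeg y = Suc (mdeg b)" by (subst e) (simp only: mdeg_add mdeg_single)
  ultimately show ?thesis using e iS by blast
qed

lemma finite_mons_le:
  assumes "finite S"
  shows "finite {a \<in> mons S. mdeg a \<le> N}"
proof -
  have "mlookup ` {a \<in> mons S. mdeg a \<le> N}
      \<subseteq> {f. \<forall>x. (x \<in> S \<longrightarrow> f x \<in> {..N}) \<and> (x \<notin> S \<longrightarrow> f x = 0)}"
    using lookup_le_mdeg le_trans by (fastforce simp: mons_lookup)
  moreover have "finite {f. \<forall>x. (x \<in> S \<longrightarrow> f x \<in> {..N}) \<and> (x \<notin> S \<longrightarrow> f x = (0::nat))}"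
    using assms by (intro finite_set_of_finite_funs) auto
  ultimately have "finite (mlookup ` {a \<in> mons S. mdeg a \<le> N})"
    by (rule finite_subset)
  moreover have "inj_on mlookup {a \<in> mons S. mdeg a \<le> N}"
    by (simp add: inj_on_def)
  ultimately show ?thesis by (rule finite_imageD)
qed

lemma finite_mons_eq: "finite S \<Longrightarrow> finite {a \<in> mons S. mdeg a = N}"
  by (rule finite_subset[OF _ finite_mons_le[of S N]]) auto

lemma mons_insert_decomp:
  assumes "a \<in> mons (insert x S)" "x \<notin> S"
  shows "restr S a \<in> mons S" "a = restr S a + Poly_Mapping.single x (mlookup a x)"
proof -
  show "restr S a \<in> mons S" by (simp add: mons_iff keys_restr)
  show "a = restr S a + Poly_Mapping.single x (mlookup a x)"
    using assms by (intro poly_mapping_eqI)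
      (auto simp: lookup_add lookup_single when_def mons_lookup)
qed

text \<open>Homogenization: the exponent of the new variable \<open>x\<close> absorbs the missing
  degree. It links the counts for degree at most \<open>N\<close> and for degree exactly
  \<open>N\<close>.\<close>

lemma bij_mons_insert_eq:
  assumes "x \<notin> S"
  shows "bij_betw (\<lambda>b. b + Poly_Mapping.single x (N - mdeg b))
    {b \<in> mons S. mdeg b \<le> N} {a \<in> mons (insert x S). mdeg a = N}"
proof (rule bij_betw_byWitness[where f' = "restr S"])
  show "\<forall>b\<in>{b \<in> mons S. mdeg b \<le> N}. restr S (b + Poly_Mapping.single x (N - mdeg b)) = b"
    using assms by (auto intro!: poly_mapping_eqI simp: lookup_add lookup_single when_def mons_lookup)
  have mono: "mons S \<subseteq> mons (insert x S)" by (auto simp: mons_iff)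
  show "\<forall>a\<in>{a \<in> mons (insert x S). mdeg a = N}.
       restr S a + Poly_Mapping.single x (N - mdeg (restr S a)) = a"
  proof
    fix a assume a: "a \<in> {a \<in> mons (insert x S). mdeg a = N}"
    then have e: "a = restr S a + Poly_Mapping.single x (mlookup a x)"
      using mons_insert_decomp(2)[of a x S] assms by simp
    have "mdeg a = mdeg (restr S a) + mlookup a x"
      by (subst e) (simp only: mdeg_add mdeg_single)
    then show "restr S a + Poly_Mapping.single x (N - mdeg (restr S a)) = a"
      using a by (metis (mono_tags, lifting) e mem_Collect_eq add_diff_cancel_left')
  qed
  show "(\<lambda>b. b + Poly_Mapping.single x (N - mdeg b)) ` {b \<in> mons S. mdeg b \<le> N}
    \<subseteq> {a \<in> mons (insert x S). mdeg a = N}"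
    using mono by (auto simp: mons_single)
  show "restr S ` {a \<in> mons (insert x S). mdeg a = N} \<subseteq> {b \<in> mons S. mdeg b \<le> N}"
  proof safe
    fix a assume a: "a \<in> mons (insert x S)" "N = mdeg a"
    show "restr S a \<in> mons S" using mons_insert_decomp(1)[of a x S] a assms by simp
    have e: "a = restr S a + Poly_Mapping.single x (mlookup a x)"
      using mons_insert_decomp(2)[of a x S] assms a by simp
    show "mdeg (restr S a) \<le> mdeg a"
      by (subst (2) e) (simp only: mdeg_add)
  qed
qed

text \<open>Stars and bars. Sorting by degree and removing a variable by homogenization gives a sum
  of counts in one variable less, which the hockey-stick identity adds up.\<close>

lemma card_mons_le:
  assumes "finite S"
  shows "card {a \<in> mons S. mdeg a \<le> N} = (N + card S) choose (card S)"
  using assms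
proof (induction S arbitrary: N rule: finite_induct)
  case empty
  have "{a \<in> mons {}. mdeg a \<le> N} = {0 :: 'a \<Rightarrow>\<^sub>0 nat}" by auto
  then show ?case by simp
next
  case (insert x S)
  have "{a \<in> mons (insert x S). mdeg a \<le> N} = (\<Union>j\<le>N. {a \<in> mons (insert x S). mdeg a = j})"
    by auto
  also have "card \<dots> = (\<Sum>j\<le>N. card {a \<in> mons (insert x S). mdeg a = j})"
    using insert by (intro card_UN_disjoint ballI impI finite_mons_eq) auto
  also have "\<dots> = (\<Sum>j\<le>N. card {a \<in> mons S. mdeg a \<le> j})"
    using bij_betw_same_card[OF bij_mons_insert_eq[OF insert(2)]] by simp
  also have "\<dots> = (\<Sum>j\<le>N. (card S + j) choose j)"
  proof (intro sum.cong refl)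
    fix j
    show "card {a \<in> mons S. mdeg a \<le> j} = (card S + j) choose j"
      using insert.IH binomial_symmetric[of "card S" "j + card S"] by (simp add: add.commute)
  qed
  also have "\<dots> = Suc (card S + N) choose N" by (rule sum_choose_lower)
  also have "\<dots> = (N + card (insert x S)) choose (card (insert x S))"
    using insert binomial_symmetric[of N "Suc (card S + N)"] by (simp add: add.commute Suc_diff_le)
  finally show ?case .
qed

lemma card_mons_eq:
  assumes "finite S" "S \<noteq> {}"
  shows "card {a \<in> mons S. mdeg a = N} = (N + (card S - 1)) choose (card S - 1)"
proof -
  obtain x S' where S: "S = insert x S'" "x \<notin> S'" using assms by (metis ex_in_conv mk_disjoint_insert)
  then show ?thesis
    using bij_betw_same_card[OF bij_mons_insert_eq[OF S(2), of N]] card_mons_le[of S' N] assms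
    by simp
qed

text \<open>Reduces claims about all monomials of large degree to powers of single nodes: if every
  exponent were below \<open>\<sigma>\<close>, the degree would be at most
  \<open>card V * \<sigma>\<close>.\<close>

lemma pigeonhole_mons:
  assumes V: "finite V" and b: "b \<in> mons V" and "card V * \<sigma> + 1 \<le> mdeg b"
  shows "\<exists>v\<in>V. \<exists>b'\<in>mons V. b = Poly_Mapping.single v \<sigma> + b'"
proof -
  have "\<exists>v\<in>V. \<sigma> \<le> mlookup b v"
  proof (rule ccontr)
    assume "\<not> ?thesis"
    then have "(\<Sum>v\<in>V. mlookup b v) \<le> (\<Sum>v\<in>V. \<sigma>)" by (intro sum_mono) auto
    then show False using assms mdeg_sum[OF V, of b] by (simp add: mons_iff)
  qed
  then obtain v where v: "v \<in> V" "\<sigma> \<le> mlookup b v" by blast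
  have e: "b = Poly_Mapping.single v \<sigma> + (b - Poly_Mapping.single v \<sigma>)"
    using v(2) by (intro add_diff_lookup) (auto simp: lookup_single when_def)
  then have "b - Poly_Mapping.single v \<sigma> \<in> mons V" using b by (metis mons_add)
  then show ?thesis using v e by blast
qed

section \<open>Eventually polynomial functions\<close>

definition ev_poly :: "(nat \<Rightarrow> real) \<Rightarrow> bool" where
  "ev_poly f \<longleftrightarrow> (\<exists>p. \<forall>\<^sub>F t in sequentially. f t = poly p (real t))"

lemma ev_poly_zero: "\<forall>\<^sub>F t in sequentially. f t = 0 \<Longrightarrow> ev_poly f"
  unfolding ev_poly_def by (rule exI[of _ 0]) simp

lemma ev_poly_cong: "\<forall>\<^sub>F t in sequentially. f t = g t \<Longrightarrow> ev_poly g \<Longrightarrow> ev_poly f"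
proof -
  assume 1: "\<forall>\<^sub>F t in sequentially. f t = g t" and "ev_poly g"
  then obtain p where "\<forall>\<^sub>F t in sequentially. g t = poly p (real t)" by (auto simp: ev_poly_def)
  with 1 have "\<forall>\<^sub>F t in sequentially. f t = poly p (real t)" by eventually_elim simp
  then show ?thesis unfolding ev_poly_def by blast
qed

lemma ev_poly_add: "ev_poly f \<Longrightarrow> ev_poly g \<Longrightarrow> ev_poly (\<lambda>t. f t + g t)"
  unfolding ev_poly_def
proof safe
  fix p q assume "\<forall>\<^sub>F t in sequentially. f t = poly p (real t)" "\<forall>\<^sub>F t in sequentially. g t = poly q (real t)"
  then have "\<forall>\<^sub>F t in sequentially. f t + g t = poly (p + q) (real t)"
    by eventually_elim simp
  then show "\<exists>p. \<forall>\<^sub>F t in sequentially. f t + g t = poly p (real t)" by blast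
qed

lemma ev_poly_sum: "finite I \<Longrightarrow> (\<And>i. i \<in> I \<Longrightarrow> ev_poly (f i)) \<Longrightarrow> ev_poly (\<lambda>t. \<Sum>i\<in>I. f i t)"
  by (induction I rule: finite_induct) (auto intro: ev_poly_add ev_poly_zero)

lemma ev_poly_shift:
  assumes "ev_poly f"
  shows "ev_poly (\<lambda>t. if j \<le> t then f (t - j) else 0)"
proof -
  obtain p where "\<forall>\<^sub>F t in sequentially. f t = poly p (real t)" using assms by (auto simp: ev_poly_def)
  then obtain T where T: "\<And>t. t \<ge> T \<Longrightarrow> f t = poly p (real t)" by (auto simp: eventually_sequentially)
  show ?thesis unfolding ev_poly_def eventually_sequentially
    by (intro exI[of _ "pcompose p [:- real j, 1:]"] exI[of _ "T + j"])
       (auto simp: poly_pcompose T of_nat_diff)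
qed

text \<open>Discrete integration. The difference of \<open>x ^ (d + 1)\<close> has degree
  \<open>d\<close> and leading coefficient \<open>d + 1\<close>, so subtracting a suitable multiple
  of it from \<open>p\<close> lowers the degree bound.\<close>

lemma poly_antidifference:
  fixes p :: "real poly"
  shows "\<exists>q. \<forall>x. poly q (x + 1) - poly q x = poly p x"
proof -
  have "(\<forall>i\<ge>d. coeff p i = 0) \<Longrightarrow> \<exists>q. pcompose q [:1, 1:] - q = p" for d and p :: "real poly"
  proof (induction d arbitrary: p)
    case 0
    then have "p = 0" by (auto intro: poly_eqI)
    then show ?case by (intro exI[of _ 0]) simp
  next
    case (Suc d)
    define c where "c = coeff p d / real (Suc d)"
    define r where "r = pcompose (monom c (Suc d)) [:1, 1:] - monom c (Suc d)"
    have "pcompose ([:0, 1:] ^ k) [:1, 1:] = ([:1, 1:] :: real poly) ^ k" for k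
      by (induction k) (simp_all only: power_0 pcompose_1 power_Suc pcompose_mult, simp add: pcompose_pCons)
    then have "r = smult c ([:1, 1:] ^ Suc d) - monom c (Suc d)"
      unfolding r_def by (subst (1) monom_altdef) (simp only: pcompose_smult)
    then have r: "coeff r i = c * coeff ([:1, 1:] ^ Suc d) i - (if i = Suc d then c else 0)" for i
      by (simp only: coeff_diff coeff_smult coeff_monom) auto
    have "coeff r i = 0" if "i > d" for i
    proof (cases "i = Suc d")
      case False
      then have "degree ([:1, 1:] ^ Suc d :: real poly) < i"
        using that by (simp only: degree_linear_power)
      then show ?thesis using False by (simp only: r coeff_eq_0) simp
    qed (simp only: r coeff_linear_power, simp)
    moreover have "coeff r d = coeff p d"
    proof -
      have "coeff ([:1, 1:] ^ Suc d :: real poly) d = real (Suc d)"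
        by (subst coeff_linear_poly_power) simp_all
      then show ?thesis by (simp only: r c_def) simp
    qed
    ultimately have rr: "coeff r i = (if i = d then coeff p d else 0)" if "i \<ge> d" for i
      using that by (cases "i = d") auto
    have "\<forall>i\<ge>d. coeff (p - r) i = 0"
      using Suc.prems rr by (auto simp: coeff_diff)
    then obtain q where "pcompose q [:1, 1:] - q = p - r" using Suc.IH by blast
    then show ?case
      by (intro exI[of _ "q + monom c (Suc d)"]) (simp add: pcompose_add r_def algebra_simps)
  qed
  from this[of "Suc (degree p)" p] obtain q where "pcompose q [:1, 1:] - q = p"
    by (meson coeff_eq_0 Suc_le_eq)
  then have "poly q (x + 1) - poly q x = poly p x" for x
    by (simp add: poly_pcompose add.commute flip: \<open>_ = p\<close>)
  then show ?thesis by blast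
qed

lemma ev_poly_cumsum:
  assumes "ev_poly f"
  shows "ev_poly (\<lambda>t. \<Sum>i\<le>t. f i)"
proof -
  obtain p where "\<forall>\<^sub>F t in sequentially. f t = poly p (real t)" using assms by (auto simp: ev_poly_def)
  then obtain T where T: "\<And>t. t \<ge> T \<Longrightarrow> f t = poly p (real t)" by (auto simp: eventually_sequentially)
  obtain q where q: "\<And>x. poly q (x + 1) - poly q x = poly p x" using poly_antidifference by blast
  \<comment> \<open>By telescoping, the sum up to \<open>t\<close> is \<open>q (t + 1)\<close> plus
    a constant; the constant is fixed by the value at \<open>T\<close>, from which on
    \<open>f\<close> is polynomial.\<close>
  define r where "r = pcompose q [:1,1:] + [:(\<Sum>i\<le>T. f i) - poly q (real T + 1):]"
  have "(\<Sum>i\<le>t. f i) = poly r (real t)" if "t \<ge> T" for t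
    using that
  proof (induction t rule: dec_induct)
    case base then show ?case by (simp add: r_def poly_pcompose add.commute)
  next
    case (step t)
    then show ?case using T[of "Suc t"] q[of "real t + 1"] by (simp add: r_def poly_pcompose algebra_simps)
  qed
  then show ?thesis unfolding ev_poly_def eventually_sequentially by blast
qed

text \<open>The slices of a down-set by the value of the last coordinate decrease, hence they stabilize.\<close>

lemma ev_poly_downset_count:
  fixes D :: "(nat \<Rightarrow>\<^sub>0 nat) set"
  assumes "D \<subseteq> mons {..<m}" and "\<And>y z. y + z \<in> D \<Longrightarrow> y \<in> D"
  shows "ev_poly (\<lambda>t. real (card {y \<in> D. mdeg y = t}))"
  using assms
proof (induction m arbitrary: D)
  case 0
  have "\<forall>\<^sub>F t in sequentially. real (card {y \<in> D. mdeg y = t}) = 0"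
    using eventually_gt_at_top[of 0]
  proof eventually_elim
    case (elim t)
    have "{y \<in> D. mdeg y = t} = {}" using 0(1) elim by auto
    then show ?case by (simp only: card.empty of_nat_0)
  qed
  then show ?case by (rule ev_poly_zero)
next
  case (Suc m)
  define s where "s = (\<lambda>j. Poly_Mapping.single m (j::nat))"
  define D' where "D' = (\<lambda>j. {y \<in> mons {..<m}. y + s j \<in> D})"
  define h where "h = (\<lambda>j t. real (card {y \<in> D' j. mdeg y = t}))"
  have S: "{..<Suc m} = insert m {..<m}" by auto
  have D'_down: "y \<in> D' j" if "y + z \<in> D' j" for y z j
  proof -
    have "(y + s j) + z \<in> D" using that by (simp add: D'_def add_ac)
    then show ?thesis using Suc.prems(2) that by (auto simp: D'_def)
  qed
  have h_poly: "ev_poly (h j)" for j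
    unfolding h_def by (rule Suc.IH) (use D'_down in \<open>auto simp: D'_def\<close>)
  have fin: "finite {y \<in> D' j. mdeg y = t}" for j t
    by (rule finite_subset[OF _ finite_mons_eq[of "{..<m}" t]]) (auto simp: D'_def)
  have card_eq: "real (card {y \<in> D. mdeg y = t}) = (\<Sum>j\<le>t. h j (t - j))" for t
  proof -
    have "{y \<in> D. mdeg y = t} = (\<Union>j\<le>t. (\<lambda>y. y + s j) ` {y \<in> D' j. mdeg y = t - j})" (is "?L = ?R")
    proof
      show "?L \<subseteq> ?R"
      proof
        fix y assume y: "y \<in> ?L"
        then have "y \<in> mons (insert m {..<m})" using Suc.prems(1) S by auto
        then have e: "y = restr {..<m} y + s (mlookup y m)" "restr {..<m} y \<in> mons {..<m}"
          using mons_insert_decomp[of y m "{..<m}"] by (auto simp: s_def)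
        have d: "mdeg (restr {..<m} y) + mlookup y m = t"
        proof -
          have "mdeg y = mdeg (restr {..<m} y) + mlookup y m"
            by (subst e(1)) (simp only: mdeg_add s_def mdeg_single)
          then show ?thesis using y by simp
        qed
        have "restr {..<m} y \<in> {z \<in> D' (mlookup y m). mdeg z = t - mlookup y m}"
          using e y d by (auto simp: D'_def)
        then show "y \<in> ?R" using e(1) d by (intro UN_I[of "mlookup y m"] image_eqI) auto
      qed
      show "?R \<subseteq> ?L" by (auto simp: D'_def s_def)
    qed
    moreover have "card ?R = (\<Sum>j\<le>t. card ((\<lambda>y. y + s j) ` {y \<in> D' j. mdeg y = t - j}))"
    proof (rule card_UN_disjoint)
      show "\<forall>i\<in>{..t}. \<forall>j\<in>{..t}. i \<noteq> j \<longrightarrow>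
         (\<lambda>y. y + s i) ` {y \<in> D' i. mdeg y = t - i} \<inter> (\<lambda>y. y + s j) ` {y \<in> D' j. mdeg y = t - j} = {}"
      proof (intro ballI impI, rule ccontr)
        fix i j assume "i \<noteq> j" and "(\<lambda>y. y + s i) ` {y \<in> D' i. mdeg y = t - i} \<inter> (\<lambda>y. y + s j) ` {y \<in> D' j. mdeg y = t - j} \<noteq> {}"
        then obtain y z where yz: "y \<in> D' i" "z \<in> D' j" "y + s i = z + s j" by auto
        from this(1,2) have "mlookup (y + s i) m = i" "mlookup (z + s j) m = j"
          by (simp_all add: lookup_add s_def D'_def mons_lookup[where S = "{..<m}"])
        then show False using yz \<open>i \<noteq> j\<close> by simp
      qed
    qed (use fin in auto)
    moreover have "card ((\<lambda>y. y + s j) ` {y \<in> D' j. mdeg y = t - j}) = card {y \<in> D' j. mdeg y = t - j}" for j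
      by (rule card_image) (simp add: inj_on_def)
    ultimately show ?thesis by (simp add: h_def)
  qed
  obtain J where J: "\<And>j. j \<ge> J \<Longrightarrow> D' j = D' J"
  proof -
    obtain F where F: "finite F" "F \<subseteq> mons {..<Suc m} - D"
      "\<And>x. x \<in> mons {..<Suc m} - D \<Longrightarrow> \<exists>f\<in>F. \<forall>i\<in>{..<Suc m}. mlookup f i \<le> mlookup x i"
      using finite_dickson_basis[of "{..<Suc m}" "mons {..<Suc m} - D" mlookup] by blast
    \<comment> \<open>Beyond the largest last exponent in a basis of the complement of
      \<open>D\<close>, raising the last exponent can no longer lead out of
      \<open>D\<close>.\<close>
    define J where "J = Max (insert 0 ((\<lambda>f. mlookup f m) ` F))"
    have J: "mlookup f m \<le> J" if "f \<in> F" for f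
      using F(1) that by (auto simp: J_def intro!: Max_ge)
    have "D' j = D' J" if "j \<ge> J" for j
    proof
      have "s j = s J + s (j - J)" using that by (simp add: s_def flip: single_add)
      then show "D' j \<subseteq> D' J"
        using Suc.prems(2) by (auto simp: D'_def simp flip: add.assoc)
      show "D' J \<subseteq> D' j"
      proof (rule ccontr)
        assume "\<not> D' J \<subseteq> D' j"
        then obtain y where y: "y \<in> mons {..<m}" "y + s J \<in> D" "y + s j \<notin> D"
          by (auto simp: D'_def)
        have "y \<in> mons {..<Suc m}" using y(1) by (auto simp: mons_iff)
        then have "y + s j \<in> mons {..<Suc m} - D"
          using y by (simp add: s_def mons_single)
        then obtain f where f: "f \<in> F" "\<And>i. i \<in> {..<Suc m} \<Longrightarrow> mlookup f i \<le> mlookup (y + s j) i"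
          using F(3) by meson
        have fm: "f \<in> mons {..<Suc m}" "f \<notin> D" using f(1) F(2) by auto
        have "mlookup f i \<le> mlookup (y + s J) i" for i
        proof (cases "i < m")
          case True
          then show ?thesis using f(2)[of i] by (simp add: lookup_add s_def lookup_single)
        next
          case False
          show ?thesis
          proof (cases "i = m")
            case True
            then show ?thesis using J[OF f(1)] by (simp add: lookup_add s_def)
          next
            case False
            then show ?thesis using \<open>\<not> i < m\<close> fm mons_lookup[of f "{..<Suc m}" i] by auto
          qed
        qed
        then have "y + s J = f + (y + s J - f)" by (rule add_diff_lookup)
        then show False using y(2) fm(2) Suc.prems(2) by metis
      qed
    qed
    then show ?thesis using that by blast
  qed
  have hJ: "h j i = h J i" if "j \<ge> J" for i j
    using J[OF that] by (simp only: h_def)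
  \<comment> \<open>The slices below \<open>J\<close> are treated one by one; all later slices agree
    with slice \<open>J\<close>, so together they form a single cumulative sum.\<close>
  have "ev_poly (\<lambda>t. (\<Sum>j<J. if j \<le> t then h j (t - j) else 0) + (if J \<le> t then \<Sum>i\<le>t - J. h J i else 0))"
    by (intro ev_poly_add ev_poly_sum ev_poly_shift ev_poly_shift[of "\<lambda>t. \<Sum>i\<le>t. h J i"] ev_poly_cumsum h_poly) auto
  moreover have "\<forall>\<^sub>F t in sequentially. real (card {y \<in> D. mdeg y = t}) =
     (\<Sum>j<J. if j \<le> t then h j (t - j) else 0) + (if J \<le> t then \<Sum>i\<le>t - J. h J i else 0)"
    using eventually_ge_at_top[of J]
  proof eventually_elim
    case (elim t)
    have "{..t} = {..<J} \<union> {J..t}" using elim by auto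
    then have "(\<Sum>j\<le>t. h j (t - j)) = (\<Sum>j<J. h j (t - j)) + (\<Sum>j\<in>{J..t}. h j (t - j))"
      by (simp add: sum.union_disjoint ivl_disj_int)
    also have "(\<Sum>j\<in>{J..t}. h j (t - j)) = (\<Sum>j\<in>{J..t}. h J (t - j))"
      by (intro sum.cong refl hJ) auto
    also have "\<dots> = (\<Sum>i\<le>t - J. h J i)"
      using elim by (intro sum.reindex_bij_witness[of _ "\<lambda>i. t - i" "\<lambda>j. t - j"]) auto
    also have "(\<Sum>j<J. h j (t - j)) = (\<Sum>j<J. if j \<le> t then h j (t - j) else 0)"
      using elim by (intro sum.cong) auto
    finally show ?case using elim by (simp add: card_eq)
  qed
  ultimately show ?case by (rule ev_poly_cong[rotated])
qed

text \<open>The disjunction about \<open>L\<close> strengthens the induction: it excludes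
  \<open>L = 0\<close> for a nonzero polynomial, so that the product with \<infinity> in the Horner
  step is again infinite.\<close>

lemma poly_tendsto_ereal:
  fixes p :: "real poly"
  shows "\<exists>L. (\<lambda>t. ereal (poly p (real t))) \<longlonglongrightarrow> L \<and> (L = \<infinity> \<or> L = -\<infinity> \<or> (\<exists>c. p = [:c:]))"
proof (induction p)
  case 0
  show ?case by (intro exI[of _ "ereal 0"]) (auto simp del: ereal_eq_0)
next
  case (pCons c p)
  show ?case
  proof (cases "p = 0")
    case True
    then show ?thesis by (intro exI[of _ "ereal c"]) auto
  next
    case False
    obtain L where L: "(\<lambda>t. ereal (poly p (real t))) \<longlonglongrightarrow> L" "L = \<infinity> \<or> L = -\<infinity> \<or> (\<exists>c. p = [:c:])"
      using pCons by blast
    have "L \<noteq> 0"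
    proof
      assume "L = 0"
      then obtain a where "p = [:a:]" using L(2) by auto
      then have "(\<lambda>t. ereal (poly p (real t))) \<longlonglongrightarrow> ereal a" by simp
      then have "ereal a = 0" using L(1) \<open>L = 0\<close> LIMSEQ_unique by blast
      then show False using False \<open>p = [:a:]\<close> by simp
    qed
    have "(\<lambda>t. ereal (real t)) \<longlonglongrightarrow> \<infinity>"
      using filterlim_real_sequentially tendsto_PInfty_eq_at_top by blast
    then have m: "(\<lambda>t. ereal (real t) * ereal (poly p (real t))) \<longlonglongrightarrow> \<infinity> * L"
      using L(1) \<open>L \<noteq> 0\<close> by (intro tendsto_mult_ereal) auto
    have inf: "\<infinity> * L = \<infinity> \<or> \<infinity> * L = -\<infinity>"
      using \<open>L \<noteq> 0\<close> by (cases L) (auto simp: less_le)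
    then have "(\<lambda>t. ereal c + ereal (real t) * ereal (poly p (real t))) \<longlonglongrightarrow> ereal c + \<infinity> * L"
      using m by (intro tendsto_add_ereal_general) auto
    then show ?thesis using inf by (intro exI[of _ "ereal c + \<infinity> * L"]) auto
  qed
qed

text \<open>Splitting off the constant coefficient cancels one factor \<open>t\<close>, and its own
  contribution tends to 0. After \<open>m\<close> rounds a polynomial without denominator is
  left.\<close>

lemma ev_poly_ratio_convergent:
  assumes "ev_poly f"
  shows "\<exists>L. (\<lambda>t. ereal (f t / real t ^ m)) \<longlonglongrightarrow> L"
proof -
  have main: "\<exists>L. (\<lambda>t. ereal (poly p (real t) / real t ^ m)) \<longlonglongrightarrow> L" for p :: "real poly"
  proof (induction m arbitrary: p)
    case 0
    then show ?case using poly_tendsto_ereal[of p] by auto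
  next
    case (Suc m)
    obtain a q where p: "p = pCons a q" by (cases p)
    obtain L where L: "(\<lambda>t. ereal (poly q (real t) / real t ^ m)) \<longlonglongrightarrow> L" using Suc by blast
    have "(\<lambda>t. a / real t ^ Suc m) \<longlonglongrightarrow> 0" by real_asymp
    then have "(\<lambda>t. ereal (a / real t ^ Suc m)) \<longlonglongrightarrow> ereal 0" by (simp only: lim_ereal)
    then have "(\<lambda>t. ereal (a / real t ^ Suc m) + ereal (poly q (real t) / real t ^ m)) \<longlonglongrightarrow> ereal 0 + L"
      using L by (intro tendsto_add_ereal_general) auto
    moreover have "\<forall>\<^sub>F t in sequentially. ereal (a / real t ^ Suc m) + ereal (poly q (real t) / real t ^ m)
        = ereal (poly p (real t) / real t ^ Suc m)"
      using eventually_gt_at_top[of 0] by eventually_elim (auto simp: p field_simps)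
    ultimately show ?case by (intro exI) (rule Lim_transform_eventually)
  qed
  obtain p where p: "\<forall>\<^sub>F t in sequentially. f t = poly p (real t)" using assms by (auto simp: ev_poly_def)
  obtain L where "(\<lambda>t. ereal (poly p (real t) / real t ^ m)) \<longlonglongrightarrow> L" using main by blast
  moreover have "\<forall>\<^sub>F t in sequentially. ereal (poly p (real t) / real t ^ m) = ereal (f t / real t ^ m)"
    using p by eventually_elim simp
  ultimately show ?thesis by (intro exI) (rule Lim_transform_eventually)
qed

section \<open>Monomial ideals of the local ring\<close>

lemma poly_mapping_sum_singles:
  fixes p :: "'a \<Rightarrow>\<^sub>0 'b::comm_monoid_add"
  shows "p = (\<Sum>a\<in>mkeys p. Poly_Mapping.single a (mlookup p a))"
  by (rule poly_mapping_eqI) (auto simp: lookup_sum lookup_single when_def in_keys_iff)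

lemma lookup_mult_sum:
  fixes p q :: "'a::monoid_add \<Rightarrow>\<^sub>0 'b::semiring_0"
  shows "mlookup (p * q) m =
    (\<Sum>a\<in>mkeys p. \<Sum>b\<in>mkeys q. if a + b = m then mlookup p a * mlookup q b else 0)"
proof -
  have "p * q = (\<Sum>a\<in>mkeys p. \<Sum>b\<in>mkeys q. Poly_Mapping.single (a + b) (mlookup p a * mlookup q b))"
  proof -
    have "p * q = (\<Sum>a\<in>mkeys p. Poly_Mapping.single a (mlookup p a)) * (\<Sum>b\<in>mkeys q. Poly_Mapping.single b (mlookup q b))"
      by (simp only: flip: poly_mapping_sum_singles)
    then show ?thesis by (simp add: sum_product mult_single)
  qed
  then show ?thesis by (simp add: lookup_sum lookup_single when_def)
qed

text \<open>A sum of exponent vectors vanishes only if both do, so the constant coefficient is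
  multiplicative. Hence polynomials with nonzero constant term are closed under products and can
  serve as denominators.\<close>

lemma lookup_mult_0:
  fixes p q :: "('v \<Rightarrow>\<^sub>0 nat) \<Rightarrow>\<^sub>0 'k::field"
  shows "mlookup (p * q) 0 = mlookup p 0 * mlookup q 0"
proof -
  have z: "a + b = 0 \<longleftrightarrow> a = 0 \<and> b = 0" for a b :: "'v \<Rightarrow>\<^sub>0 nat"
  proof
    assume "a + b = 0"
    then have "mdeg a + mdeg b = 0" by (simp only: mdeg_0 flip: mdeg_add)
    then show "a = 0 \<and> b = 0" by simp
  qed simp
  have "mlookup (p * q) 0 = (\<Sum>a\<in>mkeys p. \<Sum>b\<in>mkeys q. if a = 0 then (if b = 0 then mlookup p a * mlookup q b else 0) else 0)"
    unfolding lookup_mult_sum z by (intro sum.cong refl) auto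
  also have "\<dots> = (\<Sum>a\<in>mkeys p. if a = 0 then mlookup p a * mlookup q 0 else 0)"
    by (intro sum.cong refl) (auto simp: in_keys_iff)
  also have "\<dots> = mlookup p 0 * mlookup q 0"
    by (auto simp: in_keys_iff)
  finally show ?thesis .
qed

lemma single_Suc_0_neq_0 [simp]: "Poly_Mapping.single v (Suc 0) \<noteq> 0"
proof
  assume "Poly_Mapping.single v (Suc 0) = 0"
  then have "mlookup (Poly_Mapping.single v (Suc 0)) v = 0" by simp
  then show False by (simp only: lookup_single_eq)
qed

section \<open>Fractions over the polynomial ring\<close>

locale monomial_localization =
  fixes K :: "'k::field itself" and V :: "'v set"
begin

text \<open>\<open>U\<close> is the complement of the origin ideal, and \<open>fr p s\<close> is the fraction \<open>p / s\<close>.\<close>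

definition C :: "('v, 'k) mpoly set" where "C = {p. mkeys p \<subseteq> mons V}"
definition U :: "('v, 'k) mpoly set" where "U = {p \<in> C. mlookup p 0 \<noteq> 0}"
definition R where "R = node_ring K V"
definition fr :: "('v, 'k) mpoly \<Rightarrow> ('v, 'k) mpoly \<Rightarrow> (('v, 'k) mpoly \<times> ('v, 'k) mpoly) set" where
  "fr p s = loc_frac (poly_ring K V) (origin_ideal K V) p s"

lemma C_add [simp]: "p \<in> C \<Longrightarrow> q \<in> C \<Longrightarrow> p + q \<in> C"
  using Poly_Mapping.keys_add[of p q] unfolding C_def by blast

lemma C_mult [simp]: "p \<in> C \<Longrightarrow> q \<in> C \<Longrightarrow> p * q \<in> C"
  using keys_mult[of p q] unfolding C_def by fastforce

lemma C_0 [simp]: "0 \<in> C" by (simp add: C_def)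
lemma C_1 [simp]: "1 \<in> C" by (simp add: C_def)
lemma C_uminus [simp]: "p \<in> C \<Longrightarrow> - p \<in> C"
  by (auto simp: C_def in_keys_iff)
lemma C_single [simp]: "a \<in> mons V \<Longrightarrow> Poly_Mapping.single a c \<in> C"
  by (auto simp: C_def)
lemma C_sum: "(\<And>i. i \<in> I \<Longrightarrow> f i \<in> C) \<Longrightarrow> (\<Sum>i\<in>I. f i) \<in> C"
  by (induction I rule: infinite_finite_induct) auto

lemma U_C: "s \<in> U \<Longrightarrow> s \<in> C" by (simp add: U_def)
lemma U_1 [simp]: "1 \<in> U" by (simp add: U_def)
lemma U_mult [simp]: "s \<in> U \<Longrightarrow> t \<in> U \<Longrightarrow> s * t \<in> U"
  by (simp add: U_def lookup_mult_0)

lemma poly_ring_simps: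
  "carrier (poly_ring K V) = C" "p \<otimes>\<^bsub>poly_ring K V\<^esub> q = p * q" "\<one>\<^bsub>poly_ring K V\<^esub> = 1"
  "\<zero>\<^bsub>poly_ring K V\<^esub> = 0" "p \<oplus>\<^bsub>poly_ring K V\<^esub> q = p + q"
  by (auto simp: poly_ring_def C_def mons_def)

lemma cring_poly_ring: "cring (poly_ring K V)"
proof (rule cringI)
  show "abelian_group (poly_ring K V)"
  proof (rule abelian_groupI)
    fix x assume "x \<in> carrier (poly_ring K V)"
    then show "\<exists>y\<in>carrier (poly_ring K V). y \<oplus>\<^bsub>poly_ring K V\<^esub> x = \<zero>\<^bsub>poly_ring K V\<^esub>"
      by (intro bexI[of _ "- x"]) (simp_all add: poly_ring_simps)
  qed (simp_all add: poly_ring_simps add_ac)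
  show "comm_monoid (poly_ring K V)"
    by (rule comm_monoidI) (simp_all add: poly_ring_simps mult_ac)
qed (simp add: poly_ring_simps distrib_right)

lemma a_inv_poly_ring: "p \<in> C \<Longrightarrow> \<ominus>\<^bsub>poly_ring K V\<^esub> p = - p"
proof -
  interpret cring "poly_ring K V" by (rule cring_poly_ring)
  assume "p \<in> C"
  then show ?thesis by (intro minus_equality) (simp_all add: poly_ring_simps)
qed

lemma ideal_poly_ringI:
  assumes "I \<subseteq> C" "0 \<in> I" "\<And>p q. p \<in> I \<Longrightarrow> q \<in> I \<Longrightarrow> p + q \<in> I"
    "\<And>p q. p \<in> I \<Longrightarrow> q \<in> C \<Longrightarrow> q * p \<in> I"
  shows "ideal I (poly_ring K V)"
proof -
  interpret cring "poly_ring K V" by (rule cring_poly_ring)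
  show ?thesis
  proof (rule idealI)
    show "ring (poly_ring K V)" by (rule ring_axioms)
    show "subgroup I (add_monoid (poly_ring K V))"
    proof (rule add.subgroupI)
      fix a assume a: "a \<in> I"
      then have "- 1 * a \<in> I" by (intro assms(4)) simp_all
      then show "\<ominus>\<^bsub>poly_ring K V\<^esub> a \<in> I"
        using a assms(1) by (simp add: a_inv_poly_ring subset_iff)
    qed (use assms in \<open>auto simp: poly_ring_simps\<close>)
  qed (use assms in \<open>auto simp: poly_ring_simps mult.commute\<close>)
qed

text \<open>A monomial other than 1 has some \<open>indet v\<close> as a factor, so a polynomial
  without constant term is a combination of indeterminates. This identifies the denominators of
  \<open>node_ring\<close>.\<close>

lemma origin_ideal_eq: "origin_ideal K V = {p \<in> C. mlookup p 0 = 0}"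
proof
  have "ideal {p \<in> C. mlookup p 0 = 0} (poly_ring K V)"
    by (rule ideal_poly_ringI) (auto simp: lookup_add lookup_mult_0)
  moreover have "indet ` V \<subseteq> {p \<in> C. mlookup p 0 = 0}"
  proof clarify
    fix v assume "v \<in> V"
    show "indet v \<in> C \<and> mlookup (indet v :: ('v, 'k) mpoly) 0 = 0"
      using \<open>v \<in> V\<close> unfolding indet_def
      by (intro conjI C_single mons_single lookup_single_not_eq) auto
  qed
  ultimately show "origin_ideal K V \<subseteq> {p \<in> C. mlookup p 0 = 0}"
    unfolding origin_ideal_def genideal_def by blast
  show "{p \<in> C. mlookup p 0 = 0} \<subseteq> origin_ideal K V"
  proof
    fix p assume p: "p \<in> {p \<in> C. mlookup p 0 = 0}"
    show "p \<in> origin_ideal K V"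
      unfolding origin_ideal_def genideal_def
    proof clarify
      fix I assume I: "ideal I (poly_ring K V)" "indet ` V \<subseteq> I"
      interpret I: ideal I "poly_ring K V" by (rule I)
      have 0: "0 \<in> I" using additive_subgroup.zero_closed[OF I.is_additive_subgroup] by (simp add: poly_ring_simps)
      have add: "x + y \<in> I" if "x \<in> I" "y \<in> I" for x y
        using additive_subgroup.a_closed[OF I.is_additive_subgroup that] by (simp add: poly_ring_simps)
      have tm: "Poly_Mapping.single a c \<in> I" if a: "a \<in> mons V" "a \<noteq> 0" for a c
      proof -
        obtain v b where e: "v \<in> V" "b \<in> mons V" "a = Poly_Mapping.single v (Suc 0) + b"
          using mons_decomp_single[OF a] by blast
        have "Poly_Mapping.single b c * indet v \<in> I"
          using I.I_l_closed[of "indet v" "Poly_Mapping.single b c"] I(2) e(1,2)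
          by (auto simp: poly_ring_simps)
        then show ?thesis unfolding e(3) by (simp add: indet_def mult_single add.commute)
      qed
      have "(\<Sum>a\<in>F. Poly_Mapping.single a (mlookup p a)) \<in> I" if "finite F" "F \<subseteq> mkeys p" for F
        using that
      proof (induction F rule: finite_induct)
        case (insert a F)
        then have "a \<in> mons V" "a \<noteq> 0" using p by (auto simp: C_def in_keys_iff)
        then show ?case using insert tm by (simp add: add)
      qed (simp add: 0)
      then show "p \<in> I" using poly_mapping_sum_singles[of p] by (metis finite_keys subset_refl)
    qed
  qed
qed

lemma C_minus_origin: "C - origin_ideal K V = U"
  by (auto simp: origin_ideal_eq U_def)

lemma loc_rel_iff:
  "((p, s), (q, t)) \<in> loc_rel (poly_ring K V) (origin_ideal K V) \<longleftrightarrow>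
     p \<in> C \<and> q \<in> C \<and> s \<in> U \<and> t \<in> U \<and> (\<exists>u\<in>U. u * (p * t) = u * (q * s))"
  by (simp add: loc_rel_def poly_ring_simps C_minus_origin)

lemma equiv_loc_rel: "equiv (C \<times> U) (loc_rel (poly_ring K V) (origin_ideal K V))"
proof (rule equivI)
  let ?r = "loc_rel (poly_ring K V) (origin_ideal K V)"
  show "?r \<subseteq> (C \<times> U) \<times> C \<times> U" by (auto simp: loc_rel_iff)
  show "refl_on (C \<times> U) ?r"
    by (auto simp: refl_on_def loc_rel_iff intro: bexI[of _ 1])
  show "sym ?r" by (rule symI) (auto simp: loc_rel_iff, metis)
  show "trans ?r"
  proof (rule transI, clarify)
    fix p s q t p' s' assume "((p, s), (q, t)) \<in> ?r" "((q, t), (p', s')) \<in> ?r"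
    then obtain u u' where u: "p \<in> C" "p' \<in> C" "s \<in> U" "s' \<in> U" "t \<in> U" "u \<in> U" "u' \<in> U"
      and e: "u * (p * t) = u * (q * s)" "u' * (q * s') = u' * (p' * t)" by (auto simp: loc_rel_iff)
    \<comment> \<open>The middle denominator \<open>t\<close> becomes part of the witness, since
      equality of fractions holds only up to a factor in \<open>U\<close>.\<close>
    have "(u * u' * t) * (p * s') = u' * s' * (u * (p * t))" by (simp add: mult_ac)
    also have "\<dots> = u * s * (u' * (q * s'))" unfolding e(1) by (simp add: mult_ac)
    also have "\<dots> = (u * u' * t) * (p' * s)" unfolding e(2) by (simp add: mult_ac)
    finally show "((p, s), (p', s')) \<in> ?r"
      using u by (auto simp: loc_rel_iff intro!: bexI[of _ "u * u' * t"])
  qed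
qed

lemma fr_eq_iff:
  assumes "p \<in> C" "s \<in> U" "q \<in> C" "t \<in> U"
  shows "fr p s = fr q t \<longleftrightarrow> (\<exists>u\<in>U. u * (p * t) = u * (q * s))"
  unfolding fr_def loc_frac_def
  using eq_equiv_class_iff[OF equiv_loc_rel, of "(p, s)" "(q, t)"] assms
  by (simp add: loc_rel_iff)

lemma fr_eqI:
  assumes "p \<in> C" "s \<in> U" "q \<in> C" "t \<in> U" "p * t = q * s"
  shows "fr p s = fr q t"
  using assms by (subst fr_eq_iff) (auto intro!: bexI[of _ 1])

lemma fr_iff: "x \<in> fr p s \<longleftrightarrow> (\<exists>q t. x = (q, t) \<and> p \<in> C \<and> q \<in> C \<and> s \<in> U \<and> t \<in> U \<and> fr p s = fr q t)"
proof -
  have "(q, t) \<in> fr p s \<longleftrightarrow> p \<in> C \<and> q \<in> C \<and> s \<in> U \<and> t \<in> U \<and> (\<exists>u\<in>U. u * (p * t) = u * (q * s))" for q t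
    by (simp only: fr_def loc_frac_def Image_singleton_iff loc_rel_iff)
  then have "(q, t) \<in> fr p s \<longleftrightarrow> p \<in> C \<and> q \<in> C \<and> s \<in> U \<and> t \<in> U \<and> fr p s = fr q t" for q t
    using fr_eq_iff[of p s q t] by blast
  then show ?thesis by (cases x) simp
qed

lemma R_simps:
  "carrier R = {fr p s | p s. p \<in> C \<and> s \<in> U}"
  "\<one>\<^bsub>R\<^esub> = fr 1 1" "\<zero>\<^bsub>R\<^esub> = fr 0 1"
  by (auto simp: R_def node_ring_def localization_def fr_def poly_ring_simps C_minus_origin)

lemma fr_closed [simp]: "p \<in> C \<Longrightarrow> s \<in> U \<Longrightarrow> fr p s \<in> carrier R"
  by (auto simp: R_simps)

lemma fr_cases:
  assumes "x \<in> carrier R"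
  obtains p s where "x = fr p s" "p \<in> C" "s \<in> U"
  using assms by (auto simp: R_simps)

lemma fr_mult [simp]:
  assumes "p \<in> C" "s \<in> U" "q \<in> C" "t \<in> U"
  shows "fr p s \<otimes>\<^bsub>R\<^esub> fr q t = fr (p * q) (s * t)"
proof -
  have eq: "fr (fst x * fst y) (snd x * snd y) = fr (p * q) (s * t)"
    if "x \<in> fr p s" "y \<in> fr q t" for x y
  proof -
    obtain p' s' q' t' where x: "x = (p', s')" "p' \<in> C" "s' \<in> U" "fr p s = fr p' s'"
      and y: "y = (q', t')" "q' \<in> C" "t' \<in> U" "fr q t = fr q' t'"
      using \<open>x \<in> _\<close> \<open>y \<in> _\<close> unfolding fr_iff by blast
    obtain u w where u: "u \<in> U" "u * (p * s') = u * (p' * s)" and w: "w \<in> U" "w * (q * t') = w * (q' * t)"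
      using x y assms by (auto simp: fr_eq_iff)
    have "(u * w) * ((p' * q') * (s * t)) = (u * (p' * s)) * (w * (q' * t))" by (simp add: mult_ac)
    also have "\<dots> = (u * w) * ((p * q) * (s' * t'))" unfolding u(2)[symmetric] w(2)[symmetric] by (simp add: mult_ac)
    finally show ?thesis
      using x y assms u w by (simp add: fr_eq_iff) (metis U_mult)
  qed
  \<comment> \<open>A union of equal sets has their common value only if the index sets are
    nonempty.\<close>
  have ne: "(p, s) \<in> fr p s" "(q, t) \<in> fr q t" using assms by (auto simp: fr_iff)
  have "fr p s \<otimes>\<^bsub>R\<^esub> fr q t = (\<Union>x\<in>fr p s. \<Union>y\<in>fr q t. fr (fst x * fst y) (snd x * snd y))"
    by (simp add: R_def node_ring_def localization_def fr_def poly_ring_simps)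
  also have "\<dots> = (\<Union>x\<in>fr p s. \<Union>y\<in>fr q t. fr (p * q) (s * t))"
    using eq by (intro SUP_cong refl) blast
  also have "\<dots> = fr (p * q) (s * t)" using ne by blast
  finally show ?thesis .
qed

lemma fr_add [simp]:
  assumes "p \<in> C" "s \<in> U" "q \<in> C" "t \<in> U"
  shows "fr p s \<oplus>\<^bsub>R\<^esub> fr q t = fr (p * t + q * s) (s * t)"
proof -
  have eq: "fr (fst x * snd y + fst y * snd x) (snd x * snd y) = fr (p * t + q * s) (s * t)"
    if "x \<in> fr p s" "y \<in> fr q t" for x y
  proof -
    obtain p' s' q' t' where x: "x = (p', s')" "p' \<in> C" "s' \<in> U" "fr p s = fr p' s'"
      and y: "y = (q', t')" "q' \<in> C" "t' \<in> U" "fr q t = fr q' t'"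
      using \<open>x \<in> _\<close> \<open>y \<in> _\<close> unfolding fr_iff by blast
    obtain u w where u: "u \<in> U" "u * (p * s') = u * (p' * s)" and w: "w \<in> U" "w * (q * t') = w * (q' * t)"
      using x y assms by (auto simp: fr_eq_iff)
    have "(u * w) * ((p' * t' + q' * s') * (s * t)) =
        (u * (p' * s)) * (w * (t' * t)) + (u * (s' * s)) * (w * (q' * t))" by (simp add: algebra_simps)
    also have "\<dots> = (u * w) * ((p * t + q * s) * (s' * t'))"
      unfolding u(2)[symmetric] w(2)[symmetric] by (simp add: algebra_simps)
    finally show ?thesis
      using x y assms u w by (simp add: fr_eq_iff U_C) (metis U_mult)
  qed
  have ne: "(p, s) \<in> fr p s" "(q, t) \<in> fr q t" using assms by (auto simp: fr_iff)
  have "fr p s \<oplus>\<^bsub>R\<^esub> fr q t = (\<Union>x\<in>fr p s. \<Union>y\<in>fr q t. fr (fst x * snd y + fst y * snd x) (snd x * snd y))"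
    by (simp add: R_def node_ring_def localization_def fr_def poly_ring_simps)
  also have "\<dots> = (\<Union>x\<in>fr p s. \<Union>y\<in>fr q t. fr (p * t + q * s) (s * t))"
    using eq by (intro SUP_cong refl) blast
  also have "\<dots> = fr (p * t + q * s) (s * t)" using ne by blast
  finally show ?thesis .
qed

lemma cring_R: "cring R"
proof (rule cringI)
  show "abelian_group R"
  proof (rule abelian_groupI)
    fix x y z assume "x \<in> carrier R" "y \<in> carrier R" "z \<in> carrier R"
    then obtain p s q t r w where [simp]: "x = fr p s" "p \<in> C" "s \<in> U" "y = fr q t" "q \<in> C" "t \<in> U"
      "z = fr r w" "r \<in> C" "w \<in> U" by (elim fr_cases)
    show "x \<oplus>\<^bsub>R\<^esub> y \<in> carrier R" by (simp add: U_C)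
    show "x \<oplus>\<^bsub>R\<^esub> y \<oplus>\<^bsub>R\<^esub> z = x \<oplus>\<^bsub>R\<^esub> (y \<oplus>\<^bsub>R\<^esub> z)"
      by (simp add: U_C, rule fr_eqI) (simp_all add: U_C algebra_simps)
    show "x \<oplus>\<^bsub>R\<^esub> y = y \<oplus>\<^bsub>R\<^esub> x"
      by (simp add: U_C, rule fr_eqI) (simp_all add: U_C algebra_simps)
  next
    fix x assume "x \<in> carrier R"
    then obtain p s where [simp]: "x = fr p s" "p \<in> C" "s \<in> U" by (rule fr_cases)
    show "\<zero>\<^bsub>R\<^esub> \<oplus>\<^bsub>R\<^esub> x = x" by (simp add: R_simps(3) U_C)
    have "fr (- p) s \<oplus>\<^bsub>R\<^esub> x = \<zero>\<^bsub>R\<^esub>" by (simp add: R_simps(3) U_C, rule fr_eqI) (simp_all add: U_C)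
    then show "\<exists>y\<in>carrier R. y \<oplus>\<^bsub>R\<^esub> x = \<zero>\<^bsub>R\<^esub>" by (rule bexI) simp
  qed (simp add: R_simps(3))
  show "comm_monoid R"
  proof (rule comm_monoidI)
    fix x y z assume "x \<in> carrier R" "y \<in> carrier R" "z \<in> carrier R"
    then obtain p s q t r w where [simp]: "x = fr p s" "p \<in> C" "s \<in> U" "y = fr q t" "q \<in> C" "t \<in> U"
      "z = fr r w" "r \<in> C" "w \<in> U" by (elim fr_cases)
    show "x \<otimes>\<^bsub>R\<^esub> y \<in> carrier R" by simp
    show "x \<otimes>\<^bsub>R\<^esub> y \<otimes>\<^bsub>R\<^esub> z = x \<otimes>\<^bsub>R\<^esub> (y \<otimes>\<^bsub>R\<^esub> z)" by (simp add: mult_ac)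
    show "x \<otimes>\<^bsub>R\<^esub> y = y \<otimes>\<^bsub>R\<^esub> x" by (simp add: mult_ac)
  next
    fix x assume "x \<in> carrier R"
    then obtain p s where [simp]: "x = fr p s" "p \<in> C" "s \<in> U" by (rule fr_cases)
    show "\<one>\<^bsub>R\<^esub> \<otimes>\<^bsub>R\<^esub> x = x" by (simp add: R_simps(2))
  qed (simp add: R_simps(2))
next
  fix x y z assume "x \<in> carrier R" "y \<in> carrier R" "z \<in> carrier R"
  then obtain p s q t r w where [simp]: "x = fr p s" "p \<in> C" "s \<in> U" "y = fr q t" "q \<in> C" "t \<in> U"
    "z = fr r w" "r \<in> C" "w \<in> U" by (elim fr_cases)
  show "(x \<oplus>\<^bsub>R\<^esub> y) \<otimes>\<^bsub>R\<^esub> z = x \<otimes>\<^bsub>R\<^esub> z \<oplus>\<^bsub>R\<^esub> y \<otimes>\<^bsub>R\<^esub> z"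
    by (simp add: U_C, rule fr_eqI) (simp_all add: U_C algebra_simps)
qed

lemma fr_cancel: "p \<in> C \<Longrightarrow> s \<in> U \<Longrightarrow> u \<in> U \<Longrightarrow> fr (u * p) (u * s) = fr p s"
  by (intro fr_eqI) (auto simp: U_C mult_ac)

lemma fr_add_same: "p \<in> C \<Longrightarrow> q \<in> C \<Longrightarrow> s \<in> U \<Longrightarrow> fr p s \<oplus>\<^bsub>R\<^esub> fr q s = fr (p + q) s"
  by (simp add: U_C, rule fr_eqI) (simp_all add: U_C algebra_simps)

lemma fr_0: "s \<in> U \<Longrightarrow> fr 0 s = \<zero>\<^bsub>R\<^esub>"
  unfolding R_simps by (intro fr_eqI) (auto simp: U_C)

lemma R_minus: "p \<in> C \<Longrightarrow> s \<in> U \<Longrightarrow> \<ominus>\<^bsub>R\<^esub> fr p s = fr (- p) s"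
proof -
  interpret cring R by (rule cring_R)
  assume "p \<in> C" "s \<in> U"
  then show ?thesis by (intro minus_equality) (simp_all add: fr_add_same fr_0 del: fr_add)
qed

lemma ideal_RI:
  assumes "I \<subseteq> carrier R" "\<zero>\<^bsub>R\<^esub> \<in> I" "\<And>p q. p \<in> I \<Longrightarrow> q \<in> I \<Longrightarrow> p \<oplus>\<^bsub>R\<^esub> q \<in> I"
    "\<And>p q. p \<in> I \<Longrightarrow> q \<in> carrier R \<Longrightarrow> q \<otimes>\<^bsub>R\<^esub> p \<in> I"
  shows "ideal I R"
proof -
  interpret cring R by (rule cring_R)
  show ?thesis
  proof (rule idealI)
    show "ring R" by (rule ring_axioms)
    show "subgroup I (add_monoid R)"
    proof (rule add.subgroupI)
      fix a assume a: "a \<in> I"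
      then have "\<ominus>\<^bsub>R\<^esub> \<one>\<^bsub>R\<^esub> \<otimes>\<^bsub>R\<^esub> a \<in> I" by (intro assms(4)) simp_all
      moreover have "\<ominus>\<^bsub>R\<^esub> \<one>\<^bsub>R\<^esub> \<otimes>\<^bsub>R\<^esub> a = \<ominus>\<^bsub>R\<^esub> a" using a assms(1) by (simp add: l_minus subset_iff)
      ultimately show "\<ominus>\<^bsub>R\<^esub> a \<in> I" by simp
    qed (use assms in auto)
    show "x \<otimes>\<^bsub>R\<^esub> a \<in> I" "a \<otimes>\<^bsub>R\<^esub> x \<in> I" if "a \<in> I" "x \<in> carrier R" for a x
      using assms that by (auto simp: m_comm subset_iff)
  qed
qed

section \<open>Ideals given by upsets of exponent vectors\<close>

definition upset :: "('v \<Rightarrow>\<^sub>0 nat) set \<Rightarrow> bool" where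
  "upset A \<longleftrightarrow> A \<subseteq> mons V \<and> (\<forall>a\<in>A. \<forall>b\<in>mons V. a + b \<in> A)"

text \<open>For an upset \<open>A\<close>, this is the ideal of the local ring generated by the monomials in \<open>A\<close>.\<close>

definition J :: "('v \<Rightarrow>\<^sub>0 nat) set \<Rightarrow> (('v, 'k) mpoly \<times> ('v, 'k) mpoly) set set" where
  "J A = {fr p s | p s. mkeys p \<subseteq> A \<and> s \<in> U}"

lemma upset_keys_mult: "upset A \<Longrightarrow> mkeys p \<subseteq> A \<Longrightarrow> q \<in> C \<Longrightarrow> mkeys (q * p) \<subseteq> A"
proof
  fix x assume A: "upset A" "mkeys p \<subseteq> A" "q \<in> C" and "x \<in> mkeys (q * p)"
  then obtain a b where x: "x = a + b" "a \<in> mkeys q" "b \<in> mkeys p" using keys_mult[of q p] by blast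
  then have "b + a \<in> A" using A unfolding upset_def C_def by blast
  then show "x \<in> A" using x by (simp add: add.commute)
qed

lemma upset_C: "upset A \<Longrightarrow> mkeys p \<subseteq> A \<Longrightarrow> p \<in> C"
  by (auto simp: upset_def C_def)

lemma keys_add_subset: "mkeys p \<subseteq> A \<Longrightarrow> mkeys q \<subseteq> A \<Longrightarrow> mkeys (p + q) \<subseteq> A"
  using Poly_Mapping.keys_add[of p q] by blast

lemma J_cases:
  assumes "x \<in> J A" "upset A"
  obtains p s where "x = fr p s" "mkeys p \<subseteq> A" "p \<in> C" "s \<in> U"
proof -
  obtain p s where "x = fr p s" "mkeys p \<subseteq> A" "s \<in> U" using assms(1) unfolding J_def by blast
  then show thesis using that upset_C[OF assms(2)] by blast
qed

lemma J_I: "mkeys p \<subseteq> A \<Longrightarrow> s \<in> U \<Longrightarrow> fr p s \<in> J A" by (auto simp: J_def)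

lemma J_mono: "A \<subseteq> B \<Longrightarrow> J A \<subseteq> J B" unfolding J_def by blast

lemma J_carrier: "upset A \<Longrightarrow> J A \<subseteq> carrier R"
  by (auto elim!: J_cases)

lemma J_ideal:
  assumes "upset A"
  shows "ideal (J A) R"
proof (rule ideal_RI)
  show "J A \<subseteq> carrier R" by (rule J_carrier[OF assms])
  show "\<zero>\<^bsub>R\<^esub> \<in> J A" unfolding R_simps by (rule J_I) auto
  show "x \<oplus>\<^bsub>R\<^esub> y \<in> J A" if xy: "x \<in> J A" "y \<in> J A" for x y
  proof -
    obtain p s where [simp]: "x = fr p s" "mkeys p \<subseteq> A" "p \<in> C" "s \<in> U"
      by (rule J_cases[OF xy(1) assms])
    obtain q t where [simp]: "y = fr q t" "mkeys q \<subseteq> A" "q \<in> C" "t \<in> U"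
      by (rule J_cases[OF xy(2) assms])
    have "mkeys (t * p + s * q) \<subseteq> A"
      using assms by (intro keys_add_subset upset_keys_mult) (auto simp: U_C)
    then show ?thesis by (simp add: J_I mult.commute)
  qed
  show "y \<otimes>\<^bsub>R\<^esub> x \<in> J A" if xy: "x \<in> J A" "y \<in> carrier R" for x y
  proof -
    obtain p s where [simp]: "x = fr p s" "mkeys p \<subseteq> A" "p \<in> C" "s \<in> U"
      by (rule J_cases[OF xy(1) assms])
    obtain q t where [simp]: "y = fr q t" "q \<in> C" "t \<in> U"
      by (rule fr_cases[OF xy(2)])
    show ?thesis using assms by (simp add: J_I upset_keys_mult)
  qed
qed

text \<open>The definition of \<open>J\<close> asks for some suitable numerator; this criterion
  applies to any given fraction, at the price of a factor \<open>u\<close> that comes from equality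
  of fractions.\<close>

lemma J_mem:
  assumes "upset A" "p \<in> C" "s \<in> U"
  shows "fr p s \<in> J A \<longleftrightarrow> (\<exists>u\<in>U. mkeys (u * p) \<subseteq> A)"
proof
  assume "fr p s \<in> J A"
  then obtain q t where q: "fr p s = fr q t" "mkeys q \<subseteq> A" "q \<in> C" "t \<in> U"
    using assms(1) by (rule J_cases)
  then obtain u where u: "u \<in> U" "u * (p * t) = u * (q * s)" using assms by (auto simp: fr_eq_iff)
  have "(u * t) * p = (u * s) * q" using u(2) by (simp add: mult_ac)
  then show "\<exists>u\<in>U. mkeys (u * p) \<subseteq> A"
    using u q assms upset_keys_mult[of A q "u * s"] by (intro bexI[of _ "u * t"]) (auto simp: U_C)
next
  assume "\<exists>u\<in>U. mkeys (u * p) \<subseteq> A"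
  then obtain u where u: "u \<in> U" "mkeys (u * p) \<subseteq> A" by blast
  then have "fr (u * p) (u * s) \<in> J A" using assms by (intro J_I) auto
  then show "fr p s \<in> J A" using fr_cancel u assms by simp
qed

text \<open>For one monomial the factor \<open>u\<close> of \<open>J_mem\<close> does no harm: its
  constant term is nonzero, so \<open>a\<close> itself occurs in the product. In particular
  \<open>J\<close> determines the upset.\<close>

lemma J_single_iff:
  assumes "upset A" "a \<in> mons V" "s \<in> U"
  shows "fr (Poly_Mapping.single a 1) s \<in> J A \<longleftrightarrow> a \<in> A"
proof
  assume "fr (Poly_Mapping.single a 1) s \<in> J A"
  then obtain u where u: "u \<in> U" "mkeys (u * Poly_Mapping.single a 1) \<subseteq> A"
    using J_mem assms by auto
  have "mlookup (u * Poly_Mapping.single a 1) a = (\<Sum>b\<in>mkeys u. if b = 0 then mlookup u b else 0)"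
  proof -
    have e: "b + a = a \<longleftrightarrow> b = 0" for b by simp
    show ?thesis unfolding lookup_mult_sum
      by (intro sum.cong refl) (simp add: e del: sum.delta)
  qed
  also have "\<dots> = mlookup u 0" by (auto simp: in_keys_iff)
  finally have "a \<in> mkeys (u * Poly_Mapping.single a 1)" using u(1) by (simp add: in_keys_iff U_def)
  then show "a \<in> A" using u by blast
qed (use assms in \<open>auto intro!: J_I\<close>)

text \<open>Every element of \<open>J A\<close> is a finite sum of terms over one common
  denominator, so an additively closed set need only be tested on single terms.\<close>

lemma J_subsetI:
  assumes A: "upset A" and z: "\<zero>\<^bsub>R\<^esub> \<in> X" and add: "\<And>x y. x \<in> X \<Longrightarrow> y \<in> X \<Longrightarrow> x \<oplus>\<^bsub>R\<^esub> y \<in> X"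
    and t: "\<And>a c s. a \<in> A \<Longrightarrow> s \<in> U \<Longrightarrow> fr (Poly_Mapping.single a c) s \<in> X"
  shows "J A \<subseteq> X"
proof
  fix x assume "x \<in> J A"
  then obtain p s where x: "x = fr p s" "mkeys p \<subseteq> A" "s \<in> U" using A by (rule J_cases)
  have AV: "A \<subseteq> mons V" using A by (simp add: upset_def)
  have "fr (\<Sum>a\<in>F. Poly_Mapping.single a (mlookup p a)) s \<in> X" if "finite F" "F \<subseteq> A" for F
    using that
  proof (induction F rule: finite_induct)
    case empty
    then show ?case using z x by (simp add: fr_0)
  next
    case (insert a F)
    have "fr (Poly_Mapping.single a (mlookup p a) + (\<Sum>a\<in>F. Poly_Mapping.single a (mlookup p a))) s
      = fr (Poly_Mapping.single a (mlookup p a)) s \<oplus>\<^bsub>R\<^esub> fr (\<Sum>a\<in>F. Poly_Mapping.single a (mlookup p a)) s"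
      using insert AV x by (intro fr_add_same[symmetric] C_sum C_single) auto
    then show ?case using insert t x add by simp
  qed
  then show "x \<in> X" using x poly_mapping_sum_singles[of p] by (metis finite_keys)
qed

section \<open>Products and powers of monomial ideals\<close>

definition msum :: "('v \<Rightarrow>\<^sub>0 nat) set \<Rightarrow> ('v \<Rightarrow>\<^sub>0 nat) set \<Rightarrow> ('v \<Rightarrow>\<^sub>0 nat) set" where
  "msum A B = {a + b | a b. a \<in> A \<and> b \<in> B}"

lemma upset_msum: "upset A \<Longrightarrow> B \<subseteq> mons V \<Longrightarrow> upset (msum A B)"
proof -
  assume A: "upset A" "B \<subseteq> mons V"
  have "a + b + c \<in> msum A B" if "a \<in> A" "b \<in> B" "c \<in> mons V" for a b c
  proof -
    have "a + c \<in> A" using A that by (auto simp: upset_def)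
    then have "(a + c) + b \<in> msum A B" using that unfolding msum_def by blast
    then show ?thesis by (simp add: add_ac)
  qed
  moreover have "msum A B \<subseteq> mons V" using A by (auto simp: upset_def msum_def)
  ultimately show ?thesis unfolding upset_def by (auto simp: msum_def)
qed

lemma J_prod:
  assumes A: "upset A" and B: "upset B"
  shows "ideal_prod R (J A) (J B) = J (msum A B)"
proof
  have AB: "upset (msum A B)" using A B by (intro upset_msum) (auto simp: upset_def)
  interpret ideal "J (msum A B)" R by (rule J_ideal[OF AB])
  show "ideal_prod R (J A) (J B) \<subseteq> J (msum A B)"
  proof
    fix x assume "x \<in> ideal_prod R (J A) (J B)"
    then show "x \<in> J (msum A B)"
    proof induction
      case (prod x y)
      obtain p s where [simp]: "x = fr p s" "p \<in> C" "s \<in> U" and p: "mkeys p \<subseteq> A"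
        by (rule J_cases[OF prod(1) A])
      obtain q t where [simp]: "y = fr q t" "q \<in> C" "t \<in> U" and q: "mkeys q \<subseteq> B"
        by (rule J_cases[OF prod(2) B])
      have "mkeys (p * q) \<subseteq> msum A B" using keys_mult[of p q] p q unfolding msum_def by blast
      then show ?case by (simp add: J_I)
    qed (auto intro: a_closed)
  qed
  show "J (msum A B) \<subseteq> ideal_prod R (J A) (J B)"
  proof (rule J_subsetI[OF AB])
    have 1: "fr (Poly_Mapping.single (a + b) c) s \<in> ideal_prod R (J A) (J B)" if "a \<in> A" "b \<in> B" "s \<in> U" for a b c s
    proof -
      have "fr (Poly_Mapping.single a c) s \<otimes>\<^bsub>R\<^esub> fr (Poly_Mapping.single b 1) 1 \<in> ideal_prod R (J A) (J B)"
        using that by (intro ideal_prod.prod J_I) auto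
      moreover have "a \<in> mons V" "b \<in> mons V" using that A B by (auto simp: upset_def)
      ultimately show ?thesis using that by (simp add: mult_single)
    qed
    then show "\<And>a c s. a \<in> msum A B \<Longrightarrow> s \<in> U \<Longrightarrow> fr (Poly_Mapping.single a c) s \<in> ideal_prod R (J A) (J B)"
      by (auto simp: msum_def)
    have "ideal (ideal_prod R (J A) (J B)) R"
      using ideal_prod_is_ideal J_ideal A B by blast
    then show "\<zero>\<^bsub>R\<^esub> \<in> ideal_prod R (J A) (J B)"
      using additive_subgroup.zero_closed ideal.axioms(1) by blast
  qed (rule ideal_prod.sum)
qed

lemma J_genideal:
  assumes "G \<subseteq> mons V"
  shows "genideal R {fr (Poly_Mapping.single a 1) 1 | a. a \<in> G} = J (msum (mons V) G)"
proof -
  have up: "upset (msum (mons V) G)" using assms by (intro upset_msum) (auto simp: upset_def)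
  have gsub: "a \<in> msum (mons V) G" if "a \<in> G" for a
    using that unfolding msum_def by (metis (mono_tags, lifting) add_0 mem_Collect_eq mons_0)
  show ?thesis
  proof
    have "{fr (Poly_Mapping.single a 1) 1 | a. a \<in> G} \<subseteq> J (msum (mons V) G)"
      using gsub by (auto intro!: J_I)
    then show "genideal R {fr (Poly_Mapping.single a 1) 1 | a. a \<in> G} \<subseteq> J (msum (mons V) G)"
      unfolding genideal_def using J_ideal[OF up] by blast
    show "J (msum (mons V) G) \<subseteq> genideal R {fr (Poly_Mapping.single a 1) 1 | a. a \<in> G}"
      unfolding genideal_def
    proof (rule Inter_greatest, clarify)
      fix I x assume I: "ideal I R" "{fr (Poly_Mapping.single a 1) 1 | a. a \<in> G} \<subseteq> I" and x: "x \<in> J (msum (mons V) G)"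
      interpret I: ideal I R by (rule I)
      have "J (msum (mons V) G) \<subseteq> I"
      proof (rule J_subsetI[OF up])
        fix a c s assume "a \<in> msum (mons V) G" and s: "s \<in> U"
        then obtain b g where a: "a = b + g" "b \<in> mons V" "g \<in> G" by (auto simp: msum_def)
        have "fr (Poly_Mapping.single b c) s \<otimes>\<^bsub>R\<^esub> fr (Poly_Mapping.single g 1) 1 \<in> I"
          using I(2) a s by (intro I.I_l_closed) auto
        then show "fr (Poly_Mapping.single a c) s \<in> I" using a s assms by (simp add: mult_single subset_iff)
      qed auto
      then show "x \<in> I" using x by blast
    qed
  qed
qed

primrec mpow :: "('v \<Rightarrow>\<^sub>0 nat) set \<Rightarrow> nat \<Rightarrow> ('v \<Rightarrow>\<^sub>0 nat) set" where
  "mpow A 0 = mons V"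
| "mpow A (Suc t) = msum (mpow A t) A"

lemma upset_mons: "upset (mons V)" by (auto simp: upset_def)

lemma upset_mpow: "upset A \<Longrightarrow> upset (mpow A t)"
  by (induction t) (auto intro!: upset_msum upset_mons simp: upset_def[of A])

lemma J_mons: "J (mons V) = carrier R"
  unfolding J_def R_simps C_def by simp

lemma J_pow: "upset A \<Longrightarrow> ideal_pow R (J A) t = J (mpow A t)"
proof (induction t)
  case 0
  then show ?case by (simp add: ideal_pow_def nat_pow_def ideals_set_def J_mons)
next
  case (Suc t)
  have "ideal_pow R (J A) (Suc t) = ideal_prod R (ideal_pow R (J A) t) (J A)"
    by (simp add: ideal_pow_def nat_pow_def ideals_set_def)
  then show ?case using Suc by (simp add: J_prod upset_mpow)
qed

section \<open>The maximal ideal and its powers\<close>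

definition max_id where "max_id = J (mons V - {0})"

lemma upset_max: "upset (mons V - {0})"
proof -
  have "a + b \<noteq> 0" if "a \<noteq> 0" for a b :: "'v \<Rightarrow>\<^sub>0 nat"
  proof
    assume "a + b = 0"
    then have "mdeg a + mdeg b = 0" by (simp only: mdeg_0 flip: mdeg_add)
    then show False using that by simp
  qed
  then show ?thesis by (auto simp: upset_def)
qed

text \<open>A numerator with nonzero constant term is itself an admissible denominator, so the
  fraction can be inverted. This is what makes the ring local.\<close>

lemma fr_notin_max_id:
  assumes "x \<in> carrier R" "x \<notin> max_id"
  shows "\<exists>y\<in>carrier R. y \<otimes>\<^bsub>R\<^esub> x = \<one>\<^bsub>R\<^esub>"
proof -
  obtain p s where x: "x = fr p s" "p \<in> C" "s \<in> U" using assms by (elim fr_cases)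
  have "\<not> mkeys p \<subseteq> mons V - {0}" using assms(2) x J_I unfolding max_id_def by blast
  then have "mlookup p 0 \<noteq> 0" using x(2) by (auto simp: C_def in_keys_iff)
  then have p: "p \<in> U" using x by (simp add: U_def)
  show ?thesis
  proof (rule bexI)
    show "fr s p \<in> carrier R" using x p by (simp add: U_C)
    show "fr s p \<otimes>\<^bsub>R\<^esub> x = \<one>\<^bsub>R\<^esub>"
      using x p by (simp add: U_C R_simps(2), intro fr_eqI) (simp_all add: U_C mult.commute)
  qed
qed

lemma ideal_subset_max_id:
  assumes "ideal I R" "I \<noteq> carrier R"
  shows "I \<subseteq> max_id"
proof (rule ccontr)
  interpret I: ideal I R by (rule assms)
  assume "\<not> I \<subseteq> max_id"
  then obtain x where x: "x \<in> I" "x \<notin> max_id" by blast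
  have "x \<in> carrier R" by (rule I.Icarr[OF x(1)])
  then obtain y where y: "y \<in> carrier R" "y \<otimes>\<^bsub>R\<^esub> x = \<one>\<^bsub>R\<^esub>"
    using fr_notin_max_id x(2) by blast
  have "\<one>\<^bsub>R\<^esub> \<in> I" using I.I_l_closed[OF x(1) y(1)] y(2) by simp
  then show False using assms(2) I.one_imp_carrier by simp
qed

lemma max_id_not_carrier: "max_id \<noteq> carrier R"
proof -
  have "fr (Poly_Mapping.single 0 1) 1 \<notin> max_id"
    unfolding max_id_def by (subst J_single_iff[OF upset_max]) auto
  moreover have "fr (Poly_Mapping.single 0 1) 1 \<in> carrier R" by simp
  ultimately show ?thesis by blast
qed

text \<open>\<open>j_multiplicity\<close> names the maximal ideal by a definite description, so
  uniqueness has to be shown along with maximality.\<close>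

lemma the_maximal: "(THE m. maximalideal m R) = max_id"
proof (rule the_equality)
  have id: "ideal max_id R" unfolding max_id_def by (rule J_ideal[OF upset_max])
  show "maximalideal max_id R"
  proof (rule maximalidealI[OF id])
    show "carrier R \<noteq> max_id" using max_id_not_carrier by simp
    fix I assume I: "ideal I R" "max_id \<subseteq> I" "I \<subseteq> carrier R"
    show "I = max_id \<or> I = carrier R" using ideal_subset_max_id[OF I(1)] I(2) by blast
  qed
  fix m assume m: "maximalideal m R"
  interpret m: maximalideal m R by (rule m)
  have "m \<subseteq> max_id" using ideal_subset_max_id[OF m.is_ideal] m.I_notcarr by metis
  moreover have "max_id \<subseteq> carrier R" using J_carrier[OF upset_max] by (simp add: max_id_def)
  ultimately show "m = max_id"
    using m.I_maximal[OF id] max_id_not_carrier by metis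
qed

lemma mpow_max: "mpow (mons V - {0}) t = {a \<in> mons V. t \<le> mdeg a}"
proof (induction t)
  case (Suc t)
  show ?case
  proof
    show "mpow (mons V - {0}) (Suc t) \<subseteq> {a \<in> mons V. Suc t \<le> mdeg a}"
    proof
      fix x assume "x \<in> mpow (mons V - {0}) (Suc t)"
      then obtain a b where x: "x = a + b" "a \<in> mons V" "t \<le> mdeg a" "b \<in> mons V" "b \<noteq> 0"
        using Suc by (auto simp: msum_def)
      then have "mdeg b > 0" using mdeg_eq_0_iff gr0I by blast
      then show "x \<in> {a \<in> mons V. Suc t \<le> mdeg a}" using x by simp
    qed
    show "{a \<in> mons V. Suc t \<le> mdeg a} \<subseteq> mpow (mons V - {0}) (Suc t)"
    proof safe
      fix a assume a: "a \<in> mons V" "Suc t \<le> mdeg a"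
      then have "a \<noteq> 0" by auto
      then obtain v b where e: "v \<in> V" "b \<in> mons V" "a = Poly_Mapping.single v (Suc 0) + b" "mdeg a = Suc (mdeg b)"
        using mons_decomp_single[OF a(1)] by blast
      then have "b \<in> mpow (mons V - {0}) t" using Suc a by simp
      moreover have "Poly_Mapping.single v (Suc 0) \<in> mons V - {0}" using e(1) by (simp add: mons_single)
      moreover have "a = b + Poly_Mapping.single v (Suc 0)" using e(3) by (simp add: add.commute)
      ultimately show "a \<in> mpow (mons V - {0}) (Suc t)" unfolding mpow.simps msum_def by blast
    qed
  qed
qed simp

end

section \<open>Length and local cohomology\<close>

lemma lookup_single_mult:
  fixes p :: "('v \<Rightarrow>\<^sub>0 nat) \<Rightarrow>\<^sub>0 'k::field"
  shows "mlookup (Poly_Mapping.single c x * p) (c + a) = x * mlookup p a"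
proof (cases "x = 0")
  case False
  have "mlookup (Poly_Mapping.single c x * p) (c + a) = (\<Sum>b\<in>mkeys p. if b = a then x * mlookup p b else 0)"
    unfolding lookup_mult_sum using False by (subst keys_single) simp
  then show ?thesis by (simp add: in_keys_iff)
qed simp

text \<open>Upper bound as in the Jordan-Hoelder theorem: the number of factors in which a submodule \<open>X\<close> is visible
  strictly increases with \<open>X\<close>.\<close>

lemma module_length_composition_series:
  fixes M :: "('a, 'm) module" and F :: "nat \<Rightarrow> 'm set"
  assumes "Module.module R M"
    and sub: "\<And>i. i \<le> N \<Longrightarrow> submodule (F i) R M"
    and F0: "F 0 = {\<zero>\<^bsub>M\<^esub>}" and FN: "F N = carrier M"
    and strict: "\<And>i. i < N \<Longrightarrow> F i \<subset> F (Suc i)"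
    and simple: "\<And>i x y. i < N \<Longrightarrow> x \<in> F (Suc i) - F i \<Longrightarrow> y \<in> F (Suc i) \<Longrightarrow>
      \<exists>r\<in>carrier R. \<exists>z\<in>F i. y = r \<odot>\<^bsub>M\<^esub> x \<oplus>\<^bsub>M\<^esub> z"
  shows "module_length R M = enat N"
proof -
  interpret Module.module R M by (rule assms(1))
  define idx where "idx = (\<lambda>X. {i. i < N \<and> \<not> X \<inter> F (Suc i) \<subseteq> F i})"
  have idx_le: "card (idx X) \<le> N" for X
    using card_mono[of "{..<N}" "idx X"] by (auto simp: idx_def)
  have idx_less: "card (idx X) < card (idx Y)"
    if X: "submodule X R M" and Y: "submodule Y R M" and XY: "X \<subset> Y" for X Y
  proof -
    have sub_idx: "idx X \<subseteq> idx Y" using XY unfolding idx_def by blast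
    have "idx X \<noteq> idx Y"
    proof
      assume eq: "idx X = idx Y"
      \<comment> \<open>If \<open>X\<close> and \<open>Y\<close> are visible in the same factors,
        climb the filtration: an element of \<open>Y\<close> that is new in \<open>F (Suc i)\<close>
        differs from a multiple of an element of \<open>X\<close> by an element of
        \<open>F i\<close>, which lies in \<open>Y\<close> and hence, by induction, in
        \<open>X\<close>.\<close>
      have "i \<le> N \<Longrightarrow> Y \<inter> F i \<subseteq> X" for i
      proof (induction i)
        case 0
        show ?case using F0 subgroup.one_closed[OF submodule.axioms(1)[OF X]] by auto
      next
        case (Suc i)
        then have iN: "i < N" and IH: "Y \<inter> F i \<subseteq> X" by auto
        show ?case
        proof
          fix y assume y: "y \<in> Y \<inter> F (Suc i)"
          show "y \<in> X"
          proof (cases "y \<in> F i")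
            case True
            then show ?thesis using IH y by blast
          next
            case False
            then have "i \<in> idx Y" using y iN unfolding idx_def by blast
            then have "i \<in> idx X" using eq by simp
            then obtain x where x: "x \<in> X" "x \<in> F (Suc i)" "x \<notin> F i" unfolding idx_def by blast
            obtain r z where rz: "r \<in> carrier R" "z \<in> F i" "y = r \<odot>\<^bsub>M\<^esub> x \<oplus>\<^bsub>M\<^esub> z"
              using simple[OF iN, of x y] x y by blast
            have rx: "r \<odot>\<^bsub>M\<^esub> x \<in> X" using submoduleE(4)[OF X] rz x by blast
            then have rxY: "r \<odot>\<^bsub>M\<^esub> x \<in> Y" using XY by blast
            have c: "r \<odot>\<^bsub>M\<^esub> x \<in> carrier M" "z \<in> carrier M"
              using rx submoduleE(1)[OF X] rz(2) submoduleE(1)[OF sub[of i]] iN by auto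
            have "\<ominus>\<^bsub>M\<^esub> (r \<odot>\<^bsub>M\<^esub> x) \<oplus>\<^bsub>M\<^esub> y \<in> Y"
              using submoduleE(3,5)[OF Y] rxY y by blast
            moreover have "\<ominus>\<^bsub>M\<^esub> (r \<odot>\<^bsub>M\<^esub> x) \<oplus>\<^bsub>M\<^esub> y = z"
              unfolding rz(3) using c by (rule M.r_neg1)
            ultimately have "z \<in> X" using IH rz(2) by blast
            then show ?thesis using submoduleE(5)[OF X] rx rz(3) by blast
          qed
        qed
      qed
      from this[of N] have "Y \<subseteq> X" using submoduleE(1)[OF Y] FN by blast
      then show False using XY by blast
    qed
    then have "idx X \<subset> idx Y" using sub_idx by blast
    moreover have "finite (idx Y)" by (simp add: idx_def)
    ultimately show ?thesis by (rule psubset_card_mono[rotated])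
  qed
  have upper: "l \<le> N" if X: "\<And>i. i \<le> l \<Longrightarrow> submodule (X i) R M" "\<And>i. i < l \<Longrightarrow> X i \<subset> X (Suc i)"
    for l and X :: "nat \<Rightarrow> 'm set"
  proof -
    have "i \<le> l \<Longrightarrow> i \<le> card (idx (X i))" for i
    proof (induction i)
      case (Suc i)
      then show ?case using idx_less[of "X i" "X (Suc i)"] X by simp
    qed simp
    from this[of l] show ?thesis using idx_le[of "X l"] by simp
  qed
  show ?thesis unfolding module_length_def
  proof (rule antisym)
    show "Sup {enat l |l. \<exists>N. (\<forall>i\<le>l. submodule (N i) R M) \<and> (\<forall>i<l. N i \<subset> N (Suc i))} \<le> enat N"
    proof (rule Sup_least, clarify)
      fix l X assume "\<forall>i\<le>l. submodule (X i) R M" "\<forall>i<l. X i \<subset> X (Suc i)"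
      then show "enat l \<le> enat N" using upper[of l X] by simp
    qed
    show "enat N \<le> Sup {enat l |l. \<exists>N. (\<forall>i\<le>l. submodule (N i) R M) \<and> (\<forall>i<l. N i \<subset> N (Suc i))}"
      using sub strict by (intro Sup_upper) blast
  qed
qed

section \<open>Quotients of ideals as modules\<close>

context cring
begin

lemma quot_coset_eq_iff:
  assumes "ideal J R" "a \<in> carrier R" "b \<in> carrier R"
  shows "J +> a = J +> b \<longleftrightarrow> a \<ominus> b \<in> J"
  using quotient_eq_iff_same_a_r_cos[OF assms] by blast

lemma quot_module_simps:
  "carrier (quot_module R I J) = {J +> a | a. a \<in> I}"
  "\<zero>\<^bsub>quot_module R I J\<^esub> = J"
  by (simp_all add: quot_module_def)

lemma quot_module_add:
  assumes "ideal J R" "a \<in> carrier R" "b \<in> carrier R"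
  shows "(J +> a) \<oplus>\<^bsub>quot_module R I J\<^esub> (J +> b) = J +> (a \<oplus> b)"
proof -
  interpret abelian_subgroup J R
    using assms(1) ideal.axioms(1) abelian_subgroupI3 is_abelian_group by blast
  show ?thesis using a_rcos_sum[OF assms(2,3)] by (simp add: quot_module_def)
qed

lemma quot_module_smult:
  assumes J: "ideal J R" and a: "a \<in> carrier R" and r: "r \<in> carrier R"
  shows "r \<odot>\<^bsub>quot_module R I J\<^esub> (J +> a) = J +> (r \<otimes> a)"
proof -
  interpret J: ideal J R by (rule J)
  have aJ: "a \<in> J +> a" using a J.a_rcos_self by blast
  have "J +> (r \<otimes> x) = J +> (r \<otimes> a)" if xa: "x \<in> J +> a" for x
  proof -
    obtain j where j: "j \<in> J" "x = j \<oplus> a" using xa by (auto simp: a_r_coset_def')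
    then have jc: "j \<in> carrier R" by (simp add: J.Icarr)
    have "r \<otimes> x \<ominus> r \<otimes> a = r \<otimes> j" using j jc a r by algebra
    moreover have "r \<otimes> j \<in> J" using j r by (simp add: J.I_l_closed)
    ultimately show ?thesis using j jc a r by (subst quot_coset_eq_iff[OF J]) auto
  qed
  then have "(\<Union>x\<in>J +> a. J +> (r \<otimes> x)) = (\<Union>x\<in>J +> a. J +> (r \<otimes> a))" by (intro SUP_cong refl) 
  also have "\<dots> = J +> (r \<otimes> a)" using aJ by blast
  finally show ?thesis by (simp add: quot_module_def)
qed

lemma quot_module_module:
  assumes I: "ideal I R" and J: "ideal J R"
  shows "Module.module R (quot_module R I J)"
proof -
  interpret I: ideal I R by (rule I)
  interpret J: ideal J R by (rule J)
  have z: "\<zero>\<^bsub>quot_module R I J\<^esub> = J +> \<zero>" by (simp add: quot_module_simps a_coset_add_zero J.a_subset)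
  have ag: "abelian_group (quot_module R I J)"
  proof (rule abelian_groupI)
    fix x assume "x \<in> carrier (quot_module R I J)"
    then obtain a where a: "a \<in> I" "x = J +> a" by (auto simp: quot_module_simps)
    show "\<exists>y\<in>carrier (quot_module R I J). y \<oplus>\<^bsub>quot_module R I J\<^esub> x = \<zero>\<^bsub>quot_module R I J\<^esub>"
      using a by (intro bexI[of _ "J +> \<ominus> a"]) (auto simp: z quot_module_add[OF J] quot_module_simps(1) l_neg)
  qed (auto simp: z quot_module_simps(1) quot_module_add[OF J] a_ac)
  show ?thesis
    by (rule moduleI[OF is_cring ag])
      (auto simp: quot_module_simps(1) quot_module_add[OF J] quot_module_smult[OF J] I.I_l_closed l_distr r_distr m_assoc)
qed

lemma quot_module_submodule:
  assumes I: "ideal I R" and J: "ideal J R" and L: "ideal L R" "L \<subseteq> I"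
  shows "submodule {J +> a | a. a \<in> L} R (quot_module R I J)"
proof -
  interpret I: ideal I R by (rule I)
  interpret J: ideal J R by (rule J)
  interpret L: ideal L R by (rule L)
  interpret Q: Module.module R "quot_module R I J" by (rule quot_module_module[OF I J])
  show ?thesis
  proof (rule Q.submoduleI)
    show "{J +> a |a. a \<in> L} \<subseteq> carrier (quot_module R I J)" using L(2) by (auto simp: quot_module_simps)
    have "J = J +> \<zero>" by (simp add: a_coset_add_zero J.a_subset)
    then show "\<zero>\<^bsub>quot_module R I J\<^esub> \<in> {J +> a |a. a \<in> L}"
      unfolding quot_module_simps by (intro CollectI exI[of _ \<zero>]) simp
    show sm: "r \<odot>\<^bsub>quot_module R I J\<^esub> x \<in> {J +> a |a. a \<in> L}" if "r \<in> carrier R" "x \<in> {J +> a |a. a \<in> L}" for r x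
      using that by (auto simp: quot_module_smult[OF J] L.I_l_closed)
    show "x \<oplus>\<^bsub>quot_module R I J\<^esub> y \<in> {J +> a |a. a \<in> L}"
      if "x \<in> {J +> a |a. a \<in> L}" "y \<in> {J +> a |a. a \<in> L}" for x y
      using that by (auto simp: quot_module_add[OF J])
    show "\<ominus>\<^bsub>quot_module R I J\<^esub> x \<in> {J +> a |a. a \<in> L}" if x: "x \<in> {J +> a |a. a \<in> L}" for x
    proof -
      have xc: "x \<in> carrier (quot_module R I J)" using x L(2) by (auto simp: quot_module_simps)
      have "\<ominus>\<^bsub>quot_module R I J\<^esub> x = (\<ominus> \<one>) \<odot>\<^bsub>quot_module R I J\<^esub> x"
        using Q.smult_l_minus[of \<one> x] xc by simp
      then show ?thesis using sm[of "\<ominus> \<one>" x] x by simp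
    qed
  qed
qed

lemma quot_coset_mem_iff:
  assumes J: "ideal J R" and L: "ideal L R" "J \<subseteq> L" and a: "a \<in> carrier R"
  shows "J +> a \<in> {J +> b | b. b \<in> L} \<longleftrightarrow> a \<in> L"
proof
  interpret L: ideal L R by (rule L)
  assume "J +> a \<in> {J +> b |b. b \<in> L}"
  then obtain b where b: "b \<in> L" "J +> a = J +> b" by blast
  then have bc: "b \<in> carrier R" by (simp add: L.Icarr)
  have "a \<ominus> b \<in> L" using b(2) quot_coset_eq_iff[OF J a bc] L(2) by blast
  then have "(a \<ominus> b) \<oplus> b \<in> L" using b(1) by simp
  moreover have "(a \<ominus> b) \<oplus> b = a" using a bc by algebra
  ultimately show "a \<in> L" by simp
qed blast

end

section \<open>Length of quotients of monomial ideals\<close>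

context monomial_localization
begin

text \<open>Adding monomials in order of decreasing degree keeps the set an upset.\<close>

lemma upset_chain:
  assumes "upset A" "upset B" "B \<subseteq> A" "finite (A - B)" "card (A - B) = N"
  shows "\<exists>W. W 0 = B \<and> W N = A \<and> (\<forall>i\<le>N. upset (W i) \<and> B \<subseteq> W i \<and> W i \<subseteq> A) \<and> (\<forall>i<N. \<exists>a. a \<notin> W i \<and> W (Suc i) = insert a (W i))"
  using assms(2-)
proof (induction N arbitrary: B)
  case 0
  then show ?case using assms(1) by (intro exI[of _ "\<lambda>_. A"]) auto
next
  case (Suc N)
  then have ne: "A - B \<noteq> {}" by auto
  obtain a where a: "a \<in> A - B" "\<And>b. b \<in> A - B \<Longrightarrow> mdeg b \<le> mdeg a"
    using Max_in[of "mdeg ` (A - B)"] Max_ge[of "mdeg ` (A - B)"] Suc.prems(3) ne by (metis (no_types, lifting) finite_imageI image_eqI image_iff image_is_empty)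
  have up: "upset (insert a B)"
    unfolding upset_def
  proof (intro conjI ballI)
    show "insert a B \<subseteq> mons V" using a assms(1) Suc.prems(1) by (auto simp: upset_def)
    fix x b assume x: "x \<in> insert a B" and b: "b \<in> mons V"
    show "x + b \<in> insert a B"
    proof (cases "x \<in> B \<or> b = 0")
      case True
      then show ?thesis using x b Suc.prems(1) by (auto simp: upset_def)
    next
      case False
      then have "a + b \<in> A" using x a b assms(1) by (auto simp: upset_def)
      moreover have "\<not> mdeg (a + b) \<le> mdeg a" using False by simp
      ultimately show ?thesis using a(2) x False by blast
    qed
  qed
  have d: "A - insert a B = (A - B) - {a}" by blast
  have "card (A - insert a B) = N" unfolding d using a Suc.prems by simp
  then obtain W where W: "W 0 = insert a B" "W N = A" "\<forall>i\<le>N. upset (W i) \<and> insert a B \<subseteq> W i \<and> W i \<subseteq> A"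
    "\<forall>i<N. \<exists>a. a \<notin> W i \<and> W (Suc i) = insert a (W i)"
    using Suc.IH[OF up] a Suc.prems by auto
  define W' where "W' = (\<lambda>i. case i of 0 \<Rightarrow> B | Suc j \<Rightarrow> W j)"
  have "W' 0 = B" "W' (Suc N) = A" by (simp_all add: W'_def W)
  moreover have "upset (W' i) \<and> B \<subseteq> W' i \<and> W' i \<subseteq> A" if "i \<le> Suc N" for i
    using that W(3) Suc.prems by (cases i) (auto simp: W'_def)
  moreover have "\<exists>b. b \<notin> W' i \<and> W' (Suc i) = insert b (W' i)" if "i < Suc N" for i
    using that W(1,4) a by (cases i) (auto simp: W'_def)
  ultimately show ?case by blast
qed

text \<open>Modulo \<open>J W\<close> only the coefficient of the monomial \<open>a\<close>
  survives, so the quotient behaves like a one-dimensional space over the residue field and is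
  generated by any element outside \<open>J W\<close>.\<close>

lemma J_insert_generate:
  assumes W: "upset W" "upset (insert a W)"
    and x: "x \<in> J (insert a W) - J W" and y: "y \<in> J (insert a W)"
  shows "\<exists>r\<in>carrier R. \<exists>z\<in>J W. y = r \<otimes>\<^bsub>R\<^esub> x \<oplus>\<^bsub>R\<^esub> z"
proof -
  have x1: "x \<in> J (insert a W)" using x by blast
  obtain p s where p: "x = fr p s" "mkeys p \<subseteq> insert a W" "p \<in> C" "s \<in> U"
    by (rule J_cases[OF x1 W(2)])
  obtain q t where q: "y = fr q t" "mkeys q \<subseteq> insert a W" "q \<in> C" "t \<in> U"
    by (rule J_cases[OF y W(2)])
  have "\<not> mkeys p \<subseteq> W" using x p J_I by blast
  then have pa: "mlookup p a \<noteq> 0" using p(2) by (auto simp: in_keys_iff)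
  \<comment> \<open>With this ratio the coefficient of \<open>a\<close> cancels in
    \<open>q - k * p\<close>, and all other monomials lie in \<open>W\<close>.\<close>
  define c where "c = mlookup q a / mlookup p a"
  define k where "k = (Poly_Mapping.single 0 c :: ('v, 'k) mpoly)"
  have kC: "k \<in> C" by (simp add: k_def)
  define d where "d = q - k * p"
  have lk: "mlookup (k * p) b = c * mlookup p b" for b
    using lookup_single_mult[of 0 c p b] by (simp add: k_def)
  have dk: "mkeys d \<subseteq> W"
  proof
    fix b assume b: "b \<in> mkeys d"
    then have l: "mlookup q b - c * mlookup p b \<noteq> 0" by (simp add: d_def in_keys_iff lookup_minus lk)
    then have "b \<noteq> a" using pa by (auto simp: c_def)
    moreover have "b \<in> mkeys q \<or> b \<in> mkeys p" using l by (auto simp: in_keys_iff)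
    ultimately show "b \<in> W" using p(2) q(2) by blast
  qed
  then have dC: "d \<in> C" using upset_C[OF W(1)] by blast
  have "q = k * p + d" by (simp add: d_def)
  then have "y = fr (k * s) t \<otimes>\<^bsub>R\<^esub> x \<oplus>\<^bsub>R\<^esub> fr d t"
    using p q dC kC by (simp add: U_C, intro fr_eqI) (simp_all add: U_C algebra_simps)
  moreover have "fr d t \<in> J W" using dk q by (intro J_I)
  ultimately show ?thesis using kC p q by (intro bexI[of _ "fr (k * s) t"] bexI[of _ "fr d t"]) (auto simp: U_C)
qed

lemma length_J_quot:
  assumes A: "upset A" and B: "upset B" and BA: "B \<subseteq> A" and fin: "finite (A - B)"
  shows "module_length R (quot_module R (J A) (J B)) = enat (card (A - B))"
proof -
  interpret cring R by (rule cring_R)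
  define N where "N = card (A - B)"
  obtain W where W: "W 0 = B" "W N = A" "\<And>i. i \<le> N \<Longrightarrow> upset (W i)" "\<And>i. i \<le> N \<Longrightarrow> B \<subseteq> W i" "\<And>i. i \<le> N \<Longrightarrow> W i \<subseteq> A"
     "\<And>i. i < N \<Longrightarrow> \<exists>a. a \<notin> W i \<and> W (Suc i) = insert a (W i)"
    using upset_chain[OF A B BA fin refl] unfolding N_def by blast
  have JA: "ideal (J A) R" and JB: "ideal (J B) R" using A B by (auto intro: J_ideal)
  have JW: "ideal (J (W i)) R" "J B \<subseteq> J (W i)" "J (W i) \<subseteq> J A" if "i \<le> N" for i
    using J_ideal[OF W(3)[OF that]] J_mono[OF W(4)[OF that]] J_mono[OF W(5)[OF that]] by auto
  have JWc: "J (W i) \<subseteq> carrier R" if "i \<le> N" for i using W(3)[OF that] by (rule J_carrier)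
  define F where "F = (\<lambda>i. {J B +>\<^bsub>R\<^esub> x | x. x \<in> J (W i)})"
  have Fmem: "J B +>\<^bsub>R\<^esub> x \<in> F i \<longleftrightarrow> x \<in> J (W i)" if "i \<le> N" "x \<in> carrier R" for x i
    unfolding F_def by (rule quot_coset_mem_iff[OF JB JW(1,2)[OF that(1)] that(2)])
  show ?thesis unfolding N_def[symmetric]
  proof (rule module_length_composition_series[where F = F])
    show "Module.module R (quot_module R (J A) (J B))" by (rule quot_module_module[OF JA JB])
    show "submodule (F i) R (quot_module R (J A) (J B))" if "i \<le> N" for i
      unfolding F_def by (rule quot_module_submodule[OF JA JB JW(1,3)[OF that]])
    show "F N = carrier (quot_module R (J A) (J B))" by (simp add: F_def W quot_module_simps)
    interpret B: ideal "J B" R by (rule JB)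
    show "F 0 = {\<zero>\<^bsub>quot_module R (J A) (J B)\<^esub>}"
    proof -
      have "J B +>\<^bsub>R\<^esub> x = J B" if "x \<in> J B" for x using that by (rule B.a_rcos_const)
      moreover have "\<zero>\<^bsub>R\<^esub> \<in> J B" by simp
      ultimately show ?thesis unfolding F_def W quot_module_simps by blast
    qed
    fix i assume i: "i < N"
    then have i': "i \<le> N" "Suc i \<le> N" by auto
    obtain a where a: "a \<notin> W i" "W (Suc i) = insert a (W i)" using W(6)[OF i] by blast
    have aV: "a \<in> mons V" using W(3)[OF i'(2)] a by (auto simp: upset_def)
    have mono: "F i \<subseteq> F (Suc i)" unfolding F_def a using J_mono[of "W i" "insert a (W i)"] by blast
    let ?x = "fr (Poly_Mapping.single a 1) 1"
    have "J B +>\<^bsub>R\<^esub> ?x \<in> F (Suc i)" "J B +>\<^bsub>R\<^esub> ?x \<notin> F i"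
      using a aV W(3)[OF i'(1)] J_single_iff[OF W(3)[OF i'(2)] aV] i' by (simp_all add: Fmem J_single_iff)
    then show "F i \<subset> F (Suc i)" using mono by blast
    fix X Y assume X: "X \<in> F (Suc i) - F i" and Y: "Y \<in> F (Suc i)"
    obtain x where x: "X = J B +>\<^bsub>R\<^esub> x" "x \<in> J (W (Suc i))" using X unfolding F_def by blast
    obtain y where y: "Y = J B +>\<^bsub>R\<^esub> y" "y \<in> J (W (Suc i))" using Y unfolding F_def by blast
    have xy: "x \<in> carrier R" "y \<in> carrier R" using x y JWc[OF i'(2)] by auto
    have "x \<notin> J (W i)" using X x(1) Fmem[OF i'(1) xy(1)] by blast
    then obtain r z where rz: "r \<in> carrier R" "z \<in> J (W i)" "y = r \<otimes>\<^bsub>R\<^esub> x \<oplus>\<^bsub>R\<^esub> z"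
      using J_insert_generate[of "W i" a x y] W(3)[OF i'(1)] W(3)[OF i'(2)] x(2) y(2) unfolding a(2) by blast
    have z: "z \<in> carrier R" using rz JWc[OF i'(1)] by blast
    show "\<exists>r\<in>carrier R. \<exists>Z\<in>F i. Y = r \<odot>\<^bsub>quot_module R (J A) (J B)\<^esub> X \<oplus>\<^bsub>quot_module R (J A) (J B)\<^esub> Z"
    proof (intro bexI)
      show "Y = r \<odot>\<^bsub>quot_module R (J A) (J B)\<^esub> X \<oplus>\<^bsub>quot_module R (J A) (J B)\<^esub> (J B +>\<^bsub>R\<^esub> z)"
        using rz xy z by (simp add: x y quot_module_smult[OF JB] quot_module_add[OF JB])
      show "J B +>\<^bsub>R\<^esub> z \<in> F i" using rz unfolding F_def by blast
    qed (rule rz)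
  qed
qed

section \<open>Local cohomology as a relative saturation\<close>

lemma keys_single_mult:
  fixes p :: "('v, 'k) mpoly"
  assumes "a \<in> mkeys p"
  shows "c + a \<in> mkeys (Poly_Mapping.single c 1 * p)"
proof -
  show ?thesis using assms lookup_single_mult[of c 1 p a] by (simp add: in_keys_iff)
qed

text \<open>The elements of \<open>A\<close> that some power of the maximal ideal carries into
  \<open>B\<close>: the monomials of degree at least \<open>\<sigma>\<close> generate its
  \<open>\<sigma>\<close>-th power.\<close>

definition sat :: "('v \<Rightarrow>\<^sub>0 nat) set \<Rightarrow> ('v \<Rightarrow>\<^sub>0 nat) set \<Rightarrow> ('v \<Rightarrow>\<^sub>0 nat) set" where
  "sat A B = {a \<in> A. \<exists>\<sigma>. \<forall>b\<in>mons V. \<sigma> \<le> mdeg b \<longrightarrow> a + b \<in> B}"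

lemma upset_sat:
  assumes "upset A" "upset B"
  shows "upset (sat A B)"
  unfolding upset_def
proof (intro conjI ballI)
  show "sat A B \<subseteq> mons V" using assms by (auto simp: sat_def upset_def)
  fix a b assume a: "a \<in> sat A B" and b: "b \<in> mons V"
  then obtain \<sigma> where \<sigma>: "\<And>c. c \<in> mons V \<Longrightarrow> \<sigma> \<le> mdeg c \<Longrightarrow> a + c \<in> B" by (auto simp: sat_def)
  have "a + b + c \<in> B" if "c \<in> mons V" "\<sigma> \<le> mdeg c" for c
    using \<sigma>[of "b + c"] that b by (simp add: add.assoc)
  then show "a + b \<in> sat A B" using a b assms by (auto simp: sat_def upset_def)
qed

text \<open>A numerator has finitely many monomials, so the largest of their thresholds serves for
  all of them. Conversely, testing against the powers \<open>v ^ \<sigma>\<close> of the nodes is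
  enough, because every monomial of large degree is divisible by one of them.\<close>

lemma torsion_iff_sat:
  assumes V: "finite V" and A: "upset A" and B: "upset B" and x: "x \<in> J A"
  shows "(\<exists>s. \<forall>r\<in>ideal_pow R max_id s. r \<otimes>\<^bsub>R\<^esub> x \<in> J B) \<longleftrightarrow> x \<in> J (sat A B)"
proof
  have pow: "ideal_pow R max_id s = J {a \<in> mons V. s \<le> mdeg a}" for s
    unfolding max_id_def J_pow[OF upset_max] mpow_max ..
  {
    assume "x \<in> J (sat A B)"
    then obtain p s where p: "x = fr p s" "mkeys p \<subseteq> sat A B" "p \<in> C" "s \<in> U"
      using upset_sat[OF A B] by (rule J_cases)
    have "\<forall>a\<in>mkeys p. \<exists>\<sigma>. \<forall>b\<in>mons V. \<sigma> \<le> mdeg b \<longrightarrow> a + b \<in> B" using p(2) by (auto simp: sat_def)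
    then obtain \<sigma> where \<sigma>: "\<And>a b. a \<in> mkeys p \<Longrightarrow> b \<in> mons V \<Longrightarrow> \<sigma> a \<le> mdeg b \<Longrightarrow> a + b \<in> B" by metis
    define T where "T = Max (insert 0 (\<sigma> ` mkeys p))"
    have T: "\<sigma> a \<le> T" if "a \<in> mkeys p" for a using that by (auto simp: T_def intro!: Max_ge)
    have up: "upset {a \<in> mons V. T \<le> mdeg a}" by (auto simp: upset_def)
    have "r \<otimes>\<^bsub>R\<^esub> x \<in> J B" if r: "r \<in> ideal_pow R max_id T" for r
    proof -
      have "r \<in> J {a \<in> mons V. T \<le> mdeg a}" using r pow by simp
      then obtain q t where q: "r = fr q t" "mkeys q \<subseteq> {a \<in> mons V. T \<le> mdeg a}" "q \<in> C" "t \<in> U"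
        using up by (rule J_cases)
      have "mkeys (q * p) \<subseteq> B"
      proof
        fix c assume "c \<in> mkeys (q * p)"
        then obtain b a where c: "c = b + a" "b \<in> mkeys q" "a \<in> mkeys p" using keys_mult[of q p] by blast
        then have "a + b \<in> B" using q(2) T[of a] by (intro \<sigma>) auto
        then show "c \<in> B" using c by (simp add: add.commute)
      qed
      then show ?thesis using p q by (simp add: J_I)
    qed
    then show "\<exists>s. \<forall>r\<in>ideal_pow R max_id s. r \<otimes>\<^bsub>R\<^esub> x \<in> J B" by blast
  next
    assume "\<exists>s. \<forall>r\<in>ideal_pow R max_id s. r \<otimes>\<^bsub>R\<^esub> x \<in> J B"
    then obtain \<sigma> where \<sigma>: "\<And>r. r \<in> ideal_pow R max_id \<sigma> \<Longrightarrow> r \<otimes>\<^bsub>R\<^esub> x \<in> J B" by blast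
    obtain p s where p: "x = fr p s" "mkeys p \<subseteq> A" "p \<in> C" "s \<in> U" by (rule J_cases[OF x A])
    let ?m = "\<lambda>v. Poly_Mapping.single (Poly_Mapping.single v \<sigma>) 1 :: ('v, 'k) mpoly"
    have "\<exists>u\<in>U. mkeys (u * (?m v * p)) \<subseteq> B" if v: "v \<in> V" for v
    proof -
      have "fr (?m v) 1 \<in> ideal_pow R max_id \<sigma>" unfolding pow using v by (intro J_I) (auto simp: mons_single)
      then have "fr (?m v) 1 \<otimes>\<^bsub>R\<^esub> x \<in> J B" by (rule \<sigma>)
      then have "fr (?m v * p) s \<in> J B" using p v by (simp add: mons_single)
      then show ?thesis using p v by (subst (asm) J_mem[OF B]) (simp_all add: mons_single)
    qed
    then obtain u where u: "\<And>v. v \<in> V \<Longrightarrow> u v \<in> U" "\<And>v. v \<in> V \<Longrightarrow> mkeys (u v * (?m v * p)) \<subseteq> B" by metis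
    \<comment> \<open>Each node brings its own factor \<open>u v\<close> from \<open>J_mem\<close>;
      their product works for all nodes at once and still lies in \<open>U\<close>.\<close>
    define w where "w = (\<Prod>v\<in>V. u v)"
    have prodU: "(\<Prod>v\<in>X. u v) \<in> U" if "X \<subseteq> V" for X
      using that by (induction X rule: infinite_finite_induct) (auto intro!: U_mult u(1))
    have wU: "w \<in> U" by (simp add: w_def prodU)
    have wp: "mkeys (w * p) \<subseteq> sat A B"
    proof
      fix a assume a: "a \<in> mkeys (w * p)"
      have aA: "a \<in> A" using upset_keys_mult[OF A p(2) U_C[OF wU]] a by blast
      have sh: "Poly_Mapping.single v \<sigma> + a \<in> B" if v: "v \<in> V" for v
      proof -
        have "w = (\<Prod>v\<in>V - {v}. u v) * u v" unfolding w_def using V v by (simp add: prod.remove mult.commute)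
        then have e: "?m v * (w * p) = (\<Prod>v\<in>V - {v}. u v) * (u v * (?m v * p))" by (simp only: mult_ac)
        have "(\<Prod>v\<in>V - {v}. u v) \<in> C" by (intro U_C prodU) auto
        then have "mkeys (?m v * (w * p)) \<subseteq> B" unfolding e by (rule upset_keys_mult[OF B u(2)[OF v]])
        then show ?thesis using keys_single_mult[OF a] by blast
      qed
      have "a + b \<in> B" if b: "b \<in> mons V" "card V * \<sigma> + 1 \<le> mdeg b" for b
      proof -
        obtain v b' where v: "v \<in> V" "b' \<in> mons V" "b = Poly_Mapping.single v \<sigma> + b'"
          using pigeonhole_mons[OF V b] by blast
        have "(Poly_Mapping.single v \<sigma> + a) + b' \<in> B" using sh v B unfolding upset_def by blast
        then show ?thesis using v by (simp add: add_ac)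
      qed
      then show "a \<in> sat A B" using aA unfolding sat_def by blast
    qed
    have "x = fr (w * p) (w * s)" using p wU by (simp add: fr_cancel)
    then show "x \<in> J (sat A B)" using wp p wU by (simp add: J_I)
  }
qed

lemma local_cohomology_J:
  assumes V: "finite V" and A: "upset A" and B: "upset B"
  shows "local_cohomology0 R max_id (quot_module R (J A) (J B)) = quot_module R (J (sat A B)) (J B)"
proof -
  interpret cring R by (rule cring_R)
  have JA: "ideal (J A) R" and JB: "ideal (J B) R" using A B by (auto intro: J_ideal)
  interpret B: ideal "J B" R by (rule JB)
  have satA: "J (sat A B) \<subseteq> J A" by (rule J_mono) (auto simp: sat_def)
  have m: "ideal_pow R max_id s \<subseteq> carrier R" for s
    unfolding max_id_def J_pow[OF upset_max] by (intro J_carrier upset_mpow upset_max)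
  have t: "(\<exists>s. \<forall>r\<in>ideal_pow R max_id s. r \<odot>\<^bsub>quot_module R (J A) (J B)\<^esub> (J B +>\<^bsub>R\<^esub> x) = J B) \<longleftrightarrow> x \<in> J (sat A B)"
    if x: "x \<in> J A" for x
  proof -
    have xc: "x \<in> carrier R" using x J_carrier[OF A] by blast
    have "r \<odot>\<^bsub>quot_module R (J A) (J B)\<^esub> (J B +>\<^bsub>R\<^esub> x) = J B \<longleftrightarrow> r \<otimes>\<^bsub>R\<^esub> x \<in> J B"
      if r: "r \<in> ideal_pow R max_id s" for r s
    proof -
      have rc: "r \<in> carrier R" using r m by blast
      have "J B +>\<^bsub>R\<^esub> (r \<otimes>\<^bsub>R\<^esub> x) = J B \<longleftrightarrow> r \<otimes>\<^bsub>R\<^esub> x \<in> J B"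
        using B.a_rcos_const B.a_rcos_self[of "r \<otimes>\<^bsub>R\<^esub> x"] rc xc by auto
      then show ?thesis by (simp add: quot_module_smult[OF JB xc rc])
    qed
    then show ?thesis using torsion_iff_sat[OF V A B x] by metis
  qed
  have "{X \<in> {J B +>\<^bsub>R\<^esub> x | x. x \<in> J A}. \<exists>s. \<forall>r\<in>ideal_pow R max_id s. r \<odot>\<^bsub>quot_module R (J A) (J B)\<^esub> X = J B}
     = {J B +>\<^bsub>R\<^esub> x | x. x \<in> J (sat A B)}"
    using t satA by blast
  then show ?thesis
    unfolding local_cohomology0_def quot_module_simps by (simp add: quot_module_def)
qed

end

section \<open>Krull dimension\<close>

text \<open>Replaces a monomial order: \<open>a0\<close> and \<open>b0\<close> play the role of leading monomials.\<close>

lemma unique_sum_pair: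
  fixes A B :: "('v \<Rightarrow>\<^sub>0 nat) set"
  assumes "finite S" "finite A" "finite B" "A \<noteq> {}" "B \<noteq> {}"
    and "\<And>a a' v. a \<in> A \<Longrightarrow> a' \<in> A \<Longrightarrow> v \<notin> S \<Longrightarrow> mlookup a v = mlookup a' v"
    and "\<And>a a' v. a \<in> B \<Longrightarrow> a' \<in> B \<Longrightarrow> v \<notin> S \<Longrightarrow> mlookup a v = mlookup a' v"
  shows "\<exists>a0\<in>A. \<exists>b0\<in>B. \<forall>a\<in>A. \<forall>b\<in>B. a + b = a0 + b0 \<longrightarrow> a = a0 \<and> b = b0"
  using assms
proof (induction S arbitrary: A B rule: finite_induct)
  case empty
  obtain a0 b0 where "a0 \<in> A" "b0 \<in> B" using empty by blast
  moreover have "a = a0" if "a \<in> A" for a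
    using empty(5)[OF that \<open>a0 \<in> A\<close>] by (intro poly_mapping_eqI) auto
  moreover have "b = b0" if "b \<in> B" for b
    using empty(6)[OF that \<open>b0 \<in> B\<close>] by (intro poly_mapping_eqI) auto
  ultimately show ?case by blast
next
  case (insert s S)
  define MA where "MA = Max ((\<lambda>a. mlookup a s) ` A)"
  define MB where "MB = Max ((\<lambda>a. mlookup a s) ` B)"
  define A' where "A' = {a \<in> A. mlookup a s = MA}"
  define B' where "B' = {a \<in> B. mlookup a s = MB}"
  have leA: "mlookup a s \<le> MA" if "a \<in> A" for a using that insert.prems by (auto simp: MA_def)
  have leB: "mlookup a s \<le> MB" if "a \<in> B" for a using that insert.prems by (auto simp: MB_def)
  have "MA \<in> (\<lambda>a. mlookup a s) ` A" unfolding MA_def using insert.prems by (intro Max_in) auto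
  moreover have "MB \<in> (\<lambda>a. mlookup a s) ` B" unfolding MB_def using insert.prems by (intro Max_in) auto
  ultimately have ne: "A' \<noteq> {}" "B' \<noteq> {}" unfolding A'_def B'_def by (blast, blast)
  have hA: "mlookup a v = mlookup a' v" if a: "a \<in> A'" "a' \<in> A'" "v \<notin> S" for a a' v
    using a insert.prems(5)[of a a' v] by (cases "v = s") (auto simp: A'_def)
  have hB: "mlookup a v = mlookup a' v" if a: "a \<in> B'" "a' \<in> B'" "v \<notin> S" for a a' v
    using a insert.prems(6)[of a a' v] by (cases "v = s") (auto simp: B'_def)
  have fin: "finite A'" "finite B'" using insert.prems by (auto simp: A'_def B'_def)
  obtain a0 b0 where ab: "a0 \<in> A'" "b0 \<in> B'"
    "\<forall>a\<in>A'. \<forall>b\<in>B'. a + b = a0 + b0 \<longrightarrow> a = a0 \<and> b = b0"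
    using insert.IH[OF fin ne hA hB] by blast
  have "a = a0 \<and> b = b0" if h: "a \<in> A" "b \<in> B" "a + b = a0 + b0" for a b
  proof -
    have "mlookup a s + mlookup b s = MA + MB"
      using arg_cong[OF h(3), of "\<lambda>m. mlookup m s"] ab(1,2) by (simp add: lookup_add A'_def B'_def)
    then have "mlookup a s = MA" "mlookup b s = MB" using leA[OF h(1)] leB[OF h(2)] by auto
    then have "a \<in> A'" "b \<in> B'" using h by (auto simp: A'_def B'_def)
    then show ?thesis using ab(3) h(3) by blast
  qed
  moreover have "a0 \<in> A" "b0 \<in> B" using ab by (auto simp: A'_def B'_def)
  ultimately show ?case by blast
qed

text \<open>Gaussian elimination: equation \<open>f\<close> is solved for the unknown
  \<open>\<beta>\<close>, which leaves one equation and one unknown less.\<close>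

lemma underdetermined_system:
  fixes v :: "'e \<Rightarrow> 'm \<Rightarrow> 'k::field"
  assumes "finite F" "finite E" "card F < card E"
  shows "\<exists>c. (\<exists>\<alpha>\<in>E. c \<alpha> \<noteq> 0) \<and> (\<forall>x\<in>F. (\<Sum>\<alpha>\<in>E. c \<alpha> * v \<alpha> x) = 0)"
  using assms
proof (induction F arbitrary: E v rule: finite_induct)
  case empty
  then have "E \<noteq> {}" by auto
  then show ?case by (intro exI[of _ "\<lambda>_. 1"]) auto
next
  case (insert f F)
  show ?case
  proof (cases "\<forall>\<alpha>\<in>E. v \<alpha> f = 0")
    case True
    have "card F < card E" using insert by simp
    then obtain c where "\<exists>\<alpha>\<in>E. c \<alpha> \<noteq> 0" "\<forall>x\<in>F. (\<Sum>\<alpha>\<in>E. c \<alpha> * v \<alpha> x) = 0"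
      using insert.IH[OF insert.prems(1), of v] by blast
    then show ?thesis using True by (intro exI[of _ c]) auto
  next
    case False
    then obtain \<beta> where \<beta>: "\<beta> \<in> E" "v \<beta> f \<noteq> 0" by blast
    define w where "w = (\<lambda>\<alpha> x. v \<alpha> x - v \<alpha> f / v \<beta> f * v \<beta> x)"
    have "card F < card (E - {\<beta>})" using insert \<beta> by simp
    then obtain c where c: "\<exists>\<alpha>\<in>E - {\<beta>}. c \<alpha> \<noteq> 0" "\<forall>x\<in>F. (\<Sum>\<alpha>\<in>E - {\<beta>}. c \<alpha> * w \<alpha> x) = 0"
      using insert.IH[of "E - {\<beta>}" w] insert.prems(1) by blast
    define s where "s = (\<Sum>\<alpha>\<in>E - {\<beta>}. c \<alpha> * (v \<alpha> f / v \<beta> f))"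
    define c' where "c' = c(\<beta> := - s)"
    have sum: "(\<Sum>\<alpha>\<in>E. c' \<alpha> * v \<alpha> x) = (\<Sum>\<alpha>\<in>E - {\<beta>}. c \<alpha> * w \<alpha> x)" for x
    proof -
      have "(\<Sum>\<alpha>\<in>E. c' \<alpha> * v \<alpha> x) = c' \<beta> * v \<beta> x + (\<Sum>\<alpha>\<in>E - {\<beta>}. c' \<alpha> * v \<alpha> x)"
        using insert.prems(1) \<beta>(1) by (rule sum.remove)
      also have "(\<Sum>\<alpha>\<in>E - {\<beta>}. c' \<alpha> * v \<alpha> x) = (\<Sum>\<alpha>\<in>E - {\<beta>}. c \<alpha> * v \<alpha> x)"
        by (intro sum.cong) (auto simp: c'_def)
      also have "c' \<beta> * v \<beta> x = (\<Sum>\<alpha>\<in>E - {\<beta>}. - (c \<alpha> * (v \<alpha> f / v \<beta> f) * v \<beta> x))"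
        by (simp add: c'_def s_def sum_distrib_right sum_negf)
      finally show ?thesis by (simp add: w_def algebra_simps flip: sum.distrib)
    qed
    have "w \<alpha> f = 0" for \<alpha> using \<beta> by (simp add: w_def)
    then have "(\<Sum>\<alpha>\<in>E. c' \<alpha> * v \<alpha> x) = 0" if "x \<in> insert f F" for x
      using that c(2) unfolding sum by auto
    moreover have "\<exists>\<alpha>\<in>E. c' \<alpha> \<noteq> 0" using c(1) by (auto simp: c'_def)
    ultimately show ?thesis by blast
  qed
qed

lemma binomial_scale_le: "(d * D + n) choose n \<le> d ^ n * ((D + n) choose n)" if "d \<ge> 1" for d D n :: nat
proof (induction n)
  case (Suc n)
  have "Suc n * ((d * D + Suc n) choose Suc n) = (d * D + Suc n) * ((d * D + n) choose n)"
    using Suc_times_binomial[of n "d * D + n"] by simp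
  also have "\<dots> \<le> (d * (D + Suc n)) * (d ^ n * ((D + n) choose n))"
  proof (intro mult_mono Suc.IH)
    have "1 * Suc n \<le> d * Suc n" using that by (rule mult_le_mono1)
    then show "d * D + Suc n \<le> d * (D + Suc n)" by (simp add: distrib_left)
  qed simp_all
  also have "\<dots> = d ^ Suc n * (Suc (D + n) * ((D + n) choose n))" by (simp add: algebra_simps)
  also have "\<dots> = Suc n * (d ^ Suc n * ((D + Suc n) choose Suc n))"
    unfolding Suc_times_binomial[symmetric] by (simp only: add_Suc_right mult_ac)
  finally show ?case by (simp only: Suc_mult_le_cancel1)
qed simp

text \<open>In \<open>D\<close> the left side grows with exponent \<open>n\<close>, the right side
  with exponent \<open>n + 1\<close>. For monomials: in \<open>n + 1\<close> variables there are
  more of degree at most \<open>D\<close> than there are in \<open>n\<close> variables of degree at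
  most \<open>d * D\<close>.\<close>

lemma binomial_exceeds: "\<exists>D. (d * D + n) choose n < (D + Suc n) choose Suc n" for d n :: nat
proof -
  \<comment> \<open>Passing to \<open>Suc d\<close> meets the condition of
    \<open>binomial_scale_le\<close>; \<open>D\<close> is chosen to absorb the factors
    \<open>d' ^ n\<close> and \<open>Suc n\<close>.\<close>
  define d' where "d' = Suc d"
  define D where "D = Suc n * d' ^ n"
  have "(d * D + n) choose n \<le> (d' * D + n) choose n" by (intro binomial_right_mono) (simp add: d'_def)
  also have "\<dots> \<le> d' ^ n * ((D + n) choose n)" by (intro binomial_scale_le) (simp add: d'_def)
  finally have 1: "Suc n * ((d * D + n) choose n) \<le> D * ((D + n) choose n)"
    by (simp only: D_def mult.assoc Suc_mult_le_cancel1)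
  also have "\<dots> < Suc (D + n) * ((D + n) choose n)" by (intro mult_strict_right_mono) (auto simp: zero_less_binomial)
  also have "\<dots> = Suc n * ((D + Suc n) choose Suc n)" by (simp only: Suc_times_binomial add_Suc_right)
  finally show ?thesis by (intro exI[of _ D]) (simp only: mult_less_cancel1)
qed

section \<open>Lower bound for the dimension: primes generated by nodes\<close>

context monomial_localization
begin

text \<open>Under \<open>J\<close> this becomes the ideal generated by the nodes in
  \<open>S\<close>; letting \<open>S\<close> grow one node at a time yields the chain of
  primes.\<close>

definition hits :: "'v set \<Rightarrow> ('v \<Rightarrow>\<^sub>0 nat) set" where
  "hits S = {a \<in> mons V. mkeys a \<inter> S \<noteq> {}}"

lemma upset_hits: "upset (hits S)"
  by (auto simp: upset_def hits_def keys_add_nat)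

text \<open>Reduction modulo the nodes in \<open>S\<close> keeps exactly the monomials in
  \<open>A\<close> and \<open>B\<close>. By \<open>unique_sum_pair\<close> some monomial of the
  reduced product arises from one pair only, so it cannot cancel.\<close>

lemma hits_mult:
  assumes V: "finite V" and p: "p \<in> C" "\<not> mkeys p \<subseteq> hits S" and q: "q \<in> C" "\<not> mkeys q \<subseteq> hits S"
  shows "\<not> mkeys (p * q) \<subseteq> hits S"
proof -
  define A where "A = {a \<in> mkeys p. mkeys a \<inter> S = {}}"
  define B where "B = {a \<in> mkeys q. mkeys a \<inter> S = {}}"
  have ne: "A \<noteq> {}" "B \<noteq> {}" using p q by (auto simp: A_def B_def C_def hits_def)
  have "A \<subseteq> mons V" "B \<subseteq> mons V" using p q by (auto simp: A_def B_def C_def)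
  then have z: "mlookup a v = 0" if "a \<in> A \<or> a \<in> B" "v \<notin> V" for a v
    using that mons_lookup[of a V v] by blast
  obtain a0 b0 where ab: "a0 \<in> A" "b0 \<in> B" "\<And>a b. a \<in> A \<Longrightarrow> b \<in> B \<Longrightarrow> a + b = a0 + b0 \<Longrightarrow> a = a0 \<and> b = b0"
    using unique_sum_pair[OF V, of A B] ne z by (auto simp: A_def B_def)
  have e: "(a + b = a0 + b0) \<longleftrightarrow> (a = a0 \<and> b = b0)" if "a \<in> mkeys p" "b \<in> mkeys q" for a b
  proof
    assume h: "a + b = a0 + b0"
    have "mkeys (a + b) \<inter> S = {}" unfolding h using ab(1,2) by (auto simp: keys_add_nat A_def B_def)
    then have "a \<in> A" "b \<in> B" using that by (auto simp: keys_add_nat A_def B_def)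
    then show "a = a0 \<and> b = b0" using ab(3) h by blast
  qed simp
  have "mlookup (p * q) (a0 + b0) = (\<Sum>a\<in>mkeys p. \<Sum>b\<in>mkeys q. if a = a0 then (if b = b0 then mlookup p a * mlookup q b else 0) else 0)"
    unfolding lookup_mult_sum by (intro sum.cong refl) (auto simp: e)
  also have "\<dots> = (\<Sum>a\<in>mkeys p. if a = a0 then mlookup p a * mlookup q b0 else 0)"
    using ab(2) by (intro sum.cong refl) (auto simp: B_def)
  also have "\<dots> = mlookup p a0 * mlookup q b0" using ab(1) by (auto simp: A_def)
  finally have "a0 + b0 \<in> mkeys (p * q)" using ab(1,2) by (simp add: in_keys_iff A_def B_def)
  moreover have "a0 + b0 \<notin> hits S" using ab(1,2) by (auto simp: hits_def keys_add_nat A_def B_def)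
  ultimately show ?thesis by blast
qed

lemma prime_hits:
  assumes V: "finite V"
  shows "primeideal (J (hits S)) R"
proof (rule primeidealI[OF J_ideal[OF upset_hits] cring_R])
  have "fr (Poly_Mapping.single 0 1) 1 \<notin> J (hits S)"
    by (subst J_single_iff[OF upset_hits]) (auto simp: hits_def)
  moreover have "fr (Poly_Mapping.single 0 1) 1 \<in> carrier R" by simp
  ultimately show "carrier R \<noteq> J (hits S)" by blast
  fix x y assume xy: "x \<in> carrier R" "y \<in> carrier R" "x \<otimes>\<^bsub>R\<^esub> y \<in> J (hits S)"
  obtain p s where p: "x = fr p s" "p \<in> C" "s \<in> U" by (rule fr_cases[OF xy(1)])
  obtain q t where q: "y = fr q t" "q \<in> C" "t \<in> U" by (rule fr_cases[OF xy(2)])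
  have "fr (p * q) (s * t) \<in> J (hits S)" using xy(3) p q by simp
  then obtain u where u: "u \<in> U" "mkeys (u * (p * q)) \<subseteq> hits S"
    using J_mem[OF upset_hits, of "p * q" "s * t"] p q by auto
  have "0 \<in> mkeys u" using u(1) by (simp add: U_def in_keys_iff)
  moreover have "0 \<notin> hits S" by (simp add: hits_def)
  ultimately have "\<not> mkeys u \<subseteq> hits S" by blast
  then have "mkeys p \<subseteq> hits S \<or> mkeys q \<subseteq> hits S"
    using hits_mult[OF V, of u S "p * q"] hits_mult[OF V, of p S q] u p q U_C[OF u(1)] by auto
  then show "x \<in> J (hits S) \<or> y \<in> J (hits S)" using p q J_I by blast
qed

lemma krull_dim_ge:
  assumes V: "finite V"
  shows "enat (card V) \<le> krull_dim R"
proof -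
  obtain e where e: "bij_betw e {..<card V} V" using ex_bij_betw_nat_finite[OF V] by (auto simp: atLeast0LessThan)
  define P where "P = (\<lambda>i. J (hits (e ` {..<i})))"
  have "P i \<subset> P (Suc i)" if i: "i < card V" for i
  proof -
    have "hits (e ` {..<i}) \<subseteq> hits (e ` {..<Suc i})" by (auto simp: hits_def)
    then have "P i \<subseteq> P (Suc i)" unfolding P_def by (rule J_mono)
    have "x = i" if "e i = e x" "x < i" for x
      using inj_onD[OF bij_betw_imp_inj_on[OF e], of x i] that i by simp
    then have ei: "e i \<in> V" "e i \<notin> e ` {..<i}"
      using bij_betwE[OF e] i by auto
    have m: "Poly_Mapping.single (e i) 1 \<in> mons V" using ei by (simp add: mons_single)
    have "fr (Poly_Mapping.single (Poly_Mapping.single (e i) 1) 1) 1 \<in> P (Suc i)"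
      unfolding P_def J_single_iff[OF upset_hits m U_1] using m by (auto simp: hits_def)
    moreover have "fr (Poly_Mapping.single (Poly_Mapping.single (e i) 1) 1) 1 \<notin> P i"
      unfolding P_def J_single_iff[OF upset_hits m U_1] using ei by (auto simp: hits_def)
    ultimately show ?thesis using \<open>P i \<subseteq> P (Suc i)\<close> by blast
  qed
  moreover have "primeideal (P i) R" for i unfolding P_def by (rule prime_hits[OF V])
  ultimately show ?thesis unfolding krull_dim_def by (intro Sup_upper) blast
qed

section \<open>Upper bound for the dimension: algebraic dependence\<close>

definition bdeg :: "nat \<Rightarrow> ('v, 'k) mpoly set" where
  "bdeg N = {p. mkeys p \<subseteq> {a \<in> mons V. mdeg a \<le> N}}"

lemma bdeg_mult: "p \<in> bdeg N \<Longrightarrow> q \<in> bdeg M \<Longrightarrow> p * q \<in> bdeg (N + M)"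
proof -
  assume pq: "p \<in> bdeg N" "q \<in> bdeg M"
  show ?thesis unfolding bdeg_def
  proof (rule CollectI, rule subsetI)
    fix x assume "x \<in> mkeys (p * q)"
    then obtain a b where "x = a + b" "a \<in> mkeys p" "b \<in> mkeys q" using keys_mult[of p q] by blast
    then show "x \<in> {a \<in> mons V. mdeg a \<le> N + M}" using pq by (auto simp: bdeg_def intro!: add_mono)
  qed
qed

lemma bdeg_1: "1 \<in> bdeg 0" by (simp add: bdeg_def)

lemma bdeg_power: "p \<in> bdeg d \<Longrightarrow> p ^ k \<in> bdeg (d * k)"
  by (induction k) (auto simp: bdeg_1 intro: bdeg_mult)

lemma bdeg_prod: "finite I \<Longrightarrow> (\<And>i. i \<in> I \<Longrightarrow> f i \<in> bdeg (g i)) \<Longrightarrow> (\<Prod>i\<in>I. f i) \<in> bdeg (\<Sum>i\<in>I. g i)"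
  by (induction I rule: finite_induct) (auto simp: bdeg_1 intro: bdeg_mult)

lemma bdeg_mono: "N \<le> M \<Longrightarrow> bdeg N \<subseteq> bdeg M" by (auto simp: bdeg_def)

lemma bdeg_exists: "p \<in> C \<Longrightarrow> \<exists>d. p \<in> bdeg d"
proof -
  assume p: "p \<in> C"
  have "mdeg a \<le> Max (insert 0 (mdeg ` mkeys p))" if "a \<in> mkeys p" for a
    using that by (intro Max_ge) auto
  then show ?thesis using p unfolding bdeg_def C_def by blast
qed

text \<open>By counting: there are \<open>card V + 1\<close> polynomials, and for large
  \<open>D\<close> their products with total exponent at most \<open>D\<close> outnumber the
  monomials of degree at most \<open>d * D\<close> in which these products are expanded. This forces
  a linear relation.\<close>

lemma algebraic_dependence:
  fixes f :: "nat \<Rightarrow> ('v, 'k) mpoly"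
  assumes V: "finite V" and f: "\<And>i. i \<le> card V \<Longrightarrow> f i \<in> C"
  shows "\<exists>E c. finite E \<and> E \<subseteq> mons {..card V} \<and> E \<noteq> {} \<and> (\<forall>\<alpha>\<in>E. c \<alpha> \<noteq> 0) \<and>
    (\<Sum>\<alpha>\<in>E. Poly_Mapping.single 0 (c \<alpha>) * (\<Prod>i\<in>{..card V}. f i ^ mlookup \<alpha> i)) = 0"
proof -
  let ?n = "card V"
  have "\<forall>i. \<exists>d. i \<le> ?n \<longrightarrow> f i \<in> bdeg d" using bdeg_exists f by blast
  then obtain d0 where d0: "\<And>i. i \<le> ?n \<Longrightarrow> f i \<in> bdeg (d0 i)" by metis
  define d where "d = Max (d0 ` {..?n})"
  have d: "f i \<in> bdeg d" if "i \<le> ?n" for i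
  proof -
    have "d0 i \<le> d" using that unfolding d_def by (intro Max_ge) auto
    then show ?thesis using d0[OF that] bdeg_mono by blast
  qed
  obtain D where D: "(d * D + ?n) choose ?n < (D + Suc ?n) choose Suc ?n" using binomial_exceeds by blast
  define E where "E = {\<alpha> \<in> mons {..?n}. mdeg \<alpha> \<le> D}"
  define F where "F = {a \<in> mons V. mdeg a \<le> d * D}"
  define m where "m = (\<lambda>\<alpha>. \<Prod>i\<in>{..?n}. f i ^ mlookup \<alpha> i)"
  have fin: "finite E" "finite F" unfolding E_def F_def using V by (auto intro: finite_mons_le)
  have "card F < card E" unfolding E_def F_def using V D by (simp add: card_mons_le)
  then obtain c where c: "\<exists>\<alpha>\<in>E. c \<alpha> \<noteq> 0" "\<And>x. x \<in> F \<Longrightarrow> (\<Sum>\<alpha>\<in>E. c \<alpha> * mlookup (m \<alpha>) x) = 0"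
    using underdetermined_system[OF fin(2,1), of "\<lambda>\<alpha>. mlookup (m \<alpha>)"] by blast
  have mb: "m \<alpha> \<in> bdeg (d * D)" if "\<alpha> \<in> E" for \<alpha>
  proof -
    have "m \<alpha> \<in> bdeg (\<Sum>i\<in>{..?n}. d * mlookup \<alpha> i)"
      unfolding m_def using d by (intro bdeg_prod bdeg_power) auto
    also have "(\<Sum>i\<in>{..?n}. d * mlookup \<alpha> i) = d * mdeg \<alpha>"
      using that by (subst mdeg_sum[of "{..?n}"]) (auto simp: E_def mons_iff sum_distrib_left)
    also have "bdeg (d * mdeg \<alpha>) \<subseteq> bdeg (d * D)" using that by (intro bdeg_mono) (auto simp: E_def)
    finally show ?thesis .
  qed
  have zero: "(\<Sum>\<alpha>\<in>E. Poly_Mapping.single 0 (c \<alpha>) * m \<alpha>) = 0"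
  proof (rule poly_mapping_eqI)
    fix x
    have "mlookup (\<Sum>\<alpha>\<in>E. Poly_Mapping.single 0 (c \<alpha>) * m \<alpha>) x = (\<Sum>\<alpha>\<in>E. c \<alpha> * mlookup (m \<alpha>) x)"
    proof -
      have "mlookup (Poly_Mapping.single 0 y * p) x = y * mlookup p x" for y and p :: "('v, 'k) mpoly"
        using lookup_single_mult[of 0 y p x] by simp
      then show ?thesis by (simp add: lookup_sum)
    qed
    also have "\<dots> = 0"
    proof (cases "x \<in> F")
      case False
      then have "mlookup (m \<alpha>) x = 0" if "\<alpha> \<in> E" for \<alpha>
        using mb[OF that] unfolding bdeg_def F_def by (auto simp: in_keys_iff)
      then show ?thesis by (simp add: sum.neutral)
    qed (rule c)
    finally show "mlookup (\<Sum>\<alpha>\<in>E. Poly_Mapping.single 0 (c \<alpha>) * m \<alpha>) x = mlookup 0 x" by simp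
  qed
  \<comment> \<open>Terms with coefficient 0 are dropped, since independence along a chain of primes
    is a statement about nonzero coefficients.\<close>
  let ?E = "{\<alpha>\<in>E. c \<alpha> \<noteq> 0}"
  have "(\<Sum>\<alpha>\<in>?E. Poly_Mapping.single 0 (c \<alpha>) * m \<alpha>) = (\<Sum>\<alpha>\<in>E. Poly_Mapping.single 0 (c \<alpha>) * m \<alpha>)"
    using fin by (intro sum.mono_neutral_left) auto
  then have z: "(\<Sum>\<alpha>\<in>?E. Poly_Mapping.single 0 (c \<alpha>) * m \<alpha>) = 0" using zero by simp
  show ?thesis
  proof (intro exI[of _ ?E] exI[of _ c] conjI)
    show "finite ?E" using fin by simp
    show "?E \<subseteq> mons {..?n}" by (auto simp: E_def)
    show "?E \<noteq> {}" using c(1) by blast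
    show "(\<Sum>\<alpha>\<in>?E. Poly_Mapping.single 0 (c \<alpha>) * (\<Prod>i\<in>{..?n}. f i ^ mlookup \<alpha> i)) = 0"
      using z by (simp only: m_def)
  qed blast
qed

text \<open>Cancel the largest common power of \<open>f j\<close>, which is allowed as \<open>f j \<notin> Q j\<close>; the terms still divisible
  by \<open>f j\<close> lie in \<open>Q (Suc j)\<close>, and the remaining ones do not involve \<open>f j\<close>.\<close>

lemma independent_along_prime_chain:
  fixes f :: "nat \<Rightarrow> ('v, 'k) mpoly" and Q :: "nat \<Rightarrow> ('v, 'k) mpoly set" and ex :: "'e \<Rightarrow> nat \<Rightarrow> nat"
  assumes QC: "\<And>i. Q i \<subseteq> C"
    and add: "\<And>i p q. i \<le> N \<Longrightarrow> p \<in> Q i \<Longrightarrow> q \<in> Q i \<Longrightarrow> p - q \<in> Q i"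
    and mult: "\<And>i p q. i \<le> N \<Longrightarrow> p \<in> C \<Longrightarrow> q \<in> Q i \<Longrightarrow> p * q \<in> Q i"
    and prime: "\<And>i p q. i \<le> N \<Longrightarrow> p \<in> C \<Longrightarrow> q \<in> C \<Longrightarrow> p * q \<in> Q i \<Longrightarrow> p \<in> Q i \<or> q \<in> Q i"
    and const: "\<And>i c. i \<le> N \<Longrightarrow> c \<noteq> 0 \<Longrightarrow> Poly_Mapping.single 0 c \<notin> Q i"
    and mono: "\<And>i. i < N \<Longrightarrow> Q i \<subseteq> Q (Suc i)"
    and f: "\<And>i. i < N \<Longrightarrow> f i \<in> Q (Suc i) - Q i"
    and A: "finite A" "A \<noteq> {}" "\<And>\<alpha>. \<alpha> \<in> A \<Longrightarrow> c \<alpha> \<noteq> 0"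
    and inj: "\<And>\<alpha> \<beta>. \<alpha> \<in> A \<Longrightarrow> \<beta> \<in> A \<Longrightarrow> (\<forall>i\<in>{j..<N}. ex \<alpha> i = ex \<beta> i) \<Longrightarrow> \<alpha> = \<beta>"
    and j: "j \<le> N"
  shows "(\<Sum>\<alpha>\<in>A. Poly_Mapping.single 0 (c \<alpha>) * (\<Prod>i\<in>{j..<N}. f i ^ ex \<alpha> i)) \<notin> Q j"
  using j A inj
proof (induction j arbitrary: A rule: inc_induct)
  case base
  obtain \<alpha> where \<alpha>: "\<alpha> \<in> A" using base by blast
  then have "A = {\<alpha>}" using base(4) by auto
  then show ?case using const[of N "c \<alpha>"] base(3)[OF \<alpha>] by simp
next
  case (step j)
  have fC: "f i \<in> C" if "i < N" for i using f[OF that] QC by blast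
  have powC: "p ^ k \<in> C" if "p \<in> C" for p k using that by (induction k) auto
  have prodC: "(\<Prod>i\<in>I. f i ^ e i) \<in> C" if "I \<subseteq> {..<N}" for I and e :: "nat \<Rightarrow> nat"
    using that by (induction I rule: infinite_finite_induct) (auto intro!: C_mult powC fC)
  define e where "e = Min ((\<lambda>\<alpha>. ex \<alpha> j) ` A)"
  have e_le: "e \<le> ex \<alpha> j" if "\<alpha> \<in> A" for \<alpha> using that step.prems unfolding e_def by (intro Min_le) auto
  have "e \<in> (\<lambda>\<alpha>. ex \<alpha> j) ` A" unfolding e_def using step.prems by (intro Min_in) auto
  then obtain \<alpha>0 where \<alpha>0: "\<alpha>0 \<in> A" "ex \<alpha>0 j = e" by auto
  define B where "B = {\<alpha>\<in>A. ex \<alpha> j = e}"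
  define M where "M = (\<lambda>\<alpha>. \<Prod>i\<in>{Suc j..<N}. f i ^ ex \<alpha> i)"
  have MC: "M \<alpha> \<in> C" for \<alpha> unfolding M_def by (intro prodC) auto
  define X where "X = (\<Sum>\<alpha>\<in>B. Poly_Mapping.single 0 (c \<alpha>) * M \<alpha>)"
  \<comment> \<open>The subtraction does not truncate: outside \<open>B\<close> the exponent exceeds
    the minimum \<open>e\<close>, and one further factor \<open>f j\<close> is split off.\<close>
  define Y where "Y = (\<Sum>\<alpha>\<in>A - B. Poly_Mapping.single 0 (c \<alpha>) * (f j ^ (ex \<alpha> j - e - 1) * M \<alpha>))"
  have jN: "j < N" using step by simp
  have YC: "Y \<in> C" unfolding Y_def using fC[OF jN] by (intro C_sum C_mult powC MC) auto
  have XC: "X \<in> C" unfolding X_def by (intro C_sum C_mult MC) auto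
  have "{j..<N} = insert j {Suc j..<N}" using jN by auto
  then have M: "(\<Prod>i\<in>{j..<N}. f i ^ ex \<alpha> i) = f j ^ ex \<alpha> j * M \<alpha>" for \<alpha> by (simp add: M_def)
  have "(\<Sum>\<alpha>\<in>A. Poly_Mapping.single 0 (c \<alpha>) * (\<Prod>i\<in>{j..<N}. f i ^ ex \<alpha> i)) =
     (\<Sum>\<alpha>\<in>B. Poly_Mapping.single 0 (c \<alpha>) * (f j ^ ex \<alpha> j * M \<alpha>)) + (\<Sum>\<alpha>\<in>A - B. Poly_Mapping.single 0 (c \<alpha>) * (f j ^ ex \<alpha> j * M \<alpha>))"
    unfolding M using step.prems(1) by (subst sum.subset_diff[of B A]) (auto simp: B_def add.commute)
  also have "(\<Sum>\<alpha>\<in>B. Poly_Mapping.single 0 (c \<alpha>) * (f j ^ ex \<alpha> j * M \<alpha>)) = f j ^ e * X"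
    unfolding X_def sum_distrib_left by (intro sum.cong refl) (auto simp: B_def mult_ac)
  also have "(\<Sum>\<alpha>\<in>A - B. Poly_Mapping.single 0 (c \<alpha>) * (f j ^ ex \<alpha> j * M \<alpha>)) = f j ^ e * (f j * Y)"
    unfolding Y_def sum_distrib_left
  proof (intro sum.cong refl)
    fix \<alpha> assume "\<alpha> \<in> A - B"
    then have "ex \<alpha> j = e + (1 + (ex \<alpha> j - e - 1))" using e_le[of \<alpha>] by (auto simp: B_def)
    then have "f j ^ ex \<alpha> j = f j ^ e * (f j * f j ^ (ex \<alpha> j - e - 1))" by (metis power_add power_one_right)
    then show "Poly_Mapping.single 0 (c \<alpha>) * (f j ^ ex \<alpha> j * M \<alpha>) =
      f j ^ e * (f j * (Poly_Mapping.single 0 (c \<alpha>) * (f j ^ (ex \<alpha> j - e - 1) * M \<alpha>)))"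
      by (simp only: mult_ac)
  qed
  finally have eq: "(\<Sum>\<alpha>\<in>A. Poly_Mapping.single 0 (c \<alpha>) * (\<Prod>i\<in>{j..<N}. f i ^ ex \<alpha> i)) = f j ^ e * (X + f j * Y)"
    by (simp only: distrib_left)
  have XN: "X \<notin> Q (Suc j)"
    unfolding X_def M_def
  proof (rule step.IH)
    show "finite B" "B \<noteq> {}" using step.prems \<alpha>0 by (auto simp: B_def)
    show "c \<alpha> \<noteq> 0" if "\<alpha> \<in> B" for \<alpha> using that step.prems by (auto simp: B_def)
    show "\<alpha> = \<beta>" if h: "\<alpha> \<in> B" "\<beta> \<in> B" "\<forall>i\<in>{Suc j..<N}. ex \<alpha> i = ex \<beta> i" for \<alpha> \<beta>
    proof (rule step.prems(4))
      show "\<forall>i\<in>{j..<N}. ex \<alpha> i = ex \<beta> i"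
        using h unfolding B_def by (auto simp: Suc_le_eq le_eq_less_or_eq)
    qed (use h in \<open>auto simp: B_def\<close>)
  qed
  show ?case unfolding eq
  proof
    assume in_Q: "f j ^ e * (X + f j * Y) \<in> Q j"
    have ZC: "X + f j * Y \<in> C" using XC YC fC[OF jN] by simp
    have "f j ^ k * (X + f j * Y) \<in> Q j \<Longrightarrow> X + f j * Y \<in> Q j" for k
    proof (induction k)
      case (Suc k)
      then have "f j * (f j ^ k * (X + f j * Y)) \<in> Q j" by (simp add: mult.assoc)
      then have "f j ^ k * (X + f j * Y) \<in> Q j"
        using prime[of j "f j" "f j ^ k * (X + f j * Y)"] jN fC[OF jN] powC ZC f[OF jN] by auto
      then show ?case by (rule Suc.IH)
    qed simp
    then have "X + f j * Y \<in> Q j" using in_Q by blast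
    then have 1: "X + f j * Y \<in> Q (Suc j)" using mono[OF jN] by blast
    have "Y * f j \<in> Q (Suc j)" using f[OF jN] YC jN by (intro mult) auto
    then have "(X + f j * Y) - Y * f j \<in> Q (Suc j)" using 1 jN by (intro add) auto
    then show False using XN by (simp add: mult.commute)
  qed
qed

text \<open>A longer chain would, contracted to the polynomial ring, have \<open>card V + 1\<close>
  strict steps. Polynomials picked from these steps are algebraically dependent by counting, but
  independent along the chain.\<close>

lemma prime_chain_length:
  assumes V: "finite V" and P: "\<And>i. i \<le> l \<Longrightarrow> primeideal (P i) R" and strict: "\<And>i. i < l \<Longrightarrow> P i \<subset> P (Suc i)"
  shows "l \<le> card V"
proof (rule ccontr)
  let ?n = "card V" and ?N = "Suc (card V)"
  assume "\<not> l \<le> ?n"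
  then have l: "?N \<le> l" by simp
  define Q where "Q = (\<lambda>i. {p \<in> C. fr p 1 \<in> P i})"
  have id: "ideal (P i) R" if "i \<le> ?N" for i using P[of i] l that by (simp add: primeideal.axioms(1))
  have "\<exists>p. p \<in> Q (Suc i) - Q i" if i: "i < ?N" for i
  proof -
    interpret I: ideal "P i" R using id i by simp
    interpret I': ideal "P (Suc i)" R using id i by simp
    obtain x where x: "x \<in> P (Suc i)" "x \<notin> P i" using strict[of i] i l by auto
    have "x \<in> carrier R" using I'.Icarr x by blast
    then obtain p s where p: "x = fr p s" "p \<in> C" "s \<in> U" by (rule fr_cases)
    \<comment> \<open>Denominators are units, so a strict step of the chain is already witnessed by
      a numerator.\<close>
    have "fr s 1 \<otimes>\<^bsub>R\<^esub> x = fr p 1" using p by (simp add: U_C, intro fr_eqI) (simp_all add: U_C mult.commute)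
    then have "fr p 1 \<in> P (Suc i)" using I'.I_l_closed[OF x(1), of "fr s 1"] p by (simp add: U_C)
    moreover have "fr p 1 \<notin> P i"
    proof
      assume "fr p 1 \<in> P i"
      then have "fr 1 s \<otimes>\<^bsub>R\<^esub> fr p 1 \<in> P i" using p by (intro I.I_l_closed) auto
      then show False using x p by simp
    qed
    ultimately show ?thesis using p by (auto simp: Q_def)
  qed
  then obtain f where f: "\<And>i. i < ?N \<Longrightarrow> f i \<in> Q (Suc i) - Q i" by metis
  have "f i \<in> C" if "i \<le> ?n" for i using f[of i] that by (auto simp: Q_def)
  then obtain E c where E: "finite E" "E \<subseteq> mons {..?n}" "E \<noteq> {}" "\<forall>\<alpha>\<in>E. c \<alpha> \<noteq> 0"
    "(\<Sum>\<alpha>\<in>E. Poly_Mapping.single 0 (c \<alpha>) * (\<Prod>i\<in>{..?n}. f i ^ mlookup \<alpha> i)) = 0"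
    using algebraic_dependence[OF V, of f] by blast
  have "(\<Sum>\<alpha>\<in>E. Poly_Mapping.single 0 (c \<alpha>) * (\<Prod>i\<in>{0..<?N}. f i ^ mlookup \<alpha> i)) \<notin> Q 0"
  proof (rule independent_along_prime_chain)
    show "Q i \<subseteq> C" for i by (auto simp: Q_def)
    show "p - q \<in> Q i" if "i \<le> ?N" "p \<in> Q i" "q \<in> Q i" for i p q
    proof -
      interpret I: ideal "P i" R using id that by simp
      have "fr p 1 \<ominus>\<^bsub>R\<^esub> fr q 1 \<in> P i" using that by (auto simp: Q_def a_minus_def)
      then show ?thesis using that by (simp add: Q_def a_minus_def R_minus flip: diff_conv_add_uminus)
           (metis C_add C_uminus diff_conv_add_uminus)
    qed
    show "p * q \<in> Q i" if "i \<le> ?N" "p \<in> C" "q \<in> Q i" for i p q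
    proof -
      interpret I: ideal "P i" R using id that by simp
      have "fr p 1 \<otimes>\<^bsub>R\<^esub> fr q 1 \<in> P i" using that by (intro I.I_l_closed) (auto simp: Q_def)
      then show ?thesis using that by (simp add: Q_def)
    qed
    show "p \<in> Q i \<or> q \<in> Q i" if "i \<le> ?N" "p \<in> C" "q \<in> C" "p * q \<in> Q i" for i p q
    proof -
      interpret I: primeideal "P i" R using P l that by simp
      have "fr p 1 \<otimes>\<^bsub>R\<^esub> fr q 1 \<in> P i" using that by (simp add: Q_def)
      then show ?thesis using I.I_prime[of "fr p 1" "fr q 1"] that by (auto simp: Q_def)
    qed
    show "Poly_Mapping.single 0 a \<notin> Q i" if "i \<le> ?N" "a \<noteq> 0" for i a
    proof
      interpret I: primeideal "P i" R using P l that by simp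
      assume "Poly_Mapping.single 0 a \<in> Q i"
      then have "fr (Poly_Mapping.single 0 (inverse a)) 1 \<otimes>\<^bsub>R\<^esub> fr (Poly_Mapping.single 0 a) 1 \<in> P i"
        by (intro I.I_l_closed) (auto simp: Q_def)
      then have "\<one>\<^bsub>R\<^esub> \<in> P i" using that by (simp add: mult_single R_simps(2))
      then show False using I.one_imp_carrier I.I_notcarr by simp
    qed
    show "Q i \<subseteq> Q (Suc i)" if "i < ?N" for i using strict[of i] l that by (auto simp: Q_def)
    show "f i \<in> Q (Suc i) - Q i" if "i < ?N" for i by (rule f[OF that])
    show "finite E" "E \<noteq> {}" "\<And>\<alpha>. \<alpha> \<in> E \<Longrightarrow> c \<alpha> \<noteq> 0" using E by auto
    show "\<alpha> = \<beta>" if "\<alpha> \<in> E" "\<beta> \<in> E" "\<forall>i\<in>{0..<?N}. mlookup \<alpha> i = mlookup \<beta> i" for \<alpha> \<beta>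
    proof (rule poly_mapping_eqI)
      fix i
      have "\<alpha> \<in> mons {..?n}" "\<beta> \<in> mons {..?n}" using that E(2) by auto
      then show "mlookup \<alpha> i = mlookup \<beta> i"
        using that(3) mons_lookup[of \<alpha> "{..?n}" i] mons_lookup[of \<beta> "{..?n}" i] by (cases "i \<le> ?n") auto
    qed
  qed simp
  moreover have "{0..<?N} = {..?n}" by auto
  ultimately have "0 \<notin> Q 0" using E(5) by simp
  moreover have "0 \<in> Q 0"
  proof -
    interpret I: ideal "P 0" R using id by simp
    have "\<zero>\<^bsub>R\<^esub> \<in> P 0" using additive_subgroup.zero_closed[OF I.is_additive_subgroup] .
    then show ?thesis by (simp add: Q_def R_simps(3))
  qed
  ultimately show False by blast
qed

theorem krull_dim_R:
  assumes V: "finite V"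
  shows "krull_dim R = enat (card V)"
proof (rule antisym)
  show "krull_dim R \<le> enat (card V)"
    unfolding krull_dim_def
  proof (rule Sup_least, clarify)
    fix l P assume "\<forall>i\<le>l. primeideal (P i) R" "\<forall>i<l. P i \<subset> P (Suc i)"
    then show "enat l \<le> enat (card V)" using prime_chain_length[OF V, of l P] by simp
  qed
qed (rule krull_dim_ge[OF V])

end

section \<open>Monomials over the monoid of edges\<close>

text \<open>Multiplicatively, the product of the powers \<open>g i ^ y i\<close>. The multiset
  \<open>y\<close> of generators is itself written as a monomial.\<close>

definition comb :: "('i \<Rightarrow> 'v \<Rightarrow>\<^sub>0 nat) \<Rightarrow> ('i \<Rightarrow>\<^sub>0 nat) \<Rightarrow> ('v \<Rightarrow>\<^sub>0 nat)" where
  "comb g y = (\<Sum>i\<in>mkeys y. Poly_Mapping.map (\<lambda>k. mlookup y i * k) (g i))"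

lemma lookup_comb:
  assumes "finite S" "y \<in> mons S"
  shows "mlookup (comb g y) v = (\<Sum>i\<in>S. mlookup y i * mlookup (g i) v)"
proof -
  have "mlookup (comb g y) v = (\<Sum>i\<in>mkeys y. mlookup y i * mlookup (g i) v)"
    by (auto simp: comb_def lookup_sum Poly_Mapping.map.rep_eq when_def intro!: sum.cong)
  also have "\<dots> = (\<Sum>i\<in>S. mlookup y i * mlookup (g i) v)"
    using assms by (intro sum.mono_neutral_left) (auto simp: mons_iff in_keys_iff)
  finally show ?thesis .
qed

lemma lookup_comb_keys: "mlookup (comb g y) v = (\<Sum>i\<in>mkeys y. mlookup y i * mlookup (g i) v)"
  by (rule lookup_comb) (auto simp: mons_iff)

lemma comb_0 [simp]: "comb g 0 = 0"
  by (simp add: comb_def)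

lemma comb_add: "comb g (y + z) = comb g y + comb g z"
proof (rule poly_mapping_eqI)
  fix v
  let ?S = "mkeys y \<union> mkeys z"
  have "finite ?S" "y \<in> mons ?S" "z \<in> mons ?S" "y + z \<in> mons ?S" by (auto simp: mons_iff keys_add_nat)
  then show "mlookup (comb g (y + z)) v = mlookup (comb g y + comb g z) v"
    by (simp add: lookup_comb[of ?S] lookup_add sum.distrib algebra_simps)
qed

lemma comb_single [simp]: "comb g (Poly_Mapping.single i (Suc 0)) = g i"
  by (rule poly_mapping_eqI) (simp add: lookup_comb_keys)

lemma mons_sum: "(\<And>i. i \<in> I \<Longrightarrow> f i \<in> mons S) \<Longrightarrow> (\<Sum>i\<in>I. f i) \<in> mons S"
  by (induction I rule: infinite_finite_induct) auto

lemma comb_mons: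
  assumes "\<And>i. i \<in> S \<Longrightarrow> g i \<in> mons V" "y \<in> mons S"
  shows "comb g y \<in> mons V"
proof -
  have "mlookup (comb g y) v = 0" if "v \<notin> V" for v
  proof -
    have "mlookup (g i) v = 0" if "i \<in> mkeys y" for i
      using assms(1)[of i] assms(2) that \<open>v \<notin> V\<close> mons_lookup[of "g i" V v] by (auto simp: mons_iff)
    then show ?thesis by (simp add: lookup_comb_keys)
  qed
  then show ?thesis by (auto simp: mons_iff in_keys_iff)
qed

lemma weight_comb:
  assumes "finite V"
  shows "(\<Sum>v\<in>V. \<phi> v * int (mlookup (comb g y) v)) = (\<Sum>i\<in>mkeys y. int (mlookup y i) * (\<Sum>v\<in>V. \<phi> v * int (mlookup (g i) v)))"
proof -
  have "(\<Sum>v\<in>V. \<phi> v * int (mlookup (comb g y) v)) = (\<Sum>v\<in>V. \<Sum>i\<in>mkeys y. int (mlookup y i) * (\<phi> v * int (mlookup (g i) v)))"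
    by (simp add: lookup_comb_keys sum_distrib_left mult_ac)
  also have "\<dots> = (\<Sum>i\<in>mkeys y. \<Sum>v\<in>V. int (mlookup y i) * (\<phi> v * int (mlookup (g i) v)))"
    by (rule sum.swap)
  finally show ?thesis by (simp add: sum_distrib_left)
qed

text \<open>Edges are numbered so that multisets of edges become monomials over
  \<open>{..<m}\<close>, to which the counting of down-sets and the lexicographic order
  apply.\<close>

locale edge_monoid =
  fixes V :: "'v set" and ed :: "nat \<Rightarrow> ('v \<Rightarrow>\<^sub>0 nat)" and m :: nat
  assumes fin_V: "finite V" and ed_mons: "\<And>i. i < m \<Longrightarrow> ed i \<in> mons V"
    and ed_deg: "\<And>i. i < m \<Longrightarrow> mdeg (ed i) = 2"
begin

abbreviation "Y \<equiv> mons {..<m}"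

lemma comb_ed_mons: "y \<in> Y \<Longrightarrow> comb ed y \<in> mons V"
  using comb_mons[of "{..<m}" ed V y] ed_mons by simp

lemma mdeg_comb: "y \<in> Y \<Longrightarrow> mdeg (comb ed y) = 2 * mdeg y"
proof (induction "mdeg y" arbitrary: y)
  case 0
  then show ?case by simp
next
  case (Suc n)
  then have "y \<noteq> 0" by auto
  then obtain i y' where y: "i < m" "y' \<in> Y" "y = Poly_Mapping.single i (Suc 0) + y'" "mdeg y = Suc (mdeg y')"
    using mons_decomp_single[OF Suc.prems] by auto
  then have "mdeg (comb ed y') = 2 * mdeg y'" using Suc(1)[of y'] Suc(2) by simp
  then show ?case using y ed_deg[of i] by (simp add: comb_add)
qed

text \<open>Monomials are written additively. \<open>U t\<close> consists of the monomials in the \<open>t\<close>-th power of the ideal,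
  and \<open>\<nu> a\<close> is the order of \<open>a\<close>.\<close>

definition U :: "nat \<Rightarrow> ('v \<Rightarrow>\<^sub>0 nat) set" where
  "U t = {z + comb ed y | z y. z \<in> mons V \<and> y \<in> Y \<and> mdeg y = t}"

lemma U_I: "z \<in> mons V \<Longrightarrow> y \<in> Y \<Longrightarrow> mdeg y = t \<Longrightarrow> z + comb ed y \<in> U t"
  unfolding U_def by blast

lemma U_mons: "U t \<subseteq> mons V"
  by (auto simp: U_def comb_ed_mons)

lemma U_0: "U 0 = mons V"
  using U_mons[of 0] U_I[of _ 0 0] by auto

lemma U_add: "a \<in> U s \<Longrightarrow> b \<in> U t \<Longrightarrow> a + b \<in> U (s + t)"
proof -
  assume "a \<in> U s" "b \<in> U t"
  then obtain z y z' y' where "a = z + comb ed y" "z \<in> mons V" "y \<in> Y" "mdeg y = s"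
    "b = z' + comb ed y'" "z' \<in> mons V" "y' \<in> Y" "mdeg y' = t" unfolding U_def by blast
  moreover from this have "(z + z') + comb ed (y + y') \<in> U (s + t)" by (intro U_I) auto
  ultimately have "(z + z') + comb ed (y + y') \<in> U (s + t)" "a + b = (z + z') + comb ed (y + y')"
    by (simp_all only: comb_add add_ac)
  then show ?thesis by simp
qed

lemma U_Suc_subset: "U (Suc t) \<subseteq> U t"
proof
  fix a assume "a \<in> U (Suc t)"
  then obtain z y where a: "a = z + comb ed y" "z \<in> mons V" "y \<in> Y" "mdeg y = Suc t" unfolding U_def by blast
  then have "y \<noteq> 0" by auto
  then obtain i y' where y: "i < m" "y' \<in> Y" "y = Poly_Mapping.single i (Suc 0) + y'" "mdeg y = Suc (mdeg y')"
    using mons_decomp_single[OF a(3)] by auto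
  have "(z + ed i) + comb ed y' \<in> U t" using a y ed_mons by (intro U_I) auto
  moreover have "a = (z + ed i) + comb ed y'" using a y by (simp add: comb_add add_ac)
  ultimately show "a \<in> U t" by simp
qed

lemma U_antimono: "s \<le> t \<Longrightarrow> U t \<subseteq> U s"
  by (rule lift_Suc_antimono_le[of U]) (use U_Suc_subset in auto)

lemma U_deg: "a \<in> U t \<Longrightarrow> 2 * t \<le> mdeg a"
  by (auto simp: U_def mdeg_comb)

definition \<nu> :: "('v \<Rightarrow>\<^sub>0 nat) \<Rightarrow> nat" where "\<nu> a = (GREATEST t. a \<in> U t)"

text \<open>The greatest \<open>t\<close> exists because \<open>U_deg\<close> bounds
  \<open>t\<close> by the degree of \<open>a\<close>; all smaller values follow since the sets
  \<open>U t\<close> decrease.\<close>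

lemma U_iff: "a \<in> mons V \<Longrightarrow> a \<in> U t \<longleftrightarrow> t \<le> \<nu> a"
proof
  assume a: "a \<in> mons V"
  have b: "\<forall>t. a \<in> U t \<longrightarrow> t \<le> mdeg a" using U_deg by fastforce
  show "a \<in> U t \<Longrightarrow> t \<le> \<nu> a" unfolding \<nu>_def using b by (intro Greatest_le_nat[where b = "mdeg a"]) simp_all
  have "a \<in> U (\<nu> a)" unfolding \<nu>_def
    by (rule GreatestI_nat[where P = "\<lambda>t. a \<in> U t" and k = 0 and b = "mdeg a"]) (use a U_0 b in simp_all)
  then show "t \<le> \<nu> a \<Longrightarrow> a \<in> U t" using U_antimono by blast
qed

lemma \<nu>_add: "a \<in> mons V \<Longrightarrow> b \<in> mons V \<Longrightarrow> \<nu> a + \<nu> b \<le> \<nu> (a + b)"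
  using U_add[of a "\<nu> a" b "\<nu> b"] by (simp add: U_iff)

lemma \<nu>_mono: "a \<in> mons V \<Longrightarrow> b \<in> mons V \<Longrightarrow> \<nu> a \<le> \<nu> (a + b)"
  using \<nu>_add[of a b] by simp

lemma \<nu>_deg: "a \<in> mons V \<Longrightarrow> 2 * \<nu> a \<le> mdeg a"
  using U_iff[of a "\<nu> a"] U_deg by blast

lemma \<nu>_add_comb: "a \<in> mons V \<Longrightarrow> y \<in> Y \<Longrightarrow> \<nu> a + mdeg y \<le> \<nu> (a + comb ed y)"
proof -
  assume a: "a \<in> mons V" "y \<in> Y"
  then have "comb ed y \<in> U (mdeg y)" using U_I[of 0 y] by simp
  then have "mdeg y \<le> \<nu> (comb ed y)" using a comb_ed_mons by (simp add: U_iff)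
  then show ?thesis using \<nu>_add[of a "comb ed y"] a comb_ed_mons by simp
qed

text \<open>The monomials with a nonzero class in the local cohomology.\<close>

definition \<Gamma> :: "('v \<Rightarrow>\<^sub>0 nat) set" where
  "\<Gamma> = {a \<in> mons V. \<exists>\<sigma>. \<forall>b\<in>mons V. \<sigma> \<le> mdeg b \<longrightarrow> Suc (\<nu> a) \<le> \<nu> (a + b)}"

definition \<Gamma>t :: "nat \<Rightarrow> ('v \<Rightarrow>\<^sub>0 nat) set" where "\<Gamma>t t = {a \<in> \<Gamma>. \<nu> a = t}"

lemma \<Gamma>_mons: "a \<in> \<Gamma> \<Longrightarrow> a \<in> mons V" by (simp add: \<Gamma>_def)

text \<open>If the order grows only by the number of edges multiplied in, the threshold
  \<open>\<sigma>\<close> of \<open>a\<close> works for the product too: the edges add the same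
  amount on both sides.\<close>

lemma \<Gamma>_add:
  assumes a: "a \<in> \<Gamma>" and b: "b \<in> mons V" and y: "y \<in> Y" and e: "\<nu> (a + b + comb ed y) = \<nu> a + mdeg y"
  shows "a + b + comb ed y \<in> \<Gamma>"
proof -
  obtain \<sigma> where \<sigma>: "\<And>c. c \<in> mons V \<Longrightarrow> \<sigma> \<le> mdeg c \<Longrightarrow> Suc (\<nu> a) \<le> \<nu> (a + c)"
    using a by (auto simp: \<Gamma>_def)
  have "Suc (\<nu> (a + b + comb ed y)) \<le> \<nu> (a + b + comb ed y + c)" if c: "c \<in> mons V" "\<sigma> \<le> mdeg c" for c
  proof -
    have "Suc (\<nu> a) \<le> \<nu> (a + (b + c))" using c b by (intro \<sigma>) auto
    also have "\<nu> (a + (b + c)) + mdeg y \<le> \<nu> (a + (b + c) + comb ed y)"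
      using a b c y by (intro \<nu>_add_comb) (auto simp: \<Gamma>_mons)
    finally show ?thesis using e by (simp add: add_ac)
  qed
  then show ?thesis using a b y comb_ed_mons by (auto simp: \<Gamma>_def)
qed

text \<open>Dickson's lemma is applied to the factorizations \<open>(z, y)\<close> that realize the
  order, not to the monomials themselves. Compared with a basis element \<open>f\<close> below it,
  such a factorization has surplus edges \<open>x\<close> and a surplus monomial \<open>w\<close>.
  The edges account for the whole growth of the order, so \<open>w\<close> must be small, and
  finitely many \<open>e f + w\<close> generate.\<close>

lemma \<Gamma>_finitely_generated:
  obtains B where "finite B" "B \<subseteq> \<Gamma>"
    "\<And>a. a \<in> \<Gamma> \<Longrightarrow> \<exists>b\<in>B. \<exists>y\<in>Y. a = b + comb ed y \<and> \<nu> a = \<nu> b + mdeg y"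
proof -
  define X where "X = {(z, y). z \<in> mons V \<and> y \<in> Y \<and> z + comb ed y \<in> \<Gamma> \<and> \<nu> (z + comb ed y) = mdeg y}"
  define \<phi> where "\<phi> = (\<lambda>x :: ('v \<Rightarrow>\<^sub>0 nat) \<times> (nat \<Rightarrow>\<^sub>0 nat). case_sum (mlookup (fst x)) (mlookup (snd x)))"
  have finS: "finite (V <+> {..<m})" using fin_V by simp
  obtain F where F: "finite F" "F \<subseteq> X" "\<forall>x\<in>X. \<exists>f\<in>F. \<forall>i\<in>V <+> {..<m}. \<phi> f i \<le> \<phi> x i"
    using finite_dickson_basis[OF finS, of X \<phi>] by (elim exE conjE)
  define e where "e = (\<lambda>x::('v \<Rightarrow>\<^sub>0 nat) \<times> (nat \<Rightarrow>\<^sub>0 nat). fst x + comb ed (snd x))"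
  have "\<forall>f\<in>F. \<exists>\<sigma>. \<forall>b\<in>mons V. \<sigma> \<le> mdeg b \<longrightarrow> Suc (\<nu> (e f)) \<le> \<nu> (e f + b)"
    using F(2) by (auto simp: X_def \<Gamma>_def e_def)
  then obtain \<sigma> where \<sigma>: "\<And>f b. f \<in> F \<Longrightarrow> b \<in> mons V \<Longrightarrow> \<sigma> f \<le> mdeg b \<Longrightarrow> Suc (\<nu> (e f)) \<le> \<nu> (e f + b)"
    by metis
  define T where "T = Max (insert 0 (\<sigma> ` F))"
  have T: "\<sigma> f \<le> T" if "f \<in> F" for f using that F(1) by (auto simp: T_def intro!: Max_ge)
  define B where "B = (\<lambda>(f, w). e f + w) ` (F \<times> {w \<in> mons V. mdeg w \<le> T}) \<inter> \<Gamma>"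
  have "finite B" unfolding B_def using F(1) finite_mons_le[OF fin_V] by auto
  moreover have "\<exists>b\<in>B. \<exists>y\<in>Y. a = b + comb ed y \<and> \<nu> a = \<nu> b + mdeg y" if a: "a \<in> \<Gamma>" for a
  proof -
    have "a \<in> U (\<nu> a)" using a by (simp add: U_iff \<Gamma>_mons)
    then obtain z y where zy: "a = z + comb ed y" "z \<in> mons V" "y \<in> Y" "mdeg y = \<nu> a" unfolding U_def by blast
    then have "(z, y) \<in> X" using a by (auto simp: X_def)
    then obtain f where f: "f \<in> F" "\<forall>i\<in>V <+> {..<m}. \<phi> f i \<le> \<phi> (z, y) i"
      using F(3) by blast
    obtain z0 y0 where f0: "f = (z0, y0)" by (cases f)
    have X0: "z0 \<in> mons V" "y0 \<in> Y" "e f \<in> \<Gamma>" "\<nu> (e f) = mdeg y0"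
      using f(1) F(2) unfolding f0 by (auto simp: X_def e_def)
    have "mlookup z0 v \<le> mlookup z v" for v
      using f(2)[rule_format, of "Inl v"] X0(1) mons_lookup[of z0 V v] unfolding f0 by (cases "v \<in> V") (auto simp: \<phi>_def)
    then have z: "z = z0 + (z - z0)" by (rule add_diff_lookup)
    have "mlookup y0 v \<le> mlookup y v" for v
      using f(2)[rule_format, of "Inr v"] X0(2) mons_lookup[of y0 "{..<m}" v] unfolding f0 by (cases "v < m") (auto simp: \<phi>_def)
    then have y: "y = y0 + (y - y0)" by (rule add_diff_lookup)
    define w where "w = z - z0"
    define x where "x = y - y0"
    have z: "z = z0 + w" and y: "y = y0 + x" using z y by (simp_all add: w_def x_def)
    have w: "w \<in> mons V" using z zy(2) by simp
    have x: "x \<in> Y" using y zy(3) by simp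
    have ae: "a = e f + w + comb ed x" by (simp add: zy(1) z y f0 e_def comb_add add_ac)
    have nua: "\<nu> a = \<nu> (e f) + mdeg x" using zy(4) X0(4) y by simp
    have efw: "e f + w \<in> mons V" using \<Gamma>_mons[OF X0(3)] w by simp
    \<comment> \<open>Squeezed between the two bounds, \<open>w\<close> adds nothing to the order.
      As \<open>e f\<close> lies in \<open>\<Gamma>\<close>, this keeps the degree of
      \<open>w\<close> below the threshold of \<open>f\<close>.\<close>
    have 1: "\<nu> (e f + w) + mdeg x \<le> \<nu> a" unfolding ae using efw x by (rule \<nu>_add_comb)
    have 2: "\<nu> (e f) \<le> \<nu> (e f + w)" using \<nu>_mono[OF \<Gamma>_mons[OF X0(3)] w] .
    have nuw: "\<nu> (e f + w) = \<nu> (e f)" using 1 2 nua by simp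
    have "mdeg w \<le> T"
    proof (rule ccontr)
      assume "\<not> mdeg w \<le> T"
      then have "\<sigma> f \<le> mdeg w" using T[OF f(1)] by simp
      then show False using \<sigma>[OF f(1) w] nuw by simp
    qed
    moreover have "e f + w \<in> \<Gamma>" using \<Gamma>_add[OF X0(3) w, of 0] nuw by simp
    ultimately have "e f + w \<in> B" unfolding B_def using f(1) w by force
    then show ?thesis using ae x nua nuw by (intro bexI[of _ "e f + w"] bexI[of _ x]) auto
  qed
  ultimately show ?thesis using that[of B] by (auto simp: B_def)
qed

lemma finite_\<Gamma>t: "finite (\<Gamma>t t)"
proof -
  obtain B where B: "finite B" "B \<subseteq> \<Gamma>"
    "\<And>a. a \<in> \<Gamma> \<Longrightarrow> \<exists>b\<in>B. \<exists>y\<in>Y. a = b + comb ed y \<and> \<nu> a = \<nu> b + mdeg y"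
    using \<Gamma>_finitely_generated by blast
  have "\<Gamma>t t \<subseteq> (\<lambda>(b, y). b + comb ed y) ` (B \<times> {y \<in> Y. mdeg y \<le> t})"
  proof
    fix a assume "a \<in> \<Gamma>t t"
    then show "a \<in> (\<lambda>(b, y). b + comb ed y) ` (B \<times> {y \<in> Y. mdeg y \<le> t})"
      using B(3)[of a] by (force simp: \<Gamma>t_def)
  qed
  then show ?thesis using B(1) finite_mons_le[of "{..<m}" t] by (auto intro: finite_subset)
qed

text \<open>\<open>D i\<close> consists of the \<open>y\<close> for which \<open>bs i + comb ed y\<close> is the least representation of this monomial: \<open>i\<close> is
  minimal, then \<open>y\<close> in the lexicographic order of \<^typ>\<open>nat \<Rightarrow>\<^sub>0 nat\<close>, which is compatible with addition.\<close>

lemma ev_poly_card_\<Gamma>t: "ev_poly (\<lambda>t. real (card (\<Gamma>t t)))"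
proof -
  obtain B where B: "finite B" "B \<subseteq> \<Gamma>"
    "\<And>a. a \<in> \<Gamma> \<Longrightarrow> \<exists>b\<in>B. \<exists>y\<in>Y. a = b + comb ed y \<and> \<nu> a = \<nu> b + mdeg y"
    using \<Gamma>_finitely_generated by blast
  obtain bs where bs: "bij_betw bs {..<card B} B"
    using ex_bij_betw_nat_finite[OF B(1)] by (auto simp: atLeast0LessThan)
  define r where "r = card B"
  have bsB: "bs i \<in> B" if "i < r" for i using bij_betwE[OF bs] that by (simp add: r_def)
  have bsG: "bs i \<in> \<Gamma>" if "i < r" for i using bsB[OF that] B(2) by blast
  have bsV: "bs i \<in> mons V" if "i < r" for i using bsG[OF that] by (rule \<Gamma>_mons)
  \<comment> \<open>Two representations of one monomial that predict the same order. The relation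
    persists when the same \<open>w\<close> is added to \<open>y\<close> and \<open>z\<close>, which
    makes \<open>D i\<close> a down-set.\<close>
  define rep where "rep = (\<lambda>i y j z. j < r \<and> z \<in> Y \<and> bs j + comb ed z = bs i + comb ed y \<and> \<nu> (bs j) + mdeg z = \<nu> (bs i) + mdeg y)"
  define D where "D = (\<lambda>i. {y \<in> Y. \<nu> (bs i + comb ed y) = \<nu> (bs i) + mdeg y \<and>
      (\<forall>j z. rep i y j z \<longrightarrow> i < j \<or> i = j \<and> y \<le> z)})"
  have D_down: "y \<in> D i" if i: "i < r" and yw: "y + w \<in> D i" for i y w
  proof -
    have Y: "y \<in> Y" "w \<in> Y" using yw by (auto simp: D_def)
    have nu: "\<nu> (bs i + comb ed (y + w)) = \<nu> (bs i) + mdeg (y + w)" using yw by (simp add: D_def)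
    have "\<nu> (bs i + comb ed y) + mdeg w \<le> \<nu> (bs i + comb ed y + comb ed w)"
      using bsV[OF i] Y comb_ed_mons by (intro \<nu>_add_comb) auto
    moreover have "\<nu> (bs i) + mdeg y \<le> \<nu> (bs i + comb ed y)" using bsV[OF i] Y by (intro \<nu>_add_comb) auto
    ultimately have "\<nu> (bs i + comb ed y) = \<nu> (bs i) + mdeg y" using nu by (simp add: comb_add add.assoc)
    moreover have "i < j \<or> i = j \<and> y \<le> z" if "rep i y j z" for j z
    proof -
      have "rep i (y + w) j (z + w)"
        using that Y by (simp add: rep_def comb_add flip: add.assoc)
      then have "i < j \<or> i = j \<and> y + w \<le> z + w" using yw unfolding D_def by blast
      then show ?thesis by simp
    qed
    ultimately show ?thesis using Y by (simp add: D_def)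
  qed
  have DY: "D i \<subseteq> Y" for i by (auto simp: D_def)
  have D_poly: "ev_poly (\<lambda>t. real (card {y \<in> D i. mdeg y = t}))" if "i < r" for i
    using D_down[OF that] DY by (intro ev_poly_downset_count) blast+
  define S where "S = (\<lambda>t i. {y \<in> D i. \<nu> (bs i) + mdeg y = t})"
  have finS: "finite (S t i)" for t i
    by (rule finite_subset[OF _ finite_mons_le[of "{..<m}" t]]) (use DY in \<open>auto simp: S_def\<close>)
  have repr: "\<Gamma>t t = (\<Union>i<r. (\<lambda>y. bs i + comb ed y) ` S t i)" for t
  proof
    show "(\<Union>i<r. (\<lambda>y. bs i + comb ed y) ` S t i) \<subseteq> \<Gamma>t t"
    proof clarify
      fix i y assume i: "i < r" and y: "y \<in> S t i"
      have "bs i + 0 + comb ed y \<in> \<Gamma>"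
        using y bsG[OF i] by (intro \<Gamma>_add) (auto simp: S_def D_def)
      then show "bs i + comb ed y \<in> \<Gamma>t t" using y by (simp add: \<Gamma>t_def S_def D_def)
    qed
    show "\<Gamma>t t \<subseteq> (\<Union>i<r. (\<lambda>y. bs i + comb ed y) ` S t i)"
    proof
      fix a assume "a \<in> \<Gamma>t t"
      then have a: "a \<in> \<Gamma>" "\<nu> a = t" by (auto simp: \<Gamma>t_def)
      define P where "P = (\<lambda>i y. i < r \<and> y \<in> Y \<and> a = bs i + comb ed y \<and> t = \<nu> (bs i) + mdeg y)"
      obtain b y where by_: "b \<in> B" "y \<in> Y" "a = b + comb ed y" "\<nu> a = \<nu> b + mdeg y" using B(3)[OF a(1)] by blast
      have "b \<in> bs ` {..<r}" using bs by_(1) unfolding bij_betw_def r_def by blast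
      then obtain i where "i < r" "bs i = b" by blast
      then have "P i y" using by_ a by (simp add: P_def)
      then have "\<exists>i y. P i y" by blast
      define i0 where "i0 = (LEAST i. \<exists>y. P i y)"
      have i0: "\<exists>y. P i0 y" unfolding i0_def using LeastI_ex[of "\<lambda>i. \<exists>y. P i y"] \<open>\<exists>i y. P i y\<close> by blast
      have i0_le: "i0 \<le> j" if "P j z" for j z unfolding i0_def using that by (intro Least_le) blast
      define ys where "ys = {y. P i0 y}"
      have "finite ys"
        by (rule finite_subset[OF _ finite_mons_le[of "{..<m}" t]]) (auto simp: ys_def P_def)
      moreover have "ys \<noteq> {}" using i0 by (simp add: ys_def)
      ultimately have y0: "Min ys \<in> ys" "\<And>z. z \<in> ys \<Longrightarrow> Min ys \<le> z" by auto
      define y0 where "y0 = Min ys"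
      have P0: "P i0 y0" using y0(1) by (simp add: ys_def y0_def)
      have "y0 \<in> S t i0"
        unfolding S_def D_def
      proof (intro CollectI conjI allI impI)
        show "y0 \<in> Y" "\<nu> (bs i0) + mdeg y0 = t" using P0 by (auto simp: P_def)
        show "\<nu> (bs i0 + comb ed y0) = \<nu> (bs i0) + mdeg y0" using P0 a by (simp add: P_def)
        fix j z assume "rep i0 y0 j z"
        then have Pj: "P j z" using P0 by (auto simp: rep_def P_def)
        show "i0 < j \<or> i0 = j \<and> y0 \<le> z"
        proof (cases "i0 = j")
          case True
          then have "z \<in> ys" using Pj by (simp add: ys_def)
          then show ?thesis using True y0(2) by (simp add: y0_def)
        next
          case False
          then show ?thesis using i0_le[OF Pj] by simp
        qed
      qed
      then show "a \<in> (\<Union>i<r. (\<lambda>y. bs i + comb ed y) ` S t i)" using P0 unfolding P_def by blast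
    qed
  qed
  have unique: "i = j \<and> y = z" if "i < r" "j < r" "y \<in> S t i" "z \<in> S t j" "bs i + comb ed y = bs j + comb ed z" for i j y z t
  proof -
    have D: "y \<in> D i" "z \<in> D j" "\<nu> (bs i) + mdeg y = t" "\<nu> (bs j) + mdeg z = t" using that by (simp_all add: S_def)
    then have "y \<in> Y" "z \<in> Y" using DY by blast+
    then have r: "rep i y j z" "rep j z i y" unfolding rep_def using that(1,2,5) D(3,4) by simp_all
    have "i < j \<or> i = j \<and> y \<le> z" using D(1) r(1) unfolding D_def by blast
    moreover have "j < i \<or> j = i \<and> z \<le> y" using D(2) r(2) unfolding D_def by blast
    ultimately show ?thesis by auto
  qed
  have card_eq: "real (card (\<Gamma>t t)) = (\<Sum>i<r. if \<nu> (bs i) \<le> t then real (card {y \<in> D i. mdeg y = t - \<nu> (bs i)}) else 0)" for t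
  proof -
    have "card (\<Gamma>t t) = (\<Sum>i<r. card ((\<lambda>y. bs i + comb ed y) ` S t i))"
      unfolding repr
    proof (rule card_UN_disjoint)
      show "\<forall>i\<in>{..<r}. \<forall>j\<in>{..<r}. i \<noteq> j \<longrightarrow> (\<lambda>y. bs i + comb ed y) ` S t i \<inter> (\<lambda>y. bs j + comb ed y) ` S t j = {}"
      proof (intro ballI impI, rule ccontr)
        fix i j assume ij: "i \<in> {..<r}" "j \<in> {..<r}" "i \<noteq> j"
          and "(\<lambda>y. bs i + comb ed y) ` S t i \<inter> (\<lambda>y. bs j + comb ed y) ` S t j \<noteq> {}"
        then obtain y z where "y \<in> S t i" "z \<in> S t j" "bs i + comb ed y = bs j + comb ed z" by blast
        then show False using unique[of i j y t z] ij by simp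
      qed
    qed (use finS in auto)
    also have "\<dots> = (\<Sum>i<r. card (S t i))"
    proof (intro sum.cong refl card_image inj_onI)
      fix i y z assume "i \<in> {..<r}" "y \<in> S t i" "z \<in> S t i" "bs i + comb ed y = bs i + comb ed z"
      then show "y = z" using unique[of i i y t z] by simp
    qed
    finally have "card (\<Gamma>t t) = (\<Sum>i<r. card (S t i))" .
    moreover have "real (card (S t i)) = (if \<nu> (bs i) \<le> t then real (card {y \<in> D i. mdeg y = t - \<nu> (bs i)}) else 0)" for i
    proof (cases "\<nu> (bs i) \<le> t")
      case True
      then have "S t i = {y \<in> D i. mdeg y = t - \<nu> (bs i)}" by (auto simp: S_def)
      then show ?thesis using True by simp
    next
      case False
      then have "S t i = {}" by (auto simp: S_def)
      then show ?thesis using False by simp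
    qed
    ultimately show ?thesis by simp
  qed
  show ?thesis unfolding card_eq by (intro ev_poly_sum ev_poly_shift D_poly) auto
qed

text \<open>Up to a factor of bounded degree, elements of \<open>\<Gamma>\<close> are products of
  edges. The upper bound and the vanishing result access \<open>\<Gamma>\<close> through this
  property.\<close>

lemma \<Gamma>_bound:
  obtains c where "\<And>a. a \<in> \<Gamma> \<Longrightarrow> \<exists>b\<in>mons V. \<exists>y\<in>Y. a = b + comb ed y \<and> mdeg b \<le> c \<and> mdeg y \<le> \<nu> a"
proof -
  obtain B where B: "finite B" "B \<subseteq> \<Gamma>"
    "\<And>a. a \<in> \<Gamma> \<Longrightarrow> \<exists>b\<in>B. \<exists>y\<in>Y. a = b + comb ed y \<and> \<nu> a = \<nu> b + mdeg y"
    using \<Gamma>_finitely_generated by blast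
  have "mdeg b \<le> Max (mdeg ` B)" if "b \<in> B" for b using B(1) that by auto
  then have "\<exists>b\<in>mons V. \<exists>y\<in>Y. a = b + comb ed y \<and> mdeg b \<le> Max (mdeg ` B) \<and> mdeg y \<le> \<nu> a" if "a \<in> \<Gamma>" for a
    using B(2) B(3)[OF that] \<Gamma>_mons by fastforce
  then show ?thesis by (rule that)
qed

end

section \<open>The upper bound\<close>

text \<open>Induction on \<open>j\<close> by the absorption identity: each step contributes a factor
  that tends to \<open>\<alpha> / (j + 1)\<close>.\<close>

lemma binomial_asymptotic:
  fixes f :: "nat \<Rightarrow> nat"
  assumes "(\<lambda>p. real (f p) / real p) \<longlonglongrightarrow> \<alpha>"
  shows "(\<lambda>p. real ((f p + j) choose j) / real p ^ j) \<longlonglongrightarrow> \<alpha> ^ j / fact j"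
proof (induction j)
  case (Suc j)
  have "(\<lambda>p. real (f p) / real p + real (Suc j) / real p) \<longlonglongrightarrow> \<alpha> + 0"
    by (intro tendsto_add assms) real_asymp
  then have "(\<lambda>p. (real (f p) / real p + real (Suc j) / real p) / real (Suc j) * (real ((f p + j) choose j) / real p ^ j))
     \<longlonglongrightarrow> (\<alpha> + 0) / real (Suc j) * (\<alpha> ^ j / fact j)"
    by (intro tendsto_mult tendsto_divide Suc tendsto_const) auto
  moreover have "(real (f p) / real p + real (Suc j) / real p) / real (Suc j) * (real ((f p + j) choose j) / real p ^ j)
     = real ((f p + Suc j) choose Suc j) / real p ^ Suc j" for p
  proof -
    have "Suc j * ((f p + Suc j) choose Suc j) = (f p + Suc j) * ((f p + j) choose j)"
      using Suc_times_binomial[of j "f p + j"] by (simp only: add_Suc_right)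
    then have "real (Suc j) * real ((f p + Suc j) choose Suc j) = (real (f p) + real (Suc j)) * real ((f p + j) choose j)"
      by (metis of_nat_add of_nat_mult)
    then have e: "real ((f p + Suc j) choose Suc j) = (real (f p) + real (Suc j)) / real (Suc j) * real ((f p + j) choose j)"
      by (simp only: divide_eq_eq eq_divide_eq times_divide_eq_left) (simp add: mult.commute)
    show ?thesis unfolding e by (simp only: add_divide_distrib[symmetric] power_Suc times_divide_times_eq divide_divide_eq_left mult_ac times_divide_eq_left times_divide_eq_right)
  qed
  moreover have "(\<alpha> + 0) / real (Suc j) * (\<alpha> ^ j / fact j) = \<alpha> ^ Suc j / fact (Suc j)" by simp
  ultimately show ?case by (simp only:)
qed simp

lemma restr_add: "restr W (a + b) = restr W a + restr W b"
  by (rule poly_mapping_eqI) (simp add: lookup_add)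

lemma restr_id: "a \<in> mons W \<Longrightarrow> restr W a = a"
  by (rule poly_mapping_eqI) (auto simp: mons_lookup)

lemma restr_disjoint: "a \<in> mons W' \<Longrightarrow> W \<inter> W' = {} \<Longrightarrow> restr W a = 0"
proof (rule poly_mapping_eqI)
  fix k assume "a \<in> mons W'" "W \<inter> W' = {}"
  then show "mlookup (restr W a) k = mlookup 0 k" using mons_lookup[of a W' k] by (cases "k \<in> W") auto
qed

lemma restr_mons: "restr W a \<in> mons W"
  by (simp add: mons_iff keys_restr)

lemma mdeg_restr_le: "mdeg (restr W a) \<le> mdeg a"
proof -
  have "a = restr W a + (a - restr W a)" by (rule add_diff_lookup) simp
  then show ?thesis by (metis le_add1 mdeg_add)
qed

text \<open>Enlarging \<open>W\<close> by \<open>w\<close> adds those \<open>a\<close> whose degree in \<open>W\<close> crosses \<open>A\<close> by the exponent of \<open>w\<close>.\<close>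

lemma card_halfspace_ge:
  assumes V: "finite V" and W: "W \<subseteq> V" and A: "1 \<le> A" "A \<le> N"
  shows "(\<Sum>j<card W. ((A - 1 + j) choose j) * ((N - A + (card V - 1 - j)) choose (card V - 1 - j)))
     \<le> card {a \<in> mons V. mdeg a = N \<and> A \<le> mdeg (restr W a)}"
proof -
  have "finite W" using V W by (rule finite_subset[rotated])
  then show ?thesis using W
  proof (induction W rule: finite_induct)
    case (insert w W)
    let ?j = "card W"
    have fW: "finite W" by (rule insert)
    have wV: "w \<in> V - W" using insert by auto
    have WV: "W \<subseteq> V" using insert by auto
    \<comment> \<open>The exponent of \<open>w\<close> is raised by what \<open>x\<close> lacks to
      degree \<open>A\<close>. The factor \<open>b\<close> avoids \<open>W\<close> but may contain
      \<open>w\<close>; so the degree in \<open>W\<close> stays below \<open>A\<close>, the degree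
      in \<open>insert w W\<close> reaches it, and the total is \<open>N\<close>.\<close>
    define g where "g = (\<lambda>x b. x + b + Poly_Mapping.single w (A - mdeg x))"
    define P where "P = {x \<in> mons W. mdeg x \<le> A - 1} \<times> {b \<in> mons (V - W). mdeg b = N - A}"
    define S0 where "S0 = {a \<in> mons V. mdeg a = N \<and> A \<le> mdeg (restr W a)}"
    define S1 where "S1 = {a \<in> mons V. mdeg a = N \<and> A \<le> mdeg (restr (insert w W) a)}"
    have fS1: "finite S1" unfolding S1_def by (rule finite_subset[OF _ finite_mons_eq[OF V, of N]]) auto
    have r: "restr W (g x b) = x" if "(x, b) \<in> P" for x b
    proof -
      have "Poly_Mapping.single w (A - mdeg x) \<in> mons {w}" by (simp add: mons_single)
      then have "restr W (Poly_Mapping.single w (A - mdeg x)) = 0"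
        using insert(2) by (intro restr_disjoint) auto
      moreover have "restr W b = 0" using that by (intro restr_disjoint[of _ "V - W"]) (auto simp: P_def)
      ultimately show ?thesis using that by (simp add: g_def restr_add restr_id P_def)
    qed
    have inj: "inj_on (\<lambda>(x, b). g x b) P"
    proof (rule inj_onI, clarify)
      fix x b x' b' assume h: "(x, b) \<in> P" "(x', b') \<in> P" "g x b = g x' b'"
      have "x = x'" using r[OF h(1)] r[OF h(2)] h(3) by simp
      then show "x = x' \<and> b = b'" using h(3) by (simp add: g_def)
    qed
    have sub: "(\<lambda>(x, b). g x b) ` P \<subseteq> S1 - S0"
    proof clarify
      fix x b assume xb: "(x, b) \<in> P"
      then have x: "x \<in> mons W" "mdeg x \<le> A - 1" and b: "b \<in> mons (V - W)" "mdeg b = N - A" by (auto simp: P_def)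
      have "x \<in> mons V" "b \<in> mons V" using x b WV by (auto simp: mons_iff)
      then have gV: "g x b \<in> mons V" using wV by (simp add: g_def mons_single)
      have gd: "mdeg (g x b) = N" using x b A by (simp add: g_def)
      have "restr (insert w W) x = x" using x by (intro restr_id) (auto simp: mons_iff)
      moreover have "restr (insert w W) (Poly_Mapping.single w (A - mdeg x)) = Poly_Mapping.single w (A - mdeg x)"
        by (intro restr_id mons_single) simp
      ultimately have "restr (insert w W) (g x b) = x + restr (insert w W) b + Poly_Mapping.single w (A - mdeg x)"
        by (simp add: g_def restr_add)
      then have "A \<le> mdeg (restr (insert w W) (g x b))" using x A by simp
      then have "g x b \<in> S1" using gV gd by (simp add: S1_def)
      moreover have "\<not> A \<le> mdeg (restr W (g x b))" unfolding r[OF xb] using x A by linarith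
      then have "g x b \<notin> S0" by (simp add: S0_def)
      ultimately show "g x b \<in> S1 - S0" by blast
    qed
    have S01: "S0 \<subseteq> S1"
    proof
      fix a assume a: "a \<in> S0"
      have "restr W a = restr W (restr (insert w W) a)" by (rule poly_mapping_eqI) simp
      then have "mdeg (restr W a) \<le> mdeg (restr (insert w W) a)" by (metis mdeg_restr_le)
      then show "a \<in> S1" using a by (auto simp: S0_def S1_def)
    qed
    have "card P = card {x \<in> mons W. mdeg x \<le> A - 1} * card {b \<in> mons (V - W). mdeg b = N - A}"
      unfolding P_def by (rule card_cartesian_product)
    also have "card {x \<in> mons W. mdeg x \<le> A - 1} = (A - 1 + ?j) choose ?j"
      by (rule card_mons_le[OF fW])
    also have "card {b \<in> mons (V - W). mdeg b = N - A} = (N - A + (card (V - W) - 1)) choose (card (V - W) - 1)"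
      using V wV by (intro card_mons_eq) auto
    also have "card (V - W) - 1 = card V - 1 - ?j" using fW WV by (simp add: card_Diff_subset)
    finally have cP: "card P = ((A - 1 + ?j) choose ?j) * ((N - A + (card V - 1 - ?j)) choose (card V - 1 - ?j))" .
    have "card S0 + card P = card S0 + card ((\<lambda>(x, b). g x b) ` P)" by (simp add: card_image[OF inj])
    also have "\<dots> = card (S0 \<union> (\<lambda>(x, b). g x b) ` P)"
      using sub S01 fS1 by (intro card_Un_disjoint[symmetric]) (auto intro: finite_subset)
    also have "\<dots> \<le> card S1" using sub S01 fS1 by (intro card_mono) auto
    finally have "card S0 + card P \<le> card S1" .
    moreover have "(\<Sum>j<?j. ((A - 1 + j) choose j) * ((N - A + (card V - 1 - j)) choose (card V - 1 - j))) \<le> card S0"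
      unfolding S0_def using insert.IH WV by simp
    ultimately show ?case using cP insert(1,2) by (simp add: S1_def)
  qed simp
qed

text \<open>The monomials of order \<open>t\<close> have degrees \<open>2 t, 2 t + 1, \<dots>, 2 t + C\<close>. Bounding each degree separately would
  lose a factor, but the sums over \<open>t\<close> see every degree only once.\<close>

lemma averaged_limit_le:
  fixes N c :: "nat \<Rightarrow> real" and L :: ereal
  assumes lim: "(\<lambda>t. ereal (N t / real t ^ d)) \<longlonglongrightarrow> L"
    and N0: "\<And>t. 0 \<le> N t" and c0: "\<And>t. 0 \<le> c t"
    and sums: "\<And>T. (\<Sum>t<T. N t) \<le> (\<Sum>t<2 * T + C. c t)"
    and even: "\<And>\<delta>. \<delta> > 0 \<Longrightarrow> \<forall>\<^sub>F p in sequentially. c (2 * p) \<le> (\<kappa> + \<delta>) * real p ^ d"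
    and odd: "\<And>\<delta>. \<delta> > 0 \<Longrightarrow> \<forall>\<^sub>F p in sequentially. c (Suc (2 * p)) \<le> (\<kappa> + \<delta>) * real p ^ d"
  shows "L \<le> ereal (2 * \<kappa>)"
proof (rule ccontr)
  assume "\<not> L \<le> ereal (2 * \<kappa>)"
  then obtain L' where L': "ereal (2 * \<kappa>) < ereal L'" "ereal L' < L"
    using ereal_dense2[of "ereal (2 * \<kappa>)" L] by (auto simp: not_le)
  \<comment> \<open>A quarter of the gap: two degrees per order use up \<open>2 * \<delta>\<close>,
    and another \<open>2 * \<delta>\<close> is left for the contradiction.\<close>
  define \<delta> where "\<delta> = (L' - 2 * \<kappa>) / 4"
  define \<mu> where "\<mu> = \<kappa> + \<delta>"
  have \<delta>: "\<delta> > 0" using L' by (simp add: \<delta>_def)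
  have L'_eq: "L' = 2 * \<mu> + 2 * \<delta>" by (simp add: \<mu>_def \<delta>_def field_simps)
  have "\<forall>\<^sub>F t in sequentially. ereal L' < ereal (N t / real t ^ d)" using lim L'(2) by (rule order_tendstoD)
  with even[OF \<delta>] odd[OF \<delta>] eventually_gt_at_top[of 0]
  have "\<forall>\<^sub>F t in sequentially. c (2 * t) \<le> \<mu> * real t ^ d \<and> c (Suc (2 * t)) \<le> \<mu> * real t ^ d \<and> L' * real t ^ d \<le> N t \<and> t > 0"
    by eventually_elim (auto simp: \<mu>_def field_simps)
  then obtain t0 where t0: "\<And>t. t \<ge> t0 \<Longrightarrow> c (2 * t) \<le> \<mu> * real t ^ d" "\<And>t. t \<ge> t0 \<Longrightarrow> c (Suc (2 * t)) \<le> \<mu> * real t ^ d"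
     "\<And>t. t \<ge> t0 \<Longrightarrow> L' * real t ^ d \<le> N t" "\<And>t. t \<ge> t0 \<Longrightarrow> t > 0"
    unfolding eventually_sequentially by blast
  have "0 \<le> \<mu> * real t0 ^ d" using t0(1)[of t0] c0[of "2 * t0"] by simp
  moreover have "0 < real t0 ^ d" using t0(4)[of t0] by simp
  ultimately have \<mu>0: "0 \<le> \<mu>" by (metis mult_neg_pos not_le)
  have c_le: "c k \<le> \<mu> * real (k div 2) ^ d" if "k div 2 \<ge> t0" for k
    using t0(1,2)[OF that] by (cases "even k") (auto elim!: evenE oddE)
  define K where "K = (\<Sum>t<2 * t0. c t)"
  have K0: "0 \<le> K" unfolding K_def by (intro sum_nonneg c0)
  have split: "(\<Sum>t<2 * T. c t) = (\<Sum>t<T. c (2 * t) + c (Suc (2 * t)))" for T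
    by (induction T) auto
  have main: "2 * \<delta> * (\<Sum>t\<in>{t0..<T}. real t ^ d) \<le> K + real C * (\<mu> * real (T + C) ^ d)" if T: "T \<ge> t0" for T
  proof -
    have "(\<Sum>t\<in>{t0..<T}. L' * real t ^ d) \<le> (\<Sum>t\<in>{t0..<T}. N t)"
      by (intro sum_mono t0(3)) auto
    also have "\<dots> \<le> (\<Sum>t<T. N t)" by (intro sum_mono2) (auto simp: N0)
    also have "\<dots> \<le> (\<Sum>t<2 * T + C. c t)" by (rule sums)
    also have "{..<2 * T + C} = {..<2 * T} \<union> {2 * T..<2 * T + C}" by auto
    also have "(\<Sum>t\<in>{..<2 * T} \<union> {2 * T..<2 * T + C}. c t) = (\<Sum>t<2 * T. c t) + (\<Sum>t\<in>{2 * T..<2 * T + C}. c t)"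
      by (intro sum.union_disjoint) auto
    also have "(\<Sum>t<2 * T. c t) = (\<Sum>t<T. c (2 * t) + c (Suc (2 * t)))" by (rule split)
    also have "{..<T} = {..<t0} \<union> {t0..<T}" using T by auto
    also have "(\<Sum>t\<in>{..<t0} \<union> {t0..<T}. c (2 * t) + c (Suc (2 * t))) = K + (\<Sum>t\<in>{t0..<T}. c (2 * t) + c (Suc (2 * t)))"
      unfolding K_def split by (intro sum.union_disjoint) auto
    also have "(\<Sum>t\<in>{t0..<T}. c (2 * t) + c (Suc (2 * t))) \<le> (\<Sum>t\<in>{t0..<T}. 2 * \<mu> * real t ^ d)"
    proof (intro sum_mono)
      fix t assume "t \<in> {t0..<T}"
      then show "c (2 * t) + c (Suc (2 * t)) \<le> 2 * \<mu> * real t ^ d" using t0(1,2)[of t] by simp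
    qed
    also have "(\<Sum>t\<in>{2 * T..<2 * T + C}. c t) \<le> (\<Sum>t\<in>{2 * T..<2 * T + C}. \<mu> * real (T + C) ^ d)"
    proof (intro sum_mono)
      fix k assume k: "k \<in> {2 * T..<2 * T + C}"
      then have "k div 2 \<ge> t0" "k div 2 \<le> T + C" using T by auto
      then show "c k \<le> \<mu> * real (T + C) ^ d"
        using c_le[of k] \<mu>0 by (smt (verit) mult_left_mono of_nat_0_le_iff of_nat_mono power_mono)
    qed
    finally have "(\<Sum>t\<in>{t0..<T}. L' * real t ^ d) \<le> K + (\<Sum>t\<in>{t0..<T}. 2 * \<mu> * real t ^ d) + real C * (\<mu> * real (T + C) ^ d)"
      by simp
    then show ?thesis unfolding L'_eq by (simp add: algebra_simps sum.distrib flip: sum_distrib_left)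
  qed
  \<comment> \<open>Take \<open>T = 2 * S\<close>. The terms with \<open>S \<le> t\<close> are at
    least \<open>S ^ d\<close>, so the left side of \<open>main\<close> grows like
    \<open>S ^ (d + 1)\<close>, but the right side only like \<open>S ^ d\<close>.\<close>
  have "2 * \<delta> * real S \<le> K + real C * (\<mu> * 3 ^ d)" if S: "S \<ge> t0" "S \<ge> C" for S
  proof -
    have S0: "S > 0" using t0(4) S by simp
    have "real S * real S ^ d = (\<Sum>t\<in>{S..<2 * S}. real S ^ d)" by simp
    also have "\<dots> \<le> (\<Sum>t\<in>{S..<2 * S}. real t ^ d)" by (intro sum_mono power_mono) auto
    also have "\<dots> \<le> (\<Sum>t\<in>{t0..<2 * S}. real t ^ d)" using S by (intro sum_mono2) auto
    finally have "2 * \<delta> * (real S * real S ^ d) \<le> 2 * \<delta> * (\<Sum>t\<in>{t0..<2 * S}. real t ^ d)"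
      using \<delta> by (intro mult_left_mono) auto
    also have "\<dots> \<le> K + real C * (\<mu> * real (2 * S + C) ^ d)" using S by (intro main) auto
    also have "\<dots> \<le> K * real S ^ d + real C * (\<mu> * (3 * real S) ^ d)"
    proof (intro add_mono mult_left_mono power_mono)
      have "1 \<le> real S ^ d" using S0 by (intro one_le_power) auto
      then show "K \<le> K * real S ^ d" using K0 by (simp add: mult_le_cancel_left1)
    qed (use S \<mu>0 in auto)
    also have "\<dots> = (K + real C * (\<mu> * 3 ^ d)) * real S ^ d" by (simp add: power_mult_distrib algebra_simps)
    finally have "(2 * \<delta> * real S) * real S ^ d \<le> (K + real C * (\<mu> * 3 ^ d)) * real S ^ d" by (simp add: mult_ac)
    then show ?thesis using S0 by simp
  qed
  moreover obtain S where "(K + real C * (\<mu> * 3 ^ d)) / (2 * \<delta>) < real S" using reals_Archimedean2 by blast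
  then have "K + real C * (\<mu> * 3 ^ d) < 2 * \<delta> * real S" using \<delta> by (simp add: field_simps)
  then have "K + real C * (\<mu> * 3 ^ d) < 2 * \<delta> * real (max S (max t0 C))"
    using \<delta> by (smt (verit) mult_left_mono of_nat_mono max.cobounded1)
  ultimately show False by (smt (verit) max.cobounded1 max.cobounded2 max.coboundedI2)
qed

section \<open>Monomials balanced over the parts\<close>

context edge_monoid
begin

lemma mdeg_restr_comb:
  assumes "\<And>i. i < m \<Longrightarrow> mdeg (restr W (ed i)) \<le> 1" "y \<in> Y"
  shows "mdeg (restr W (comb ed y)) \<le> mdeg y"
  using assms(2)
proof (induction "mdeg y" arbitrary: y)
  case 0
  then have "comb ed y = 0" by simp
  then have "mdeg (restr W (comb ed y)) \<le> mdeg (0 :: 'v \<Rightarrow>\<^sub>0 nat)" using mdeg_restr_le[of W "comb ed y"] by simp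
  then show ?case by simp
next
  case (Suc n)
  then have "y \<noteq> 0" by auto
  then obtain i y' where y: "i < m" "y' \<in> Y" "y = Poly_Mapping.single i (Suc 0) + y'" "mdeg y = Suc (mdeg y')"
    using mons_decomp_single[OF Suc.prems] by auto
  then have "mdeg (restr W (comb ed y')) \<le> mdeg y'" using Suc(1)[of y'] Suc(2) by simp
  then show ?case using y assms(1)[of i] by (simp add: comb_add restr_add)
qed

text \<open>Let \<open>N = 2 * p + e\<close>. Out of about \<open>(2 p) ^ n1 / n1!\<close> monomials
  of degree \<open>N\<close>, the part \<open>W i\<close> excludes about \<open>p ^ n1 / n1!\<close>
  times a sum of binomial coefficients. The outer factor 2 comes from averaging, with one even and
  one odd degree per order.\<close>

lemma multiplicity_upper_bound:
  fixes W :: "nat \<Rightarrow> 'v set"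
  assumes I: "finite I" and W: "\<And>i. i \<in> I \<Longrightarrow> W i \<subseteq> V" "disjoint_family_on W I"
    and ed_W: "\<And>i e. i \<in> I \<Longrightarrow> e < m \<Longrightarrow> mdeg (restr (W i) (ed e)) \<le> 1"
    and V: "V \<noteq> {}"
    and lim: "(\<lambda>t. ereal (real (card (\<Gamma>t t)) / real t ^ (card V - 1))) \<longlonglongrightarrow> L"
  shows "L \<le> ereal (2 * ((2 ^ (card V - 1) - (\<Sum>i\<in>I. \<Sum>j<card (W i). real ((card V - 1) choose j))) / fact (card V - 1)))"
proof -
  obtain c where c: "\<And>a. a \<in> \<Gamma> \<Longrightarrow> \<exists>b\<in>mons V. \<exists>y\<in>Y. a = b + comb ed y \<and> mdeg b \<le> c \<and> mdeg y \<le> \<nu> a"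
    using \<Gamma>_bound by blast
  define n1 where "n1 = card V - 1"
  \<comment> \<open>Each edge has at most one end in \<open>W i\<close>. For
    \<open>a = b + comb ed y\<close> the degree in \<open>W i\<close> is thus at most
    \<open>mdeg b + mdeg y\<close>, while the full degree is
    \<open>mdeg b + 2 * mdeg y\<close>.\<close>
  define T where "T = (\<lambda>N. {a \<in> mons V. mdeg a = N \<and> (\<forall>i\<in>I. 2 * mdeg (restr (W i) a) \<le> N + c)})"
  \<comment> \<open>Two disjoint parts cannot both hold more than half of the degree, so these sets
    are disjoint and their sizes can be subtracted.\<close>
  define Bd where "Bd = (\<lambda>N i. {a \<in> mons V. mdeg a = N \<and> (N + c) div 2 + 1 \<le> mdeg (restr (W i) a)})"
  have finT: "finite (T N)" for N by (rule finite_subset[OF _ finite_mons_eq[OF fin_V, of N]]) (auto simp: T_def)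
  have finB: "finite (Bd N i)" for N i by (rule finite_subset[OF _ finite_mons_eq[OF fin_V, of N]]) (auto simp: Bd_def)
  have sums: "(\<Sum>t<T'. real (card (\<Gamma>t t))) \<le> (\<Sum>N<2 * T' + c. real (card (T N)))" for T'
  proof -
    have "(\<Sum>t<T'. card (\<Gamma>t t)) = card (\<Union>t<T'. \<Gamma>t t)"
      using finite_\<Gamma>t by (intro card_UN_disjoint[symmetric]) (auto simp: \<Gamma>t_def)
    also have "\<dots> \<le> card (\<Union>N<2 * T' + c. T N)"
    proof (intro card_mono)
      show "(\<Union>t<T'. \<Gamma>t t) \<subseteq> (\<Union>N<2 * T' + c. T N)"
      proof
        fix a assume "a \<in> (\<Union>t<T'. \<Gamma>t t)"
        then have a: "a \<in> \<Gamma>" "\<nu> a < T'" by (auto simp: \<Gamma>t_def)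
        obtain b y where b: "b \<in> mons V" "y \<in> Y" "a = b + comb ed y" "mdeg b \<le> c" "mdeg y \<le> \<nu> a" using c[OF a(1)] by blast
        have d: "mdeg a = mdeg b + 2 * mdeg y" using b by (simp add: mdeg_comb)
        have "2 * mdeg (restr (W i) a) \<le> mdeg a + c" if "i \<in> I" for i
        proof -
          have "mdeg (restr (W i) a) \<le> mdeg b + mdeg y"
            using mdeg_restr_comb[OF ed_W[OF that] b(2)] mdeg_restr_le[of "W i" b] b(3) by (simp add: restr_add)
          then show ?thesis using d b(4) by simp
        qed
        then have "a \<in> T (mdeg a)" using \<Gamma>_mons[OF a(1)] by (simp add: T_def)
        moreover have "mdeg a < 2 * T' + c" using d b a(2) by simp
        ultimately show "a \<in> (\<Union>N<2 * T' + c. T N)" by blast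
      qed
    qed (use finT in auto)
    also have "\<dots> \<le> (\<Sum>N<2 * T' + c. card (T N))" by (intro card_UN_le) auto
    finally have "real (\<Sum>t<T'. card (\<Gamma>t t)) \<le> real (\<Sum>N<2 * T' + c. card (T N))" by (rule of_nat_mono)
    then show ?thesis by (simp only: of_nat_sum)
  qed
  have card_T: "real (card (T N)) \<le> real ((N + n1) choose n1) - (\<Sum>i\<in>I. real (card (Bd N i)))" for N
  proof -
    have disj: "Bd N i \<inter> Bd N j = {}" if ij: "i \<in> I" "j \<in> I" "i \<noteq> j" for i j
    proof (rule ccontr)
      assume "Bd N i \<inter> Bd N j \<noteq> {}"
      then obtain a where a: "a \<in> Bd N i" "a \<in> Bd N j" by blast
      have "W i \<inter> W j = {}" using W(2) ij by (auto simp: disjoint_family_on_def)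
      moreover have "finite (W i)" "finite (W j)" using W(1) ij fin_V finite_subset by blast+
      ultimately have "mdeg (restr (W i \<union> W j) a) = mdeg (restr (W i) a) + mdeg (restr (W j) a)"
        by (simp add: mdeg_restr sum.union_disjoint)
      then have "mdeg (restr (W i) a) + mdeg (restr (W j) a) \<le> N"
        using a mdeg_restr_le[of "W i \<union> W j" a] by (simp add: Bd_def)
      moreover have "N \<le> 2 * ((N + c) div 2) + 1" by arith
      ultimately show False using a by (simp add: Bd_def)
    qed
    have disj2: "T N \<inter> (\<Union>i\<in>I. Bd N i) = {}"
    proof (rule ccontr)
      assume "T N \<inter> (\<Union>i\<in>I. Bd N i) \<noteq> {}"
      then obtain a i where "i \<in> I" "a \<in> T N" "a \<in> Bd N i" by blast
      then have "2 * mdeg (restr (W i) a) \<le> N + c" "(N + c) div 2 + 1 \<le> mdeg (restr (W i) a)"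
        by (simp_all add: T_def Bd_def)
      then show False by arith
    qed
    have "card (T N) + (\<Sum>i\<in>I. card (Bd N i)) = card (T N) + card (\<Union>i\<in>I. Bd N i)"
      using I finB disj by (subst card_UN_disjoint) auto
    also have "\<dots> = card (T N \<union> (\<Union>i\<in>I. Bd N i))"
      using finT finB I disj2 by (intro card_Un_disjoint[symmetric]) auto
    also have "\<dots> \<le> card {a \<in> mons V. mdeg a = N}"
      by (intro card_mono finite_mons_eq fin_V) (auto simp: T_def Bd_def)
    also have "\<dots> = (N + n1) choose n1" unfolding n1_def by (rule card_mons_eq[OF fin_V V])
    finally have "real (card (T N) + (\<Sum>i\<in>I. card (Bd N i))) \<le> real ((N + n1) choose n1)" by (rule of_nat_mono)
    then show ?thesis by (simp only: of_nat_sum of_nat_add le_diff_eq)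
  qed
  define \<kappa> where "\<kappa> = (2 ^ n1 - (\<Sum>i\<in>I. \<Sum>j<card (W i). real (n1 choose j))) / fact n1"
  have jn: "j \<le> n1" if "i \<in> I" "j < card (W i)" for i j
  proof -
    have "card (W i) \<le> card V" using W(1)[OF that(1)] fin_V by (intro card_mono)
    then show ?thesis using that by (simp add: n1_def)
  qed
  have asymp: "\<forall>\<^sub>F p in sequentially. real (card (T (2 * p + e))) \<le> (\<kappa> + \<delta>) * real p ^ n1" if \<delta>: "\<delta> > 0" for \<delta> and e :: nat
  proof -
    \<comment> \<open>In degree \<open>2 * p + e\<close> the threshold of \<open>Bd\<close> is
      \<open>A p + 1\<close>. Thus \<open>A p\<close> is the \<open>A - 1\<close> of
      \<open>card_halfspace_ge\<close>, and \<open>B p\<close> is its \<open>N - A\<close>.\<close>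
    define A where "A = (\<lambda>p::nat. p + (e + c) div 2)"
    define B where "B = (\<lambda>p::nat. p + e - ((e + c) div 2 + 1))"
    define s where "s = (\<lambda>p. real ((2 * p + e + n1) choose n1) / real p ^ n1 -
       (\<Sum>i\<in>I. \<Sum>j<card (W i). real ((A p + j) choose j) / real p ^ j * (real ((B p + (n1 - j)) choose (n1 - j)) / real p ^ (n1 - j))))"
    have limA: "(\<lambda>p. real (A p) / real p) \<longlonglongrightarrow> 1" unfolding A_def of_nat_add by real_asymp
    have limB: "(\<lambda>p. real (B p) / real p) \<longlonglongrightarrow> 1"
    proof (rule Lim_transform_eventually)
      show "(\<lambda>p. (real p + real e - real ((e + c) div 2 + 1)) / real p) \<longlonglongrightarrow> 1" by real_asymp
      show "\<forall>\<^sub>F p in sequentially. (real p + real e - real ((e + c) div 2 + 1)) / real p = real (B p) / real p"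
        using eventually_ge_at_top[of "(e + c) div 2 + 1"] by eventually_elim (simp add: B_def of_nat_diff)
    qed
    have lim2: "(\<lambda>p. real (2 * p + e) / real p) \<longlonglongrightarrow> 2" unfolding of_nat_add of_nat_mult by real_asymp
    have "s \<longlonglongrightarrow> 2 ^ n1 / fact n1 - (\<Sum>i\<in>I. \<Sum>j<card (W i). (1 ^ j / fact j) * (1 ^ (n1 - j) / fact (n1 - j)))"
      unfolding s_def by (intro tendsto_diff tendsto_sum tendsto_mult binomial_asymptotic limA limB lim2)
    moreover have "(\<Sum>i\<in>I. \<Sum>j<card (W i). (1 ^ j / fact j) * (1 ^ (n1 - j) / fact (n1 - j)))
       = (\<Sum>i\<in>I. \<Sum>j<card (W i). real (n1 choose j)) / fact n1"
      unfolding sum_divide_distrib using jn by (intro sum.cong refl) (simp add: binomial_fact)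
    ultimately have "s \<longlonglongrightarrow> \<kappa>" by (simp add: \<kappa>_def diff_divide_distrib)
    then have "\<forall>\<^sub>F p in sequentially. s p < \<kappa> + \<delta>" using \<delta> by (intro order_tendstoD(2)) auto
    with eventually_gt_at_top[of "(e + c) div 2 + 1"] show ?thesis
    proof eventually_elim
      case (elim p)
      have A': "(2 * p + e + c) div 2 = A p" by (simp add: A_def)
      have B': "2 * p + e - (A p + 1) = B p" by (simp add: A_def B_def)
      have "(\<Sum>j<card (W i). real ((A p + j) choose j) * real ((B p + (n1 - j)) choose (n1 - j))) \<le> real (card (Bd (2 * p + e) i))"
        if "i \<in> I" for i
      proof -
        have "(\<Sum>j<card (W i). ((A p + 1 - 1 + j) choose j) * ((2 * p + e - (A p + 1) + (card V - 1 - j)) choose (card V - 1 - j)))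
          \<le> card {a \<in> mons V. mdeg a = 2 * p + e \<and> A p + 1 \<le> mdeg (restr (W i) a)}"
          using elim(1) by (intro card_halfspace_ge fin_V W(1) that) (auto simp: A_def)
        then have "(\<Sum>j<card (W i). ((A p + j) choose j) * ((B p + (n1 - j)) choose (n1 - j))) \<le> card (Bd (2 * p + e) i)"
          unfolding B' Bd_def A' n1_def by simp
        then have "real (\<Sum>j<card (W i). ((A p + j) choose j) * ((B p + (n1 - j)) choose (n1 - j))) \<le> real (card (Bd (2 * p + e) i))"
          by (rule of_nat_mono)
        then show ?thesis by (simp only: of_nat_sum of_nat_mult)
      qed
      then have "(\<Sum>i\<in>I. \<Sum>j<card (W i). real ((A p + j) choose j) * real ((B p + (n1 - j)) choose (n1 - j)))
         \<le> (\<Sum>i\<in>I. real (card (Bd (2 * p + e) i)))" by (rule sum_mono)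
      then have "real (card (T (2 * p + e))) \<le> real ((2 * p + e + n1) choose n1) -
          (\<Sum>i\<in>I. \<Sum>j<card (W i). real ((A p + j) choose j) * real ((B p + (n1 - j)) choose (n1 - j)))"
        using card_T[of "2 * p + e"] by linarith
      also have "\<dots> = s p * real p ^ n1"
      proof -
        have p0: "real p > 0" using elim(1) by simp
        have "(real ((A p + j) choose j) / real p ^ j * (real ((B p + (n1 - j)) choose (n1 - j)) / real p ^ (n1 - j))) * real p ^ n1
          = real ((A p + j) choose j) * real ((B p + (n1 - j)) choose (n1 - j))" if "i \<in> I" "j < card (W i)" for i j
        proof -
          have "real p ^ n1 = real p ^ j * real p ^ (n1 - j)" using jn[OF that] by (simp flip: power_add)
          then show ?thesis using p0 by simp
        qed
        then show ?thesis unfolding s_def left_diff_distrib sum_distrib_right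
          using p0 by (intro arg_cong2[of _ _ _ _ "(-)"] sum.cong refl) auto
      qed
      also have "\<dots> \<le> (\<kappa> + \<delta>) * real p ^ n1" using elim(2) by (intro mult_right_mono) auto
      finally show ?case .
    qed
  qed
  have "L \<le> ereal (2 * \<kappa>)"
  proof (rule averaged_limit_le[where N = "\<lambda>t. real (card (\<Gamma>t t))" and c = "\<lambda>N. real (card (T N))" and d = n1 and C = c])
    show "(\<lambda>t. ereal (real (card (\<Gamma>t t)) / real t ^ n1)) \<longlonglongrightarrow> L" using lim by (simp add: n1_def)
    show "\<forall>\<^sub>F p in sequentially. real (card (T (2 * p))) \<le> (\<kappa> + \<delta>) * real p ^ n1" if "\<delta> > 0" for \<delta>
      using asymp[OF that, of 0] by simp
    show "\<forall>\<^sub>F p in sequentially. real (card (T (Suc (2 * p)))) \<le> (\<kappa> + \<delta>) * real p ^ n1" if "\<delta> > 0" for \<delta>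
      using asymp[OF that, of 1] by simp
  qed (use sums in auto)
  then show ?thesis by (simp only: \<kappa>_def n1_def)
qed

end

section \<open>Vanishing of the limit\<close>

context edge_monoid
begin

text \<open>\<open>\<phi>\<close> vanishes on the edges and thus takes boundedly many values on \<open>\<Gamma>\<close>.\<close>

lemma multiplicity_zero:
  fixes \<phi> :: "'v \<Rightarrow> int"
  assumes \<phi>: "\<And>e. e < m \<Longrightarrow> (\<Sum>v\<in>V. \<phi> v * int (mlookup (ed e) v)) = 0"
    and uv: "u \<in> V" "v \<in> V" "\<phi> u \<noteq> \<phi> v"
    and lim: "(\<lambda>t. ereal (real (card (\<Gamma>t t)) / real t ^ (card V - 1))) \<longlonglongrightarrow> L"
  shows "L = 0"
proof -
  obtain c where c: "\<And>a. a \<in> \<Gamma> \<Longrightarrow> \<exists>b\<in>mons V. \<exists>y\<in>Y. a = b + comb ed y \<and> mdeg b \<le> c \<and> mdeg y \<le> \<nu> a"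
    using \<Gamma>_bound by blast
  define V' where "V' = V - {u, v}"
  have fV': "finite V'" using fin_V by (simp add: V'_def)
  have neq: "u \<noteq> v" using uv by auto
  define n2 where "n2 = card V - 2"
  have cV': "card V' = n2" using uv neq fin_V by (simp add: V'_def n2_def card_Diff_subset)
  have "card {u, v} \<le> card V" using uv fin_V by (intro card_mono) auto
  then have n2: "card V - 1 = Suc n2" using neq by (simp add: n2_def)
  have VV: "V = insert u (insert v V')" using uv by (auto simp: V'_def)
  define wt where "wt = (\<lambda>a. \<Sum>w\<in>V. \<phi> w * int (mlookup a w))"
  define M where "M = (\<Sum>w\<in>V. \<bar>\<phi> w\<bar>) * int c"
  \<comment> \<open>As \<open>\<phi> u\<close> and \<open>\<phi> v\<close> differ, degree and weight
    recover the exponents of \<open>u\<close> and \<open>v\<close> from the others. On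
    \<open>\<Gamma>t t\<close> both take boundedly many values, so only \<open>card V - 2\<close>
    exponents are free, one less than the limit is normalized for.\<close>
  define key where "key = (\<lambda>a. (wt a, mdeg a, restr V' a))"
  have inj: "inj_on key (mons V)"
  proof (rule inj_onI)
    fix a a' assume a: "a \<in> mons V" "a' \<in> mons V" "key a = key a'"
    have eq': "mlookup a w = mlookup a' w" if "w \<in> V'" for w
    proof -
      have "mlookup (restr V' a) w = mlookup (restr V' a') w" using a(3) by (simp add: key_def)
      then show ?thesis using that by simp
    qed
    define S where "S = (\<Sum>w\<in>V'. mlookup a w)"
    define S\<phi> where "S\<phi> = (\<Sum>w\<in>V'. \<phi> w * int (mlookup a w))"
    have S': "(\<Sum>w\<in>V'. mlookup a' w) = S" "(\<Sum>w\<in>V'. \<phi> w * int (mlookup a' w)) = S\<phi>"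
      unfolding S_def S\<phi>_def using eq' by (auto intro: sum.cong)
    have uV': "u \<notin> insert v V'" "v \<notin> V'" using neq by (auto simp: V'_def)
    have "mdeg a = mdeg a'" using a(3) by (simp add: key_def)
    then have "(\<Sum>w\<in>V. mlookup a w) = (\<Sum>w\<in>V. mlookup a' w)" using a fin_V by (simp add: mdeg_sum mons_iff)
    then have 1: "mlookup a u + mlookup a v = mlookup a' u + mlookup a' v"
      using uV' fV' by (simp add: VV S' S_def[symmetric])
    have "wt a = wt a'" using a(3) by (simp add: key_def)
    then have 2: "\<phi> u * int (mlookup a u) + \<phi> v * int (mlookup a v) = \<phi> u * int (mlookup a' u) + \<phi> v * int (mlookup a' v)"
      unfolding wt_def using uV' fV' by (simp add: VV S' S\<phi>_def[symmetric])
    have "int (mlookup a v) = int (mlookup a' u) + int (mlookup a' v) - int (mlookup a u)" using 1 by linarith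
    with 2 have "(\<phi> u - \<phi> v) * (int (mlookup a u) - int (mlookup a' u)) = 0" by (simp add: algebra_simps)
    then have "mlookup a u = mlookup a' u" using uv by simp
    then have "mlookup a w = mlookup a' w" if "w \<in> V" for w using that 1 eq'[of w] VV by auto
    then show "a = a'" using a mons_lookup[of a V] mons_lookup[of a' V] by (intro poly_mapping_eqI) metis
  qed
  define T where "T = (\<lambda>t. {- M..M} \<times> {2 * t..2 * t + c} \<times> {x \<in> mons V'. mdeg x \<le> 2 * t + c})"
  have img: "key ` \<Gamma>t t \<subseteq> T t" for t
  proof
    fix x assume "x \<in> key ` \<Gamma>t t"
    then obtain a where a: "a \<in> \<Gamma>" "\<nu> a = t" "x = key a" by (auto simp: \<Gamma>t_def)
    obtain b y where b: "b \<in> mons V" "y \<in> Y" "a = b + comb ed y" "mdeg b \<le> c" "mdeg y \<le> \<nu> a" using c[OF a(1)] by blast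
    have d: "mdeg a = mdeg b + 2 * mdeg y" using b by (simp add: mdeg_comb)
    have "2 * t \<le> mdeg a" using \<nu>_deg[OF \<Gamma>_mons[OF a(1)]] a(2) by simp
    moreover have "mdeg a \<le> 2 * t + c" using d b a(2) by simp
    moreover have "mdeg (restr V' a) \<le> mdeg a" by (rule mdeg_restr_le)
    moreover have "\<bar>wt a\<bar> \<le> M"
    proof -
      have "wt (comb ed y) = (\<Sum>i\<in>mkeys y. int (mlookup y i) * (\<Sum>v\<in>V. \<phi> v * int (mlookup (ed i) v)))"
        unfolding wt_def by (rule weight_comb[OF fin_V])
      also have "\<dots> = 0" using b(2) \<phi> by (intro sum.neutral) (auto simp: mons_iff)
      finally have "wt a = wt b" unfolding b(3) by (simp add: wt_def lookup_add algebra_simps sum.distrib)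
      also have "\<bar>wt b\<bar> \<le> (\<Sum>w\<in>V. \<bar>\<phi> w * int (mlookup b w)\<bar>)" unfolding wt_def by (rule sum_abs)
      also have "\<dots> \<le> (\<Sum>w\<in>V. \<bar>\<phi> w\<bar> * int c)"
      proof (intro sum_mono)
        fix w
        have "mlookup b w \<le> c" using lookup_le_mdeg[of b w] b(4) by simp
        then show "\<bar>\<phi> w * int (mlookup b w)\<bar> \<le> \<bar>\<phi> w\<bar> * int c" by (simp add: abs_mult mult_left_mono)
      qed
      finally show ?thesis by (simp add: M_def sum_distrib_right)
    qed
    ultimately show "x \<in> T t" unfolding a(3) key_def T_def by (auto simp: restr_mons)
  qed
  define k where "k = real (card {- M..M} * (c + 1))"
  have bound: "real (card (\<Gamma>t t)) \<le> k * real ((2 * t + c + n2) choose n2)" for t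
  proof -
    have "card (\<Gamma>t t) = card (key ` \<Gamma>t t)"
      by (intro card_image[symmetric] inj_on_subset[OF inj]) (auto simp: \<Gamma>t_def \<Gamma>_mons)
    also have "\<dots> \<le> card (T t)" using img finite_mons_le[OF fV', of "2 * t + c"] by (intro card_mono) (auto simp: T_def)
    also have "\<dots> = card {- M..M} * ((c + 1) * ((2 * t + c + n2) choose n2))"
      unfolding T_def card_cartesian_product card_mons_le[OF fV'] cV' by simp
    finally have "real (card (\<Gamma>t t)) \<le> real (card {- M..M} * ((c + 1) * ((2 * t + c + n2) choose n2)))" by (rule of_nat_mono)
    then show ?thesis by (simp only: k_def of_nat_mult mult.assoc)
  qed
  have "(\<lambda>t. real (2 * t + c) / real t) \<longlonglongrightarrow> 2" unfolding of_nat_add of_nat_mult by real_asymp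
  then have "(\<lambda>t. real ((2 * t + c + n2) choose n2) / real t ^ n2) \<longlonglongrightarrow> 2 ^ n2 / fact n2" by (rule binomial_asymptotic)
  moreover have "(\<lambda>t. k / real t) \<longlonglongrightarrow> 0" by real_asymp
  ultimately have "(\<lambda>t. k / real t * (real ((2 * t + c + n2) choose n2) / real t ^ n2)) \<longlonglongrightarrow> 0 * (2 ^ n2 / fact n2)"
    by (intro tendsto_mult)
  then have up: "(\<lambda>t. k * real ((2 * t + c + n2) choose n2) / real t ^ (card V - 1)) \<longlonglongrightarrow> 0" unfolding n2 by simp
  have "(\<lambda>t. real (card (\<Gamma>t t)) / real t ^ (card V - 1)) \<longlonglongrightarrow> 0"
  proof (rule tendsto_sandwich[OF _ _ tendsto_const up])
    show "\<forall>\<^sub>F t in sequentially. real (card (\<Gamma>t t)) / real t ^ (card V - 1) \<le> k * real ((2 * t + c + n2) choose n2) / real t ^ (card V - 1)"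
      using bound by (intro always_eventually allI divide_right_mono) auto
  qed auto
  then have "(\<lambda>t. ereal (real (card (\<Gamma>t t)) / real t ^ (card V - 1))) \<longlonglongrightarrow> ereal 0" by (simp only: lim_ereal)
  then show ?thesis using lim LIMSEQ_unique by (metis zero_ereal_def)
qed

end

section \<open>The lower bound\<close>

text \<open>Iterating \<open>f\<close> leads from every node to one of the odd cycles formed by the nodes with \<open>d v = 0\<close>; \<open>root v\<close>
  tells to which.\<close>

locale odd_functional_graph = edge_monoid V ed m
  for V :: "'v set" and ed :: "nat \<Rightarrow> ('v \<Rightarrow>\<^sub>0 nat)" and m :: nat +
  fixes f :: "'v \<Rightarrow> 'v" and d :: "'v \<Rightarrow> nat" and root :: "'v \<Rightarrow> 'c" and R :: "'c set" and \<rho> :: "'c \<Rightarrow> 'v"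
  assumes f_V: "\<And>v. v \<in> V \<Longrightarrow> f v \<in> V"
    and f_edge: "\<And>v. v \<in> V \<Longrightarrow> \<exists>e<m. ed e = Poly_Mapping.single v 1 + Poly_Mapping.single (f v) 1"
    and d_less: "\<And>v. v \<in> V \<Longrightarrow> 0 < d v \<Longrightarrow> d (f v) < d v"
    and d_0: "\<And>v. v \<in> V \<Longrightarrow> d v = 0 \<Longrightarrow> d (f v) = 0"
    and f_inj: "inj_on f {v \<in> V. d v = 0}"
    and f_odd: "\<And>v. v \<in> V \<Longrightarrow> d v = 0 \<Longrightarrow> \<exists>l. odd l \<and> (f ^^ l) v = v"
    and root_f: "\<And>v. v \<in> V \<Longrightarrow> root (f v) = root v"
    and fin_R: "finite R"
    and \<rho>: "\<And>c. c \<in> R \<Longrightarrow> \<rho> c \<in> V" "\<And>c. c \<in> R \<Longrightarrow> root (\<rho> c) = c"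
    and V_ne: "V \<noteq> {}"
begin

section \<open>Linear independence of the edges selected by \<open>f\<close>\<close>

definition h :: "'v \<Rightarrow> ('v \<Rightarrow>\<^sub>0 nat)" where
  "h v = Poly_Mapping.single v 1 + Poly_Mapping.single (f v) 1"

lemma h_mons: "v \<in> V \<Longrightarrow> h v \<in> mons V"
  by (simp add: h_def mons_single f_V)

lemma comb_h_mons: "y \<in> mons V \<Longrightarrow> comb h y \<in> mons V"
  using comb_mons[of V h V y] h_mons by simp

text \<open>Every \<open>h v\<close> is an edge, so a product of them is a product of equally many
  edges, and the estimates for \<open>\<nu>\<close> carry over.\<close>

lemma comb_h_ed: "y \<in> mons V \<Longrightarrow> \<exists>y'\<in>Y. mdeg y' = mdeg y \<and> comb ed y' = comb h y"
proof (induction "mdeg y" arbitrary: y)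
  case 0
  then show ?case by (intro bexI[of _ 0]) auto
next
  case (Suc n)
  then have "y \<noteq> 0" by auto
  then obtain v z where z: "v \<in> V" "z \<in> mons V" "y = Poly_Mapping.single v (Suc 0) + z" "mdeg y = Suc (mdeg z)"
    using mons_decomp_single[OF Suc.prems] by auto
  obtain z' where z': "z' \<in> Y" "mdeg z' = mdeg z" "comb ed z' = comb h z" using Suc.hyps(1)[of z] Suc.hyps(2) z by auto
  obtain e where e: "e < m" "ed e = h v" using f_edge[OF z(1)] by (auto simp: h_def)
  show ?case
  proof (rule bexI)
    show "mdeg (Poly_Mapping.single e (Suc 0) + z') = mdeg y \<and> comb ed (Poly_Mapping.single e (Suc 0) + z') = comb h y"
      using z z' e by (simp add: comb_add)
    show "Poly_Mapping.single e (Suc 0) + z' \<in> Y" using z' e by (simp add: mons_single)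
  qed
qed

lemma \<nu>_add_comb_h: "a \<in> mons V \<Longrightarrow> y \<in> mons V \<Longrightarrow> \<nu> a + mdeg y \<le> \<nu> (a + comb h y)"
  using comb_h_ed[of y] \<nu>_add_comb[of a] by force

lemma mdeg_comb_h: "y \<in> mons V \<Longrightarrow> mdeg (comb h y) = 2 * mdeg y"
  using comb_h_ed[of y] mdeg_comb by force

lemma f_funpow_V: "v \<in> V \<Longrightarrow> (f ^^ k) v \<in> V"
  by (induction k) (auto intro: f_V)

lemma weight_h:
  assumes y: "y \<in> mons V"
  shows "mlookup (comb h y) w = mlookup y w + (\<Sum>v | v \<in> V \<and> f v = w. mlookup y v)"
proof -
  have "mlookup (comb h y) w = (\<Sum>v\<in>V. mlookup y v * mlookup (h v) w)" by (rule lookup_comb[OF fin_V y])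
  also have "\<dots> = (\<Sum>v\<in>V. (if v = w then mlookup y v else 0) + (if f v = w then mlookup y v else 0))"
    by (intro sum.cong refl) (auto simp: h_def lookup_add lookup_single when_def)
  also have "\<dots> = (\<Sum>v\<in>V. if v = w then mlookup y v else 0) + (\<Sum>v\<in>V. if f v = w then mlookup y v else 0)"
    by (rule sum.distrib)
  also have "(\<Sum>v\<in>V. if v = w then mlookup y v else 0) = mlookup y w"
    using fin_V mons_lookup[OF y, of w] by simp
  also have "(\<Sum>v\<in>V. if f v = w then mlookup y v else 0) = (\<Sum>v | v \<in> V \<and> f v = w. mlookup y v)"
    using fin_V by (simp add: sum.inter_filter)
  finally show ?thesis .
qed

text \<open>Comparing sums of \<open>\<bar>z\<bar>\<close> weighted by \<open>d\<close> shows that \<open>z\<close> vanishes off the cycles; there \<open>f\<close> changes the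
  sign of \<open>z\<close>, and the cycles are odd.\<close>

lemma kernel_trivial:
  fixes z :: "'v \<Rightarrow> int"
  assumes z: "\<And>w. w \<in> V \<Longrightarrow> z w + (\<Sum>v | v \<in> V \<and> f v = w. z v) = 0"
    and w: "w \<in> V"
  shows "z w = 0"
proof -
  \<comment> \<open>Summing over images and then over their fibres visits every \<open>v\<close>
    once, with the first argument equal to \<open>f v\<close>.\<close>
  have fib: "(\<Sum>w\<in>V. \<Sum>v | v \<in> V \<and> f v = w. g w v) = (\<Sum>v\<in>V. g (f v) v)" for g :: "'v \<Rightarrow> 'v \<Rightarrow> int"
  proof -
    have "(\<Sum>w\<in>V. \<Sum>v | v \<in> V \<and> f v = w. g w v) = (\<Sum>w\<in>V. \<Sum>v\<in>V. if f v = w then g w v else 0)"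
      using fin_V by (simp add: sum.inter_filter)
    also have "\<dots> = (\<Sum>v\<in>V. \<Sum>w\<in>V. if f v = w then g w v else 0)" by (rule sum.swap)
    also have "\<dots> = (\<Sum>v\<in>V. g (f v) v)" using fin_V f_V by (intro sum.cong refl) simp
    finally show ?thesis .
  qed
  have d_le: "d (f v) \<le> d v" if "v \<in> V" for v
    using d_less[OF that] d_0[OF that] by (cases "d v = 0") auto
  have "(\<Sum>v\<in>V. int (d v) * \<bar>z v\<bar>) \<le> (\<Sum>w\<in>V. \<Sum>v | v \<in> V \<and> f v = w. int (d w) * \<bar>z v\<bar>)"
  proof (intro sum_mono)
    fix w assume "w \<in> V"
    then have "\<bar>z w\<bar> = \<bar>\<Sum>v | v \<in> V \<and> f v = w. z v\<bar>" using z[of w] by linarith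
    also have "\<dots> \<le> (\<Sum>v | v \<in> V \<and> f v = w. \<bar>z v\<bar>)" by (rule sum_abs)
    finally have "int (d w) * \<bar>z w\<bar> \<le> int (d w) * (\<Sum>v | v \<in> V \<and> f v = w. \<bar>z v\<bar>)" by (intro mult_left_mono) auto
    then show "int (d w) * \<bar>z w\<bar> \<le> (\<Sum>v | v \<in> V \<and> f v = w. int (d w) * \<bar>z v\<bar>)" by (simp add: sum_distrib_left)
  qed
  also have "\<dots> = (\<Sum>v\<in>V. int (d (f v)) * \<bar>z v\<bar>)" by (rule fib)
  finally have le: "(\<Sum>v\<in>V. (int (d v) - int (d (f v))) * \<bar>z v\<bar>) \<le> 0" by (simp add: left_diff_distrib sum_subtractf)
  have nonneg: "0 \<le> (int (d v) - int (d (f v))) * \<bar>z v\<bar>" if "v \<in> V" for v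
    using d_le[OF that] by simp
  have "(\<Sum>v\<in>V. (int (d v) - int (d (f v))) * \<bar>z v\<bar>) = 0"
    using le sum_nonneg[of V "\<lambda>v. (int (d v) - int (d (f v))) * \<bar>z v\<bar>"] nonneg by fastforce
  then have "\<forall>v\<in>V. (int (d v) - int (d (f v))) * \<bar>z v\<bar> = 0"
    using sum_nonneg_eq_0_iff[OF fin_V, of "\<lambda>v. (int (d v) - int (d (f v))) * \<bar>z v\<bar>"] nonneg by simp
  then have off: "z v = 0" if "v \<in> V" "0 < d v" for v
    using that d_less[OF that] by fastforce
  show ?thesis
  proof (cases "d w = 0")
    case True
    have step: "z (f u) = - z u" if u: "u \<in> V" "d u = 0" for u
    proof -
      \<comment> \<open>On the cycles \<open>u\<close> is the only preimage of \<open>f u\<close>,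
        by injectivity; any other preimage lies off the cycles, where \<open>z\<close> already
        vanishes.\<close>
      have "(\<Sum>v | v \<in> V \<and> f v = f u. z v) = (\<Sum>v\<in>{u}. z v)"
      proof (rule sum.mono_neutral_right)
        show "\<forall>v\<in>{v \<in> V. f v = f u} - {u}. z v = 0"
        proof
          fix v assume v: "v \<in> {v \<in> V. f v = f u} - {u}"
          have "d v \<noteq> 0"
          proof
            assume "d v = 0"
            then have "v = u" using v u f_inj by (auto dest: inj_onD)
            then show False using v by simp
          qed
          then show "z v = 0" using off v by simp
        qed
      qed (use u fin_V in auto)
      then show ?thesis using z[OF f_V[OF u(1)]] by simp
    qed
    have pow: "z ((f ^^ k) w) = (- 1) ^ k * z w \<and> d ((f ^^ k) w) = 0" for k
      using w True by (induction k) (auto simp: step f_funpow_V d_0)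
    obtain l where l: "odd l" "(f ^^ l) w = w" using f_odd[OF w True] by blast
    then have "z w = - z w" using pow[of l] by simp
    then show ?thesis by simp
  qed (use off w in auto)
qed

lemma inj_comb_h: "inj_on (comb h) (mons V)"
proof (rule inj_onI)
  fix x y assume xy: "x \<in> mons V" "y \<in> mons V" "comb h x = comb h y"
  have z: "int (mlookup x w) - int (mlookup y w) = 0" if w: "w \<in> V" for w
  proof (rule kernel_trivial[OF _ w])
    fix w
    have e: "int (mlookup (comb h x') w) = int (mlookup x' w) + (\<Sum>v | v \<in> V \<and> f v = w. int (mlookup x' v))"
      if "x' \<in> mons V" for x' using weight_h[OF that] by simp
    show "int (mlookup x w) - int (mlookup y w) + (\<Sum>v | v \<in> V \<and> f v = w. int (mlookup x v) - int (mlookup y v)) = 0"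
      using e[OF xy(1)] e[OF xy(2)] unfolding sum_subtractf xy(3) by linarith
  qed
  then have "mlookup x w = mlookup y w" if "w \<in> V" for w using z[OF that] by linarith
  then show "x = y" using mons_lookup[OF xy(1)] mons_lookup[OF xy(2)] by (intro poly_mapping_eqI) metis
qed

text \<open>The relations between monomials that result from walks of even and odd length.\<close>

definition Ev :: "'v \<Rightarrow> 'v \<Rightarrow> bool" where
  "Ev v w \<longleftrightarrow> (\<exists>y1\<in>mons V. \<exists>y2\<in>mons V. mdeg y2 = mdeg y1 \<and>
      Poly_Mapping.single v 1 + comb h y1 = Poly_Mapping.single w 1 + comb h y2)"

definition Od :: "'v \<Rightarrow> 'v \<Rightarrow> bool" where
  "Od v w \<longleftrightarrow> (\<exists>y1\<in>mons V. \<exists>y2\<in>mons V. mdeg y2 = Suc (mdeg y1) \<and>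
      Poly_Mapping.single v 1 + Poly_Mapping.single w 1 + comb h y1 = comb h y2)"

text \<open>One more step of the walk: multiplication by \<open>f w\<close> completes
  \<open>w\<close> to the edge \<open>h w\<close>, and the parity changes.\<close>

lemma Ev_f: "Ev v w \<Longrightarrow> w \<in> V \<Longrightarrow> Od v (f w)"
proof -
  assume "Ev v w" and w: "w \<in> V"
  then obtain y1 y2 where y: "y1 \<in> mons V" "y2 \<in> mons V" "mdeg y2 = mdeg y1"
    "Poly_Mapping.single v 1 + comb h y1 = Poly_Mapping.single w 1 + comb h y2" by (auto simp: Ev_def)
  have "Poly_Mapping.single v 1 + Poly_Mapping.single (f w) 1 + comb h y1 =
      (Poly_Mapping.single v 1 + comb h y1) + Poly_Mapping.single (f w) 1" by (simp add: add_ac)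
  also have "\<dots> = comb h (y2 + Poly_Mapping.single w (Suc 0))" unfolding y(4) by (simp add: comb_add h_def add_ac)
  finally show ?thesis using y w unfolding Od_def
    by (intro bexI[of _ y1] bexI[of _ "y2 + Poly_Mapping.single w (Suc 0)"]) (auto simp: mons_single)
qed

lemma Od_f: "Od v w \<Longrightarrow> w \<in> V \<Longrightarrow> Ev v (f w)"
proof -
  assume "Od v w" and w: "w \<in> V"
  then obtain y1 y2 where y: "y1 \<in> mons V" "y2 \<in> mons V" "mdeg y2 = Suc (mdeg y1)"
    "Poly_Mapping.single v 1 + Poly_Mapping.single w 1 + comb h y1 = comb h y2" by (auto simp: Od_def)
  have "Poly_Mapping.single v 1 + comb h (y1 + Poly_Mapping.single w (Suc 0)) =
    Poly_Mapping.single (f w) 1 + (Poly_Mapping.single v 1 + Poly_Mapping.single w 1 + comb h y1)"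
    by (simp add: comb_add h_def add_ac)
  also have "\<dots> = Poly_Mapping.single (f w) 1 + comb h y2" unfolding y(4) ..
  finally show ?thesis using y w unfolding Ev_def
    by (intro bexI[of _ "y1 + Poly_Mapping.single w (Suc 0)"] bexI[of _ y2]) (auto simp: mons_single)
qed

text \<open>Iterating \<open>f\<close> leads from \<open>v\<close> to a cycle node \<open>u\<close>,
  directly or with an additional odd return to \<open>u\<close>. The two lengths differ in parity,
  so both \<open>Ev v u\<close> and \<open>Od v u\<close> hold; multiply the two relations and
  cancel \<open>u\<close>. The outcome is that, next to suitable edges, the square of
  \<open>v\<close> acts like one further edge.\<close>

lemma odd_closed_walk:
  assumes v: "v \<in> V"
  shows "\<exists>y1\<in>mons V. \<exists>y2\<in>mons V. mdeg y2 = Suc (mdeg y1) \<and> Poly_Mapping.single v 2 + comb h y1 = comb h y2"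
proof -
  have walk: "if even k then Ev v ((f ^^ k) v) else Od v ((f ^^ k) v)" for k
  proof (induction k)
    case 0
    then show ?case by (auto simp: Ev_def intro!: bexI[of _ 0])
  next
    case (Suc k)
    then show ?case using Ev_f[of v "(f ^^ k) v"] Od_f[of v "(f ^^ k) v"] f_funpow_V[OF v, of k] by auto
  qed
  have "\<exists>k. d ((f ^^ k) x) = 0" if "x \<in> V" for x
    using that
  proof (induction "d x" arbitrary: x rule: less_induct)
    case less
    show ?case
    proof (cases "d x = 0")
      case True
      then show ?thesis by (intro exI[of _ 0]) simp
    next
      case False
      then obtain k where "d ((f ^^ k) (f x)) = 0" using less d_less[of x] f_V[of x] by auto
      then show ?thesis by (intro exI[of _ "Suc k"]) (simp add: funpow_swap1)
    qed
  qed
  then obtain k where k: "d ((f ^^ k) v) = 0" using v by blast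
  define u where "u = (f ^^ k) v"
  obtain l where l: "odd l" "(f ^^ l) u = u" using f_odd[of u] k f_funpow_V[OF v] by (auto simp: u_def)
  have "(f ^^ (l + k)) v = u" using l by (simp add: funpow_add u_def)
  then have "Ev v u \<and> Od v u" using walk[of k] walk[of "l + k"] l(1) by (cases "even k") (auto simp: u_def)
  then obtain y1 y2 y3 y4 where y: "y1 \<in> mons V" "y2 \<in> mons V" "mdeg y2 = mdeg y1"
      "Poly_Mapping.single v 1 + comb h y1 = Poly_Mapping.single u 1 + comb h y2"
    and y': "y3 \<in> mons V" "y4 \<in> mons V" "mdeg y4 = Suc (mdeg y3)"
      "Poly_Mapping.single v 1 + Poly_Mapping.single u 1 + comb h y3 = comb h y4"
    unfolding Ev_def Od_def by blast
  have "Poly_Mapping.single u 1 + (Poly_Mapping.single v 2 + comb h (y1 + y3)) =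
     (Poly_Mapping.single v 1 + comb h y1) + (Poly_Mapping.single v 1 + Poly_Mapping.single u 1 + comb h y3)"
  proof -
    have "Poly_Mapping.single v (2::nat) = Poly_Mapping.single v 1 + Poly_Mapping.single v 1"
      by (simp only: single_add[symmetric] one_add_one)
    then show ?thesis by (simp only: comb_add add_ac)
  qed
  also have "\<dots> = Poly_Mapping.single u 1 + comb h (y2 + y4)" unfolding y(4) y'(4) by (simp add: comb_add add_ac)
  finally have "Poly_Mapping.single v 2 + comb h (y1 + y3) = comb h (y2 + y4)" by (simp only: add_left_cancel)
  then show ?thesis using y y' by (intro bexI[of _ "y1 + y3"] bexI[of _ "y2 + y4"]) auto
qed

text \<open>Representatives of the cosets: one marked node for each cycle in
  \<open>S\<close>.\<close>

definition r :: "'c set \<Rightarrow> ('v \<Rightarrow>\<^sub>0 nat)" where "r S = (\<Sum>c\<in>S. Poly_Mapping.single (\<rho> c) 1)"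

lemma r_mons: "S \<subseteq> R \<Longrightarrow> r S \<in> mons V"
  unfolding r_def using \<rho>(1) by (intro mons_sum mons_single) auto

lemma mdeg_r: "finite S \<Longrightarrow> mdeg (r S) = card S"
  unfolding r_def by (induction S rule: finite_induct) auto

text \<open>Both ends of \<open>h i\<close> have the same root, so every \<open>h i\<close>
  contributes 0 or 2 to the degree over root \<open>c\<close>, whereas \<open>r S\<close>
  contributes 1 exactly if \<open>c\<close> is in \<open>S\<close>.\<close>

lemma parity:
  assumes S: "S \<subseteq> R" and y: "y \<in> mons V" and c: "c \<in> R"
  shows "odd (\<Sum>v\<in>V. (if root v = c then 1 else 0) * int (mlookup (r S + comb h y) v)) \<longleftrightarrow> c \<in> S"
proof -
  let ?\<phi> = "\<lambda>v. if root v = c then 1 else 0 :: int"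
  have fS: "finite S" using S fin_R by (rule finite_subset)
  have "(\<Sum>v\<in>V. ?\<phi> v * int (mlookup (h i) v)) = 2 * ?\<phi> i" if i: "i \<in> V" for i
  proof -
    have "(\<Sum>v\<in>V. ?\<phi> v * int (mlookup (h i) v)) = (\<Sum>v\<in>V. (if v = i then ?\<phi> v else 0) + (if v = f i then ?\<phi> v else 0))"
      by (intro sum.cong refl) (auto simp: h_def lookup_add lookup_single when_def)
    also have "\<dots> = ?\<phi> i + ?\<phi> (f i)" using fin_V i f_V[OF i] by (simp add: sum.distrib)
    finally show ?thesis using root_f[OF i] by simp
  qed
  then have "(\<Sum>v\<in>V. ?\<phi> v * int (mlookup (comb h y) v)) = (\<Sum>i\<in>mkeys y. int (mlookup y i) * (2 * ?\<phi> i))"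
    using y unfolding weight_comb[OF fin_V] by (intro sum.cong refl) (auto simp: mons_iff)
  also have "\<dots> = 2 * (\<Sum>i\<in>mkeys y. int (mlookup y i) * ?\<phi> i)" by (simp add: sum_distrib_left mult_ac)
  finally have 1: "even (\<Sum>v\<in>V. ?\<phi> v * int (mlookup (comb h y) v))" by simp
  have "(\<Sum>v\<in>V. ?\<phi> v * int (mlookup (r S) v)) = (\<Sum>v\<in>V. \<Sum>c'\<in>S. if v = \<rho> c' then ?\<phi> v else 0)"
    by (intro sum.cong refl) (auto simp: r_def lookup_sum lookup_single when_def intro!: sum.cong)
  also have "\<dots> = (\<Sum>c'\<in>S. \<Sum>v\<in>V. if v = \<rho> c' then ?\<phi> v else 0)" by (rule sum.swap)
  also have "\<dots> = (\<Sum>c'\<in>S. if c' = c then 1 else 0)"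
  proof (intro sum.cong refl)
    fix c' assume "c' \<in> S"
    then have "c' \<in> R" using S by blast
    then show "(\<Sum>v\<in>V. if v = \<rho> c' then ?\<phi> v else 0) = (if c' = c then 1 else 0)"
      using fin_V \<rho>[of c'] by simp
  qed
  also have "\<dots> = (if c \<in> S then 1 else 0)" using fS by simp
  finally have 2: "(\<Sum>v\<in>V. ?\<phi> v * int (mlookup (r S) v)) = (if c \<in> S then 1 else 0)" .
  have "(\<Sum>v\<in>V. ?\<phi> v * int (mlookup (r S + comb h y) v)) =
     (\<Sum>v\<in>V. ?\<phi> v * int (mlookup (r S) v)) + (\<Sum>v\<in>V. ?\<phi> v * int (mlookup (comb h y) v))"
    by (simp add: lookup_add distrib_left sum.distrib)
  then show ?thesis using 1 2 by simp
qed

text \<open>The excess of \<open>\<nu> (r S + comb h y)\<close> over \<open>mdeg y\<close> is bounded and increases with \<open>y\<close>.\<close>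

lemma eventually_additive:
  obtains base \<kappa> where "base \<in> mons V"
    "\<And>S w. S \<subseteq> R \<Longrightarrow> w \<in> mons V \<Longrightarrow> \<nu> (r S + comb h (base + w)) = mdeg (base + w) + \<kappa> S"
proof -
  define g where "g = (\<lambda>S y. \<nu> (r S + comb h y) - mdeg y)"
  have nu_ge: "mdeg y \<le> \<nu> (r S + comb h y)" if "S \<subseteq> R" "y \<in> mons V" for S y
    using \<nu>_add_comb_h[OF r_mons[OF that(1)] that(2)] by simp
  have g_mono: "g S y \<le> g S (y + w)" if S: "S \<subseteq> R" and y: "y \<in> mons V" and w: "w \<in> mons V" for S y w
  proof -
    have "\<nu> (r S + comb h y) + mdeg w \<le> \<nu> (r S + comb h y + comb h w)"
      using r_mons[OF S] comb_h_mons[OF y] w by (intro \<nu>_add_comb_h) simp_all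
    then show ?thesis by (simp add: g_def comb_add add.assoc)
  qed
  have "\<exists>y. y \<in> mons V \<and> (\<forall>z. z \<in> mons V \<longrightarrow> g S z \<le> g S y)" if S: "S \<subseteq> R" for S
  proof (rule ex_has_greatest_nat[where P = "\<lambda>y. y \<in> mons V" and f = "g S" and k = 0 and b = "Suc (card R)"])
    show "\<forall>z. z \<in> mons V \<longrightarrow> g S z < Suc (card R)"
    proof (intro allI impI)
      fix z assume z: "z \<in> mons V"
      have fS: "finite S" using S fin_R by (rule finite_subset)
      \<comment> \<open>The degree exceeds twice the number of edges only by the marked nodes in
        \<open>r S\<close>, so the excess is at most half of their number.\<close>
      have "2 * \<nu> (r S + comb h z) \<le> mdeg (r S + comb h z)"
        using r_mons[OF S] comb_h_mons[OF z] by (intro \<nu>_deg) simp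
      also have "\<dots> = card S + 2 * mdeg z" using z fS by (simp add: mdeg_r mdeg_comb_h)
      finally have "2 * g S z \<le> card S" by (simp add: g_def)
      moreover have "card S \<le> card R" using S fin_R by (intro card_mono)
      ultimately show "g S z < Suc (card R)" by simp
    qed
  qed (rule mons_0)
  then obtain y0 where y0: "\<And>S. S \<subseteq> R \<Longrightarrow> y0 S \<in> mons V" "\<And>S z. S \<subseteq> R \<Longrightarrow> z \<in> mons V \<Longrightarrow> g S z \<le> g S (y0 S)"
    by metis
  \<comment> \<open>The sum lies above the maximizer \<open>y0 S\<close> for every \<open>S\<close>,
    so by monotonicity all the excesses have reached their maxima from \<open>base\<close>
    on.\<close>
  define base where "base = (\<Sum>S\<in>Pow R. y0 S)"
  have base: "base \<in> mons V" unfolding base_def using y0 by (intro mons_sum) auto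
  have "\<nu> (r S + comb h (base + w)) = mdeg (base + w) + g S (y0 S)" if S: "S \<subseteq> R" and w: "w \<in> mons V" for S w
  proof -
    have "base = y0 S + (\<Sum>S'\<in>Pow R - {S}. y0 S')"
      unfolding base_def using S fin_R by (intro sum.remove) auto
    moreover have "(\<Sum>S'\<in>Pow R - {S}. y0 S') \<in> mons V" using y0 by (intro mons_sum) auto
    ultimately have "g S (y0 S) \<le> g S (base + w)"
      using g_mono[OF S y0(1)[OF S], of "(\<Sum>S'\<in>Pow R - {S}. y0 S') + w"] w by (simp add: add.assoc)
    moreover have "g S (base + w) \<le> g S (y0 S)" using S base w by (intro y0) auto
    ultimately have "g S (base + w) = g S (y0 S)" by simp
    then show ?thesis using nu_ge[OF S, of "base + w"] base w by (simp add: g_def)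
  qed
  then show ?thesis using that[of base "\<lambda>S. g S (y0 S)"] base by blast
qed

text \<open>The order of \<open>a S w\<close> is \<open>mdeg w\<close> plus a constant, and squares
  of nodes raise it, so these monomials belong to \<open>\<Gamma>\<close>. For fixed
  \<open>S\<close>, order \<open>t\<close> is attained by about \<open>t ^ n1 / n1!\<close> of them,
  and different \<open>S\<close> are told apart by parity.\<close>

lemma multiplicity_lower_bound:
  assumes lim: "(\<lambda>t. ereal (real (card (\<Gamma>t t)) / real t ^ (card V - 1))) \<longlonglongrightarrow> L"
  shows "ereal (2 ^ card R / fact (card V - 1)) \<le> L"
proof -
  define n1 where "n1 = card V - 1"
  obtain b0 \<kappa> where b0: "b0 \<in> mons V"
    "\<And>S w. S \<subseteq> R \<Longrightarrow> w \<in> mons V \<Longrightarrow> \<nu> (r S + comb h (b0 + w)) = mdeg (b0 + w) + \<kappa> S"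
    using eventually_additive by blast
  have "\<forall>v\<in>V. \<exists>y1 y2. y1 \<in> mons V \<and> y2 \<in> mons V \<and> mdeg y2 = Suc (mdeg y1) \<and> Poly_Mapping.single v 2 + comb h y1 = comb h y2"
    using odd_closed_walk by blast
  then obtain y1 y2 where yy: "\<And>v. v \<in> V \<Longrightarrow> y1 v \<in> mons V" "\<And>v. v \<in> V \<Longrightarrow> y2 v \<in> mons V"
    "\<And>v. v \<in> V \<Longrightarrow> mdeg (y2 v) = Suc (mdeg (y1 v))"
    "\<And>v. v \<in> V \<Longrightarrow> Poly_Mapping.single v 2 + comb h (y1 v) = comb h (y2 v)" by metis
  \<comment> \<open>The auxiliary edges of all nodes are multiplied in at once, so that the relation
    of \<open>odd_closed_walk\<close> is available at whichever node is squared.\<close>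
  define M where "M = (\<Sum>v\<in>V. y1 v)"
  have M: "M \<in> mons V" unfolding M_def using yy by (intro mons_sum)
  define a where "a = (\<lambda>S w. r S + comb h (b0 + (M + w)))"
  have aV: "a S w \<in> mons V" if "S \<subseteq> R" "w \<in> mons V" for S w
    using that r_mons comb_h_mons b0(1) M by (simp add: a_def)
  have nu_a: "\<nu> (a S w) = mdeg b0 + mdeg M + mdeg w + \<kappa> S" if "S \<subseteq> R" "w \<in> mons V" for S w
    using b0(2)[OF that(1), of "M + w"] that M by (simp add: a_def)
  have a2: "\<nu> (Poly_Mapping.single v 2 + a S w) = Suc (\<nu> (a S w))" if S: "S \<subseteq> R" and w: "w \<in> mons V" and v: "v \<in> V" for S w v
  proof -
    define M' where "M' = (\<Sum>u\<in>V - {v}. y1 u)"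
    have M'V: "M' \<in> mons V" unfolding M'_def using yy by (intro mons_sum) auto
    have MM: "M = y1 v + M'" unfolding M_def M'_def using fin_V v by (rule sum.remove)
    have "Poly_Mapping.single v 2 + a S w = (Poly_Mapping.single v 2 + comb h (y1 v)) + (r S + comb h b0 + comb h M' + comb h w)"
      by (simp add: a_def MM comb_add add_ac)
    also have "\<dots> = r S + comb h (b0 + (y2 v + M' + w))" unfolding yy(4)[OF v] by (simp add: comb_add add_ac)
    finally have "\<nu> (Poly_Mapping.single v 2 + a S w) = mdeg (b0 + (y2 v + M' + w)) + \<kappa> S"
      using b0(2)[OF S, of "y2 v + M' + w"] yy(2)[OF v] M'V w by simp
    then show ?thesis using nu_a[OF S w] yy(3)[OF v] by (simp add: MM)
  qed
  have aG: "a S w \<in> \<Gamma>" if S: "S \<subseteq> R" and w: "w \<in> mons V" for S w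
  proof -
    \<comment> \<open>A monomial of this degree contains the square of some node, and one square is
      enough to raise the order.\<close>
    have "Suc (\<nu> (a S w)) \<le> \<nu> (a S w + b)" if b: "b \<in> mons V" "card V * 2 + 1 \<le> mdeg b" for b
    proof -
      obtain v b' where v: "v \<in> V" "b' \<in> mons V" "b = Poly_Mapping.single v 2 + b'"
        using pigeonhole_mons[OF fin_V b] by blast
      have "\<nu> (Poly_Mapping.single v 2 + a S w) \<le> \<nu> (Poly_Mapping.single v 2 + a S w + b')"
        using aV[OF S w] v by (intro \<nu>_mono) (auto simp: mons_single)
      then show ?thesis using a2[OF S w v(1)] v(3) by (simp add: add_ac)
    qed
    then show ?thesis using aV[OF S w] unfolding \<Gamma>_def by blast
  qed
  have inj: "S = S' \<and> w = w'" if h: "S \<subseteq> R" "S' \<subseteq> R" "w \<in> mons V" "w' \<in> mons V" "a S w = a S' w'" for S S' w w'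
  proof -
    have "c \<in> S \<longleftrightarrow> c \<in> S'" if c: "c \<in> R" for c
    proof -
      have b: "b0 + (M + w) \<in> mons V" "b0 + (M + w') \<in> mons V" using b0(1) M h by auto
      show ?thesis
        using parity[OF h(1) b(1) c] parity[OF h(2) b(2) c] h(5) unfolding a_def by metis
    qed
    then have "S = S'" using h by blast
    then have "comb h (b0 + (M + w)) = comb h (b0 + (M + w'))" using h(5) by (simp add: a_def)
    then have "b0 + (M + w) = b0 + (M + w')" using inj_comb_h b0(1) M h by (auto dest!: inj_onD)
    then show ?thesis using \<open>S = S'\<close> by simp
  qed
  \<comment> \<open>The constant gap between the order of \<open>a S w\<close> and
    \<open>mdeg w\<close>; it does not affect the leading term.\<close>
  define k where "k = (\<lambda>S. mdeg b0 + mdeg M + \<kappa> S)"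
  define Q where "Q = (\<lambda>t S. {w \<in> mons V. mdeg w = t - k S})"
  have finQ: "finite (Q t S)" for t S unfolding Q_def by (rule finite_mons_eq[OF fin_V])
  have finP: "finite (Pow R)" using fin_R by simp
  have lower: "(\<Sum>S\<in>Pow R. real ((t - k S + n1) choose n1)) \<le> real (card (\<Gamma>t t))" if t: "\<And>S. S \<in> Pow R \<Longrightarrow> k S \<le> t" for t
  proof -
    have "(\<Sum>S\<in>Pow R. (t - k S + n1) choose n1) = (\<Sum>S\<in>Pow R. card (Q t S))"
      unfolding Q_def n1_def card_mons_eq[OF fin_V V_ne] ..
    also have "\<dots> = (\<Sum>S\<in>Pow R. card (a S ` Q t S))"
    proof (intro sum.cong refl card_image[symmetric] inj_onI)
      fix S x y assume "S \<in> Pow R" "x \<in> Q t S" "y \<in> Q t S" "a S x = a S y"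
      then show "x = y" using inj[of S S x y] by (simp add: Q_def)
    qed
    also have "\<dots> = card (\<Union>S\<in>Pow R. a S ` Q t S)"
    proof (rule card_UN_disjoint[symmetric, OF finP])
      show "\<forall>i\<in>Pow R. \<forall>j\<in>Pow R. i \<noteq> j \<longrightarrow> a i ` Q t i \<inter> a j ` Q t j = {}"
      proof (intro ballI impI, rule ccontr)
        fix S S' assume S: "S \<in> Pow R" "S' \<in> Pow R" "S \<noteq> S'" and "a S ` Q t S \<inter> a S' ` Q t S' \<noteq> {}"
        then obtain x y where "x \<in> Q t S" "y \<in> Q t S'" "a S x = a S' y" by blast
        then show False using inj[of S S' x y] S by (simp add: Q_def)
      qed
    qed (use finQ in blast)
    also have "\<dots> \<le> card (\<Gamma>t t)"
    proof (intro card_mono finite_\<Gamma>t subsetI)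
      fix x assume "x \<in> (\<Union>S\<in>Pow R. a S ` Q t S)"
      then obtain S w where x: "S \<subseteq> R" "w \<in> mons V" "mdeg w = t - k S" "x = a S w" by (auto simp: Q_def)
      have "k S \<le> t" using t x(1) by blast
      then have "\<nu> x = t" using nu_a[OF x(1,2)] x(3,4) by (simp add: k_def)
      then show "x \<in> \<Gamma>t t" using aG[OF x(1,2)] x(4) by (simp add: \<Gamma>t_def)
    qed
    finally have "real (\<Sum>S\<in>Pow R. (t - k S + n1) choose n1) \<le> real (card (\<Gamma>t t))" by (rule of_nat_mono)
    then show ?thesis by (simp only: of_nat_sum)
  qed
  have "(\<lambda>t. real ((t - k S + n1) choose n1) / real t ^ n1) \<longlonglongrightarrow> 1 ^ n1 / fact n1" for S
  proof (rule binomial_asymptotic, rule Lim_transform_eventually)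
    show "(\<lambda>t. (real t - real (k S)) / real t) \<longlonglongrightarrow> 1" by real_asymp
    show "\<forall>\<^sub>F t in sequentially. (real t - real (k S)) / real t = real (t - k S) / real t"
      using eventually_ge_at_top[of "k S"] by eventually_elim (simp add: of_nat_diff)
  qed
  then have "(\<lambda>t. \<Sum>S\<in>Pow R. real ((t - k S + n1) choose n1) / real t ^ n1) \<longlonglongrightarrow> (\<Sum>S\<in>Pow R. 1 ^ n1 / fact n1)"
    by (intro tendsto_sum)
  moreover have "(\<Sum>S\<in>Pow R. 1 ^ n1 / fact n1 :: real) = 2 ^ card R / fact n1" using fin_R by (simp add: card_Pow)
  ultimately have lo: "(\<lambda>t. ereal (\<Sum>S\<in>Pow R. real ((t - k S + n1) choose n1) / real t ^ n1)) \<longlonglongrightarrow> ereal (2 ^ card R / fact n1)"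
    by (simp only: lim_ereal)
  define K where "K = Max (k ` Pow R)"
  have K: "k S \<le> K" if "S \<in> Pow R" for S using that finP unfolding K_def by (intro Max_ge) auto
  have "\<forall>\<^sub>F t in sequentially. ereal (\<Sum>S\<in>Pow R. real ((t - k S + n1) choose n1) / real t ^ n1) \<le> ereal (real (card (\<Gamma>t t)) / real t ^ n1)"
    using eventually_ge_at_top[of K]
  proof eventually_elim
    case (elim t)
    have "k S \<le> t" if "S \<in> Pow R" for S using K[OF that] elim by simp
    then have "(\<Sum>S\<in>Pow R. real ((t - k S + n1) choose n1)) / real t ^ n1 \<le> real (card (\<Gamma>t t)) / real t ^ n1"
      by (intro divide_right_mono lower) auto
    then show ?case by (simp add: sum_divide_distrib)
  qed
  then show ?thesis using tendsto_le[OF _ lim[folded n1_def] lo] by (simp add: n1_def)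
qed

end

section \<open>Graphs\<close>

lemma relpow_segment:
  assumes "\<And>i. i < k \<Longrightarrow> (g i, g (Suc i)) \<in> r" "i \<le> j" "j \<le> k"
  shows "(g i, g j) \<in> r ^^ (j - i)"
  unfolding relpow_fun_conv using assms by (intro exI[of _ "\<lambda>l. g (i + l)"]) auto

lemma relpow_sym: "sym r \<Longrightarrow> (x, y) \<in> r ^^ k \<Longrightarrow> (y, x) \<in> r ^^ k"
proof (induction k arbitrary: y)
  case (Suc k)
  then obtain z where "(x, z) \<in> r ^^ k" "(z, y) \<in> r" by auto
  then have "(z, x) \<in> r ^^ k" "(y, z) \<in> r" using Suc by (auto dest: symD)
  then show ?case by (rule relpow_Suc_I2[rotated])
qed auto

definition adj :: "'v set set \<Rightarrow> ('v \<times> 'v) set" where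
  "adj E = {(x, y). {x, y} \<in> E}"

lemma sym_adj: "sym (adj E)"
  by (auto simp: adj_def sym_def insert_commute)

text \<open>A shortest odd closed walk is a cycle: at a repeated node it splits into two closed walks, one of
  them odd.\<close>

lemma odd_closed_walk_imp_odd_cycle:
  assumes E: "\<And>e. e \<in> E \<Longrightarrow> card e = 2"
    and walk: "odd k" "(u, u) \<in> adj E ^^ k"
  shows "\<exists>c. cycle_in E c \<and> odd (length c) \<and> (\<forall>w\<in>set c. (u, w) \<in> (adj E)\<^sup>*)"
proof -
  let ?r = "adj E"
  \<comment> \<open>The base point \<open>w\<close> may vary within reach of \<open>u\<close>, since
    cutting a walk at a repeated node can move its base point.\<close>
  define P where "P = (\<lambda>k. odd k \<and> (\<exists>w. (u, w) \<in> ?r\<^sup>* \<and> (w, w) \<in> ?r ^^ k))"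
  have "P k" using walk by (auto simp: P_def)
  define l where "l = (LEAST k. P k)"
  have Pl: "P l" unfolding l_def using \<open>P k\<close> by (rule LeastI)
  have min: "\<not> P j" if "j < l" for j using that unfolding l_def by (rule not_less_Least)
  obtain w where w: "(u, w) \<in> ?r\<^sup>*" "(w, w) \<in> ?r ^^ l" and odd: "odd l" using Pl by (auto simp: P_def)
  obtain g where g: "g 0 = w" "g l = w" "\<And>i. i < l \<Longrightarrow> (g i, g (Suc i)) \<in> ?r"
    using w(2) unfolding relpow_fun_conv by blast
  have seg: "(g i, g j) \<in> ?r ^^ (j - i)" if "i \<le> j" "j \<le> l" for i j
    using relpow_segment[of l g ?r i j] g(3) that by blast
  have reach: "(u, g i) \<in> ?r\<^sup>*" if "i \<le> l" for i
  proof -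
    have "(w, g i) \<in> ?r\<^sup>*" using seg[of 0 i] that g(1) relpow_imp_rtrancl by fastforce
    then show ?thesis using w(1) by (rule rtrancl_trans[rotated])
  qed
  \<comment> \<open>Length 1 would need an edge with a single node; being odd, the length is then at
    least 3, as \<open>cycle_in\<close> demands.\<close>
  have l3: "3 \<le> l"
  proof -
    have "l \<noteq> 1"
    proof
      assume "l = 1"
      then have "{w, w} \<in> E" using g by (auto simp: adj_def)
      then show False using E[of "{w, w}"] by simp
    qed
    then show ?thesis using odd by (auto elim!: oddE)
  qed
  have inj: "g i \<noteq> g j" if ij: "i < j" "j < l" for i j
  proof
    assume eq: "g i = g j"
    show False
    proof (cases "odd (j - i)")
      case True
      then have "P (j - i)" using seg[of i j] reach[of i] ij eq by (auto simp: P_def)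
      then show False using min[of "j - i"] ij by simp
    next
      case False
      have "(w, g i) \<in> ?r ^^ i" using seg[of 0 i] ij g(1) by simp
      moreover have "(g i, w) \<in> ?r ^^ (l - j)" using seg[of j l] ij g(2) eq by simp
      ultimately have "(w, w) \<in> ?r ^^ (i + (l - j))" unfolding relpow_add by blast
      moreover have "odd (i + (l - j))" using False odd ij by auto
      ultimately have "P (i + (l - j))" using w(1) by (auto simp: P_def)
      moreover have "i + (l - j) < l" using ij by linarith
      ultimately show False using min by blast
    qed
  qed
  define c where "c = map g [0..<l]"
  have len: "length c = l" by (simp add: c_def)
  have "distinct c" unfolding c_def distinct_map
  proof (intro conjI inj_onI)
    fix i j assume "i \<in> set [0..<l]" "j \<in> set [0..<l]" "g i = g j"
    then show "i = j" using inj[of i j] inj[of j i] by (cases i j rule: linorder_cases) auto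
  qed simp
  moreover have "{c ! i, c ! (Suc i mod length c)} \<in> E" if i: "i < length c" for i
  proof (cases "Suc i < l")
    case True
    then show ?thesis using g(3)[of i] by (simp add: c_def adj_def)
  next
    case False
    then have "Suc i = l" using i len by simp
    then show ?thesis using g(3)[of i] g(1,2) l3 by (auto simp: c_def adj_def)
  qed
  ultimately have "cycle_in E c" using l3 len by (simp add: cycle_in_def)
  moreover have "\<forall>x\<in>set c. (u, x) \<in> ?r\<^sup>*" using reach by (auto simp: c_def)
  ultimately show ?thesis using odd len by blast
qed

section \<open>The edge monoid of a graph\<close>

locale simple_graph_locale =
  fixes V :: "'v set" and E :: "'v set set"
  assumes graph: "simple_graph V E"
begin

lemma fin_V: "finite V" and V_ne: "V \<noteq> {}" and E_sub: "e \<in> E \<Longrightarrow> e \<subseteq> V" and E_card: "e \<in> E \<Longrightarrow> card e = 2"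
  using graph by (auto simp: simple_graph_def)

lemma fin_E: "finite E"
  using E_sub fin_V by (meson PowI finite_Pow_iff finite_subset subsetI)

lemma edge_neq: "{x, y} \<in> E \<Longrightarrow> x \<noteq> y"
  using E_card by force

lemma edge_cases:
  assumes "e \<in> E"
  obtains x y where "e = {x, y}" "x \<noteq> y" "x \<in> V" "y \<in> V"
  using E_card[OF assms] E_sub[OF assms] by (auto simp: card_2_iff)

definition emon :: "'v set \<Rightarrow> ('v \<Rightarrow>\<^sub>0 nat)" where
  "emon e = (\<Sum>v\<in>e. Poly_Mapping.single v 1)"

lemma emon_pair: "x \<noteq> y \<Longrightarrow> emon {x, y} = Poly_Mapping.single x 1 + Poly_Mapping.single y 1"
  by (simp add: emon_def)

definition m :: nat where "m = card E"
definition en :: "nat \<Rightarrow> 'v set" where "en = (SOME e. bij_betw e {..<m} E)"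
definition ed :: "nat \<Rightarrow> ('v \<Rightarrow>\<^sub>0 nat)" where "ed i = emon (en i)"

lemma en_bij: "bij_betw en {..<m} E"
proof -
  have "\<exists>e. bij_betw e {..<m} E"
    using ex_bij_betw_nat_finite[OF fin_E] by (auto simp: m_def atLeast0LessThan)
  then show ?thesis unfolding en_def by (rule someI_ex)
qed

lemma en_E: "i < m \<Longrightarrow> en i \<in> E"
  using bij_betwE[OF en_bij] by simp

lemma ed_cases:
  assumes "i < m"
  obtains x y where "{x, y} \<in> E" "x \<noteq> y" "x \<in> V" "y \<in> V" "ed i = Poly_Mapping.single x 1 + Poly_Mapping.single y 1"
proof -
  obtain x y where e: "en i = {x, y}" "x \<noteq> y" "x \<in> V" "y \<in> V" using en_E[OF assms] by (rule edge_cases)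
  moreover have "{x, y} \<in> E" using en_E[OF assms] e by simp
  moreover have "ed i = Poly_Mapping.single x 1 + Poly_Mapping.single y 1" using e by (simp add: ed_def emon_pair)
  ultimately show thesis using that by blast
qed

lemma ed_exists: "{x, y} \<in> E \<Longrightarrow> \<exists>i<m. ed i = Poly_Mapping.single x 1 + Poly_Mapping.single y 1"
proof -
  assume e: "{x, y} \<in> E"
  then have "{x, y} \<in> en ` {..<m}" using en_bij by (auto simp: bij_betw_def)
  then obtain i where "i < m" "en i = {x, y}" by force
  then show ?thesis using edge_neq[OF e] by (auto simp: ed_def emon_pair)
qed

sublocale edge_monoid V ed m
proof
  show "finite V" by (rule fin_V)
  fix i assume "i < m"
  then obtain x y where "x \<in> V" "y \<in> V" "ed i = Poly_Mapping.single x 1 + Poly_Mapping.single y 1" by (rule ed_cases)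
  then show "ed i \<in> mons V" "mdeg (ed i) = 2" by (simp_all add: mons_single)
qed

lemma graph_upper_bound:
  assumes mp: "multipartite V E k q"
    and lim: "(\<lambda>t. ereal (real (card (\<Gamma>t t)) / real t ^ (card V - 1))) \<longlonglongrightarrow> L"
  shows "L \<le> ereal ((2 ^ card V - 2 * (\<Sum>i=1..k. \<Sum>j=1..q i. real ((card V - 1) choose (j - 1)))) / fact (card V - 1))"
proof -
  obtain W :: "nat \<Rightarrow> 'v set" where W: "(\<Union>i\<in>{1..k}. W i) = V" "disjoint_family_on W {1..k}"
    "\<And>i. i \<in> {1..k} \<Longrightarrow> card (W i) = q i" "\<And>i e. i \<in> {1..k} \<Longrightarrow> e \<in> E \<Longrightarrow> \<not> e \<subseteq> W i"
    using mp unfolding multipartite_def by blast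
  have "mdeg (restr (W i) (ed e)) \<le> 1" if i: "i \<in> {1..k}" and e: "e < m" for i e
  proof -
    obtain x y where xy: "{x, y} \<in> E" "x \<noteq> y" "ed e = Poly_Mapping.single x 1 + Poly_Mapping.single y 1"
      using e by (rule ed_cases)
    have r: "restr (W i) (Poly_Mapping.single z (1::nat)) = 0" if "z \<notin> W i" for z
      by (rule restr_disjoint[of _ "{z}"]) (use that in \<open>auto simp: mons_single\<close>)
    have le: "mdeg (restr (W i) (Poly_Mapping.single z (1::nat))) \<le> 1" for z
      using mdeg_restr_le[of "W i" "Poly_Mapping.single z (1::nat)"] by simp
    have "x \<notin> W i \<or> y \<notin> W i" using W(4)[OF i xy(1)] by blast
    then show ?thesis using r[of x] r[of y] le[of x] le[of y] unfolding xy(3) restr_add mdeg_add by auto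
  qed
  then have "L \<le> ereal (2 * ((2 ^ (card V - 1) - (\<Sum>i\<in>{1..k}. \<Sum>j<card (W i). real ((card V - 1) choose j))) / fact (card V - 1)))"
    using W(1,2) by (intro multiplicity_upper_bound V_ne lim) auto
  also have "(\<Sum>i\<in>{1..k}. \<Sum>j<card (W i). real ((card V - 1) choose j)) = (\<Sum>i=1..k. \<Sum>j=1..q i. real ((card V - 1) choose (j - 1)))"
  proof (rule sum.cong[OF refl])
    fix i assume "i \<in> {1..k}"
    then have c: "card (W i) = q i" by (rule W(3))
    show "(\<Sum>j<card (W i). real ((card V - 1) choose j)) = (\<Sum>j=1..q i. real ((card V - 1) choose (j - 1)))"
      unfolding c by (rule sum.reindex_bij_witness[of _ "\<lambda>j. j - 1" Suc]) auto
  qed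
  \<comment> \<open>The factor 2 from averaging turns \<open>2 ^ (n - 1)\<close> into
    \<open>2 ^ n\<close>; as \<open>n - 1\<close> is a truncated subtraction, this relies on the
    node set being nonempty.\<close>
  also have "(2::real) ^ card V = 2 * 2 ^ (card V - 1)"
    using V_ne fin_V by (metis card_gt_0_iff power_eq_if not_gr_zero)
  then have "2 * ((2 ^ (card V - 1) - s) / fact (card V - 1)) = (2 ^ card V - 2 * s) / fact (card V - 1)" for s :: real
    by (simp add: algebra_simps)
  finally show ?thesis .
qed

text \<open>The degenerate case in which the bipartition functional may be constant. Without edges
  every order is 0, so \<open>\<Gamma>t t\<close> is empty for positive \<open>t\<close>.\<close>

lemma no_edges_zero:
  assumes "E = {}" and lim: "(\<lambda>t. ereal (real (card (\<Gamma>t t)) / real t ^ (card V - 1))) \<longlonglongrightarrow> L"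
  shows "L = 0"
proof -
  have "card E = 0" using assms(1) by simp
  then have m0: "m = 0" by (simp only: m_def)
  have "\<nu> a = 0" if a: "a \<in> mons V" for a
  proof -
    have "a \<in> U (\<nu> a)" using a by (simp add: U_iff)
    then obtain y where "y \<in> Y" "mdeg y = \<nu> a" unfolding U_def by blast
    moreover have "Y = {0}" using m0 by simp
    ultimately show ?thesis by simp
  qed
  then have empty: "\<Gamma>t t = {}" if "t > 0" for t using that by (auto simp: \<Gamma>t_def \<Gamma>_mons)
  have "\<forall>\<^sub>F t in sequentially. ereal 0 = ereal (real (card (\<Gamma>t t)) / real t ^ (card V - 1))"
    using eventually_gt_at_top[of 0] by eventually_elim (simp add: empty)
  then have "(\<lambda>t. ereal (real (card (\<Gamma>t t)) / real t ^ (card V - 1))) \<longlonglongrightarrow> ereal 0"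
    by (rule Lim_transform_eventually[OF tendsto_const])
  then show ?thesis using lim LIMSEQ_unique by (metis zero_ereal_def)
qed

text \<open>\<open>A\<close> and \<open>B\<close> collect the nodes reached from \<open>v0\<close>
  by even and by odd walks. A common node would close an odd walk at \<open>v0\<close>, so the sign
  \<open>\<phi>\<close> is well defined; it is 0 on the other components and cancels on every
  edge.\<close>

lemma bipartite_component_zero:
  assumes v0: "v0 \<in> V" and no_odd: "\<And>k. odd k \<Longrightarrow> (v0, v0) \<notin> adj E ^^ k"
    and lim: "(\<lambda>t. ereal (real (card (\<Gamma>t t)) / real t ^ (card V - 1))) \<longlonglongrightarrow> L"
  shows "L = 0"
proof -
  define A where "A = {w. \<exists>k. even k \<and> (v0, w) \<in> adj E ^^ k}"
  define B where "B = {w. \<exists>k. odd k \<and> (v0, w) \<in> adj E ^^ k}"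
  have disj: "A \<inter> B = {}"
  proof (rule ccontr)
    assume "A \<inter> B \<noteq> {}"
    then obtain w k l where w: "even k" "(v0, w) \<in> adj E ^^ k" "odd l" "(v0, w) \<in> adj E ^^ l"
      by (auto simp: A_def B_def)
    have "(w, v0) \<in> adj E ^^ l" using sym_adj w(4) by (rule relpow_sym)
    then have "(v0, v0) \<in> adj E ^^ (k + l)" using w(2) unfolding relpow_add by blast
    then show False using no_odd[of "k + l"] w by simp
  qed
  have AB: "y \<in> B" if xy: "x \<in> A" "{x, y} \<in> E" for x y
  proof -
    obtain k where "even k" "(v0, x) \<in> adj E ^^ k" using xy by (auto simp: A_def)
    moreover have "(x, y) \<in> adj E" using that by (simp add: adj_def)
    ultimately have "(v0, y) \<in> adj E ^^ Suc k" "odd (Suc k)" by auto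
    then show ?thesis unfolding B_def by blast
  qed
  have BA: "y \<in> A" if xy: "x \<in> B" "{x, y} \<in> E" for x y
  proof -
    obtain k where "odd k" "(v0, x) \<in> adj E ^^ k" using xy by (auto simp: B_def)
    moreover have "(x, y) \<in> adj E" using that by (simp add: adj_def)
    ultimately have "(v0, y) \<in> adj E ^^ Suc k" "even (Suc k)" by auto
    then show ?thesis unfolding A_def by blast
  qed
  define \<phi> where "\<phi> = (\<lambda>w. if w \<in> A then 1 else if w \<in> B then -1 else (0::int))"
  have edge0: "\<phi> x + \<phi> y = 0" if "{x, y} \<in> E" for x y
  proof -
    have yx: "{y, x} \<in> E" using that by (simp add: insert_commute)
    show ?thesis using AB[OF _ that] BA[OF _ that] AB[OF _ yx] BA[OF _ yx] disj unfolding \<phi>_def by auto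
  qed
  have v0A: "\<phi> v0 = 1" by (auto simp: \<phi>_def A_def intro: exI[of _ 0])
  \<comment> \<open>\<open>multiplicity_zero\<close> needs two nodes with different values. If all
    values are 1 there is no edge, because the values at the ends of an edge cancel.\<close>
  show ?thesis
  proof (cases "\<exists>u\<in>V. \<phi> u \<noteq> 1")
    case True
    then obtain u where u: "u \<in> V" "\<phi> u \<noteq> \<phi> v0" using v0A by auto
    show ?thesis
    proof (rule multiplicity_zero[OF _ u(1) v0 u(2) lim])
      fix e assume "e < m"
      then obtain x y where xy: "{x, y} \<in> E" "x \<noteq> y" "x \<in> V" "y \<in> V"
        "ed e = Poly_Mapping.single x 1 + Poly_Mapping.single y 1" by (rule ed_cases)
      have "(\<Sum>v\<in>V. \<phi> v * int (mlookup (ed e) v)) = (\<Sum>v\<in>V. (if v = x then \<phi> v else 0) + (if v = y then \<phi> v else 0))"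
        unfolding xy(5) by (intro sum.cong refl) (auto simp: lookup_add lookup_single when_def)
      also have "\<dots> = \<phi> x + \<phi> y" using fin_V xy by (simp add: sum.distrib)
      finally show "(\<Sum>v\<in>V. \<phi> v * int (mlookup (ed e) v)) = 0" using edge0[OF xy(1)] by simp
    qed
  next
    case False
    have "E = {}"
    proof (rule ccontr)
      assume "E \<noteq> {}"
      then obtain e where "e \<in> E" by blast
      then obtain x y where xy: "e = {x, y}" "x \<in> V" "y \<in> V" by (rule edge_cases)
      then have "\<phi> x = 1" "\<phi> y = 1" using False by auto
      then show False using edge0[of x y] \<open>e \<in> E\<close> xy by simp
    qed
    then show ?thesis using lim by (rule no_edges_zero)
  qed
qed

section \<open>Maximal families of disjoint odd cycles\<close>

definition odd_cycles :: "'v list set \<Rightarrow> bool" where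
  "odd_cycles C \<longleftrightarrow> (\<forall>c\<in>C. cycle_in E c \<and> odd (length c)) \<and> pairwise (\<lambda>c d. set c \<inter> set d = {}) C"

lemma cycle_V: "cycle_in E c \<Longrightarrow> set c \<subseteq> V"
proof
  fix x assume c: "cycle_in E c" and "x \<in> set c"
  then obtain i where "i < length c" "c ! i = x" by (auto simp: in_set_conv_nth)
  then have "{x, c ! (Suc i mod length c)} \<in> E" using c by (auto simp: cycle_in_def)
  then show "x \<in> V" using E_sub by blast
qed

text \<open>Disjoint cycles have different first nodes. The bound makes the maximum in
  \<open>odd_tulgeity\<close> one over a finite set; rotations of one cycle are different lists but
  share nodes, so a family contains at most one of them.\<close>

lemma odd_cycles_card:
  assumes "odd_cycles C"
  shows "finite C" "card C \<le> card V"
proof -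
  have hd: "hd c \<in> set c" if "c \<in> C" for c
    using assms that by (auto simp: odd_cycles_def cycle_in_def intro!: hd_in_set)
  have inj: "inj_on hd C"
  proof (rule inj_onI, rule ccontr)
    fix c d assume cd: "c \<in> C" "d \<in> C" "hd c = hd d" "c \<noteq> d"
    then have "set c \<inter> set d = {}" using assms by (auto simp: odd_cycles_def pairwise_def)
    then show False using hd[OF cd(1)] hd[OF cd(2)] cd(3) by auto
  qed
  have sub: "hd ` C \<subseteq> V"
    using hd cycle_V assms unfolding odd_cycles_def by blast
  show "finite C" using inj sub fin_V by (rule inj_on_finite)
  show "card C \<le> card V" using inj sub fin_V by (rule card_inj_on_le)
qed

lemma odd_tulgeity_family:
  obtains C where "odd_cycles C" "card C = odd_tulgeity E" "\<And>C'. odd_cycles C' \<Longrightarrow> card C' \<le> odd_tulgeity E"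
proof -
  define X where "X = {card C | C. odd_cycles C}"
  have t: "odd_tulgeity E = Max X" unfolding odd_tulgeity_def X_def odd_cycles_def ..
  have "X \<subseteq> {..card V}" unfolding X_def using odd_cycles_card(2) by blast
  then have fin: "finite X" by (rule finite_subset) simp
  have "odd_cycles {}" by (simp add: odd_cycles_def)
  then have "X \<noteq> {}" unfolding X_def by blast
  then have "Max X \<in> X" using fin by (intro Max_in)
  then obtain C where C: "odd_cycles C" "card C = Max X" unfolding X_def by force
  have "card C' \<le> Max X" if "odd_cycles C'" for C'
    using that fin by (intro Max_ge) (auto simp: X_def)
  then show thesis using that[of C] C t by simp
qed

lemma graph_lower_bound:
  assumes lim: "(\<lambda>t. ereal (real (card (\<Gamma>t t)) / real t ^ (card V - 1))) \<longlonglongrightarrow> L" and L0: "L \<noteq> 0"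
  shows "ereal (2 ^ odd_tulgeity E / fact (card V - 1)) \<le> L"
proof -
  let ?r = "adj E"
  obtain C where C: "odd_cycles C" "card C = odd_tulgeity E" "\<And>C'. odd_cycles C' \<Longrightarrow> card C' \<le> odd_tulgeity E"
    using odd_tulgeity_family by blast
  have finC: "finite C" using odd_cycles_card(1)[OF C(1)] .
  have cyc_in: "cycle_in E c" "odd (length c)" if "c \<in> C" for c using C(1) that by (auto simp: odd_cycles_def)
  have Cdisj: "c = c'" if "c \<in> C" "c' \<in> C" "v \<in> set c" "v \<in> set c'" for c c' v
    using C(1) that unfolding odd_cycles_def pairwise_def by blast
  define D where "D = (\<Union>c\<in>C. set c)"
  have DV: "D \<subseteq> V" unfolding D_def using cyc_in(1) cycle_V by blast
  \<comment> \<open>A node that does not reach the family either has no odd closed walk, and then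
    \<open>L = 0\<close>, or reaches an odd cycle disjoint from the family, against
    maximality.\<close>
  have reach: "\<exists>k. \<exists>u\<in>D. (v, u) \<in> ?r ^^ k" if v: "v \<in> V" for v
  proof (rule ccontr)
    assume no: "\<not> ?thesis"
    have "(v, v) \<notin> ?r ^^ k" if k: "odd k" for k
    proof
      assume vv: "(v, v) \<in> ?r ^^ k"
      obtain c where c: "cycle_in E c" "odd (length c)" "\<And>w. w \<in> set c \<Longrightarrow> (v, w) \<in> ?r\<^sup>*"
        using odd_closed_walk_imp_odd_cycle[OF E_card k vv] by blast
      have cD: "set c \<inter> D = {}"
      proof (rule ccontr)
        assume "set c \<inter> D \<noteq> {}"
        then obtain w where w: "w \<in> set c" "w \<in> D" by blast
        obtain j where "(v, w) \<in> ?r ^^ j" using rtrancl_imp_relpow[OF c(3)[OF w(1)]] by blast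
        then show False using no w(2) by blast
      qed
      then have disj: "set c \<inter> set d = {}" if "d \<in> C" for d using that by (auto simp: D_def)
      have "c \<noteq> []" using c(1) by (auto simp: cycle_in_def)
      then have "c \<notin> C" using disj[of c] by auto
      have "odd_cycles (insert c C)"
        using C(1) c(1,2) disj unfolding odd_cycles_def by (auto simp: pairwise_insert)
      then have "card (insert c C) \<le> odd_tulgeity E" by (rule C(3))
      then show False using C(2) finC \<open>c \<notin> C\<close> by simp
    qed
    then show False using bipartite_component_zero[OF v _ lim] L0 by blast
  qed
  \<comment> \<open>The distance to the nodes of the family; it is 0 exactly on \<open>D\<close> and
    will play the role of \<open>d\<close> in \<open>odd_functional_graph\<close>.\<close>
  define d where "d = (\<lambda>v. LEAST k. \<exists>u\<in>D. (v, u) \<in> ?r ^^ k)"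
  have d: "\<exists>u\<in>D. (v, u) \<in> ?r ^^ d v" if "v \<in> V" for v
    unfolding d_def using reach[OF that] by (rule LeastI_ex)
  have d_le: "d v \<le> k" if "u \<in> D" "(v, u) \<in> ?r ^^ k" for v u k
    unfolding d_def using that by (intro Least_le) blast
  have d0: "d v = 0 \<longleftrightarrow> v \<in> D" if "v \<in> V" for v
    using d[OF that] d_le[of v v 0] by auto
  have nxt: "\<exists>w. {v, w} \<in> E \<and> d w < d v" if v: "v \<in> V" "0 < d v" for v
  proof -
    obtain u where u: "u \<in> D" "(v, u) \<in> ?r ^^ d v" using d[OF v(1)] by blast
    obtain k where k: "d v = Suc k" using v(2) by (cases "d v") auto
    obtain w where w: "(v, w) \<in> ?r" "(w, u) \<in> ?r ^^ k" using u(2) unfolding k by (rule relpow_Suc_E2)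
    have "d w \<le> k" using u(1) w(2) by (rule d_le)
    then show ?thesis using w(1) k by (auto simp: adj_def)
  qed
  define cyc where "cyc = (\<lambda>v. SOME c. c \<in> C \<and> v \<in> set c)"
  have cyc_eq: "cyc v = c" if "c \<in> C" "v \<in> set c" for v c
  proof -
    have "cyc v \<in> C \<and> v \<in> set (cyc v)" unfolding cyc_def using that by (intro someI) blast
    then show ?thesis using Cdisj that by blast
  qed
  \<comment> \<open>The successor on a cycle of the family, elsewhere a neighbour nearer to the
    family. The successor is unique because the cycles are disjoint and their lists
    distinct.\<close>
  define f where "f = (\<lambda>v. if v \<in> D then SOME w. \<exists>i<length (cyc v). cyc v ! i = v \<and> w = cyc v ! (Suc i mod length (cyc v))
     else SOME w. {v, w} \<in> E \<and> d w < d v)"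
  have f_cyc: "f (c ! i) = c ! (Suc i mod length c)" if c: "c \<in> C" and i: "i < length c" for c i
  proof -
    have "c ! i \<in> set c" using i by simp
    then have e: "cyc (c ! i) = c" and iD: "c ! i \<in> D" using c cyc_eq by (auto simp: D_def)
    have dist: "distinct c" using cyc_in(1)[OF c] by (simp add: cycle_in_def)
    have "\<exists>w. \<exists>j<length c. c ! j = c ! i \<and> w = c ! (Suc j mod length c)" using i by blast
    then have "\<exists>j<length c. c ! j = c ! i \<and> f (c ! i) = c ! (Suc j mod length c)"
      unfolding f_def using iD by (simp only: if_True e) (rule someI_ex)
    then show ?thesis using dist i by (auto simp: nth_eq_iff_index_eq)
  qed
  have D_cases: "\<exists>c\<in>C. \<exists>i<length c. v = c ! i" if "v \<in> D" for v
    using that unfolding D_def by (auto simp: in_set_conv_nth)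
  have f_out: "{v, f v} \<in> E \<and> d (f v) < d v" if v: "v \<in> V" "0 < d v" for v
  proof -
    have "v \<notin> D" using d0[OF v(1)] v(2) by simp
    then show ?thesis unfolding f_def using someI_ex[OF nxt[OF v]] by simp
  qed
  have f_D: "{v, f v} \<in> E" "f v \<in> D" "cyc (f v) = cyc v" if vD: "v \<in> D" for v
  proof -
    obtain c i where c: "c \<in> C" "i < length c" "v = c ! i" using D_cases[OF vD] by blast
    have "Suc i mod length c < length c" using c(2) by (intro mod_less_divisor) auto
    then have m: "c ! (Suc i mod length c) \<in> set c" by simp
    show "{v, f v} \<in> E" using cyc_in(1)[OF c(1)] c f_cyc[OF c(1,2)] by (auto simp: cycle_in_def)
    show "f v \<in> D" using m c f_cyc[OF c(1,2)] by (auto simp: D_def)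
    show "cyc (f v) = cyc v" using cyc_eq[OF c(1) m] cyc_eq[OF c(1), of v] c f_cyc[OF c(1,2)] by simp
  qed
  have f_E: "{v, f v} \<in> E" if "v \<in> V" for v
    using f_D(1)[of v] f_out[OF that] d0[OF that] by (cases "v \<in> D") auto
  have fV: "f v \<in> V" if "v \<in> V" for v using f_E[OF that] E_sub by blast
  have d_dec: "d (f v) \<le> d v" if "v \<in> V" for v
    using f_out[OF that] f_D(2)[of v] d0[OF that] d0[OF fV[OF that]] by (cases "d v = 0") auto
  have fkV: "(f ^^ k) v \<in> V" if "v \<in> V" for k v using that by (induction k) (auto intro: fV)
  have d_iter: "d ((f ^^ k) v) \<le> d v - k" if v: "v \<in> V" for k v
  proof (induction k)
    case (Suc k)
    show ?case
    proof (cases "d ((f ^^ k) v) = 0")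
      case True
      then show ?thesis using d_dec[OF fkV[OF v, of k]] by simp
    next
      case False
      then have "d (f ((f ^^ k) v)) < d v - k" using f_out[OF fkV[OF v, of k]] Suc by linarith
      then show ?thesis by simp
    qed
  qed simp
  \<comment> \<open>After \<open>d v\<close> steps the iteration has entered \<open>D\<close>, and
    from then on it stays on one cycle; more steps would name the same cycle.\<close>
  define root where "root = (\<lambda>v. cyc ((f ^^ d v) v))"
  have root_eq: "cyc ((f ^^ k) v) = root v" if v: "v \<in> V" and k: "d v \<le> k" for v k
    using k
  proof (induction k rule: dec_induct)
    case (step k)
    have "d ((f ^^ k) v) = 0" using d_iter[OF v, of k] step by simp
    then have "(f ^^ k) v \<in> D" using d0[OF fkV[OF v]] by simp
    then show ?case using f_D(3) step by simp
  qed (simp add: root_def)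
  \<comment> \<open>The cycles of the family themselves index the cosets, and the marked node of a
    cycle is its first one.\<close>
  interpret odd_functional_graph V ed m f d root C hd
  proof
    fix v assume v: "v \<in> V"
    show "f v \<in> V" by (rule fV[OF v])
    show "\<exists>e<m. ed e = Poly_Mapping.single v 1 + Poly_Mapping.single (f v) 1" by (rule ed_exists[OF f_E[OF v]])
    show "0 < d v \<Longrightarrow> d (f v) < d v" using f_out[OF v] by simp
    show "d v = 0 \<Longrightarrow> d (f v) = 0" using d_dec[OF v] by simp
    show "root (f v) = root v"
    proof -
      have "root (f v) = cyc ((f ^^ d v) (f v))" using root_eq[OF fV[OF v] d_dec[OF v]] by simp
      also have "(f ^^ d v) (f v) = (f ^^ Suc (d v)) v" by (simp add: funpow_swap1)
      also have "cyc \<dots> = root v" by (rule root_eq[OF v]) simp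
      finally show ?thesis .
    qed
    show "\<exists>l. odd l \<and> (f ^^ l) v = v" if dv: "d v = 0"
    proof -
      have "v \<in> D" using dv d0[OF v] by simp
      then obtain c i where c: "c \<in> C" "i < length c" "v = c ! i" using D_cases by blast
      have "(f ^^ k) v = c ! ((i + k) mod length c)" for k
      proof (induction k)
        case (Suc k)
        have "(i + k) mod length c < length c" using c(2) by (intro mod_less_divisor) auto
        then have "(f ^^ Suc k) v = c ! (Suc ((i + k) mod length c) mod length c)" using Suc f_cyc[OF c(1)] by simp
        then show ?case by (simp add: mod_Suc_eq)
      qed (use c in simp)
      from this[of "length c"] have "(f ^^ length c) v = v" using c by simp
      then show ?thesis using cyc_in(2)[OF c(1)] by blast
    qed
  next
    show "inj_on f {v \<in> V. d v = 0}"
    proof (rule inj_onI)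
      fix x y assume xy: "x \<in> {v \<in> V. d v = 0}" "y \<in> {v \<in> V. d v = 0}" "f x = f y"
      then have xyD: "x \<in> D" "y \<in> D" using d0 by auto
      obtain c i where c: "c \<in> C" "i < length c" "x = c ! i" using D_cases[OF xyD(1)] by blast
      obtain c' j where c': "c' \<in> C" "j < length c'" "y = c' ! j" using D_cases[OF xyD(2)] by blast
      have "cyc x = cyc y" using f_D(3)[OF xyD(1)] f_D(3)[OF xyD(2)] xy(3) by simp
      then have cc: "c' = c" using cyc_eq[OF c(1), of x] cyc_eq[OF c'(1), of y] c c' by simp
      have dist: "distinct c" using cyc_in(1)[OF c(1)] by (simp add: cycle_in_def)
      have lt: "Suc i mod length c < length c" "Suc j mod length c < length c"
        using c(2) by (intro mod_less_divisor; auto)+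
      have "c ! (Suc i mod length c) = c ! (Suc j mod length c)"
        using f_cyc[OF c(1,2)] f_cyc[OF c(1), of j] c c' cc xy(3) by simp
      then have "Suc i mod length c = Suc j mod length c" using dist lt by (simp add: nth_eq_iff_index_eq)
      then have "i = j" using c(2) c'(2) cc by (auto simp: mod_Suc split: if_splits)
      then show "x = y" using c c' cc by simp
    qed
    show "finite C" by (rule finC)
    show "V \<noteq> {}" by (rule V_ne)
    fix c assume c: "c \<in> C"
    then have "c \<noteq> []" using cyc_in(1)[OF c] by (auto simp: cycle_in_def)
    then have h: "hd c \<in> set c" by simp
    then have hD: "hd c \<in> D" using c by (auto simp: D_def)
    then show hV: "hd c \<in> V" using DV by blast
    have "d (hd c) = 0" using d0[OF hV] hD by simp
    then show "root (hd c) = c" using cyc_eq[OF c h] by (simp add: root_def)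
  qed
  show ?thesis using multiplicity_lower_bound[OF lim] by (simp add: C(2))
qed

lemma limit_exists: "\<exists>L. (\<lambda>t. ereal (real (card (\<Gamma>t t)) / real t ^ k)) \<longlonglongrightarrow> L"
  by (rule ev_poly_ratio_convergent[OF ev_poly_card_\<Gamma>t])

end

section \<open>The j-multiplicity of the edge ideal\<close>

context simple_graph_locale
begin

text \<open>Connects the powers computed by repeated \<open>msum\<close> with the factorizations
  used for counting: the cofactors of the single edges are collected in one
  \<open>z\<close>.\<close>

lemma mpow_ed: "monomial_localization.mpow V (monomial_localization.msum (mons V) (ed ` {..<m})) t = U t"
proof (induction t)
  case 0
  show ?case by (simp add: monomial_localization.mpow.simps U_0)
next
  case (Suc t)
  let ?G = "ed ` {..<m}"
  have "monomial_localization.msum (U t) (monomial_localization.msum (mons V) ?G) = U (Suc t)" (is "?L = _")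
  proof
    show "?L \<subseteq> U (Suc t)"
    proof
      fix a assume "a \<in> ?L"
      then obtain z y z' i where a: "a = (z + comb ed y) + (z' + ed i)" "z \<in> mons V" "y \<in> Y" "mdeg y = t" "z' \<in> mons V" "i < m"
        unfolding monomial_localization.msum_def U_def by blast
      then have "(z + z') + comb ed (y + Poly_Mapping.single i (Suc 0)) \<in> U (Suc t)"
        by (intro U_I) (auto simp: mons_single)
      then show "a \<in> U (Suc t)" unfolding a(1) by (simp add: comb_add add_ac)
    qed
    show "U (Suc t) \<subseteq> ?L"
    proof
      fix a assume "a \<in> U (Suc t)"
      then obtain z y where a: "a = z + comb ed y" "z \<in> mons V" "y \<in> Y" "mdeg y = Suc t" unfolding U_def by blast
      then have "y \<noteq> 0" by auto
      then obtain i y' where y: "i < m" "y' \<in> Y" "y = Poly_Mapping.single i (Suc 0) + y'" "mdeg y = Suc (mdeg y')"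
        using mons_decomp_single[OF a(3)] by auto
      have "z + comb ed y' \<in> U t" using a y by (intro U_I) auto
      moreover have "0 + ed i \<in> monomial_localization.msum (mons V) ?G"
        unfolding monomial_localization.msum_def using y(1) mons_0 by blast
      moreover have "a = (z + comb ed y') + (0 + ed i)" using a y by (simp add: comb_add add_ac)
      ultimately show "a \<in> ?L" unfolding monomial_localization.msum_def by blast
    qed
  qed
  then show ?case using Suc by (simp add: monomial_localization.mpow.simps)
qed

text \<open>Lying in \<open>U t\<close> but not in \<open>U (Suc t)\<close> means having order
  \<open>t\<close>, and the saturation condition then becomes the one that defines
  \<open>\<Gamma>\<close>.\<close>

lemma sat_U: "monomial_localization.sat V (U t) (U (Suc t)) - U (Suc t) = \<Gamma>t t"
proof (rule equalityI; rule subsetI)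
  fix a assume "a \<in> monomial_localization.sat V (U t) (U (Suc t)) - U (Suc t)"
  then obtain \<sigma> where a: "a \<in> U t" "a \<notin> U (Suc t)" "\<And>b. b \<in> mons V \<Longrightarrow> \<sigma> \<le> mdeg b \<Longrightarrow> a + b \<in> U (Suc t)"
    unfolding monomial_localization.sat_def by blast
  have aV: "a \<in> mons V" using a(1) U_mons by blast
  then have nu: "\<nu> a = t" using a(1,2) by (simp add: U_iff)
  have "Suc (\<nu> a) \<le> \<nu> (a + b)" if "b \<in> mons V" "\<sigma> \<le> mdeg b" for b
    using a(3)[OF that] aV that(1) nu by (simp add: U_iff)
  then show "a \<in> \<Gamma>t t" using aV nu unfolding \<Gamma>t_def \<Gamma>_def by blast
next
  fix a assume "a \<in> \<Gamma>t t"
  then obtain \<sigma> where a: "a \<in> mons V" "\<nu> a = t" "\<And>b. b \<in> mons V \<Longrightarrow> \<sigma> \<le> mdeg b \<Longrightarrow> Suc (\<nu> a) \<le> \<nu> (a + b)"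
    unfolding \<Gamma>t_def \<Gamma>_def by blast
  have "a + b \<in> U (Suc t)" if "b \<in> mons V" "\<sigma> \<le> mdeg b" for b
    using a(3)[OF that] a(1,2) that(1) by (simp add: U_iff)
  moreover have "a \<in> U t" "a \<notin> U (Suc t)" using a(1,2) by (simp_all add: U_iff)
  ultimately show "a \<in> monomial_localization.sat V (U t) (U (Suc t)) - U (Suc t)"
    unfolding monomial_localization.sat_def by blast
qed

lemma edge_ideal_eq:
  fixes K :: "'k::field itself"
  shows "edge_ideal K V E = monomial_localization.J K V (monomial_localization.msum (mons V) (ed ` {..<m}))"
proof -
  interpret L: monomial_localization K V .
  have "{L.fr (indet v * indet w) 1 | v w. {v, w} \<in> E} = {L.fr (Poly_Mapping.single a 1) 1 | a. a \<in> ed ` {..<m}}" (is "?A = ?B")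
  proof
    have mult: "indet v * indet w = (Poly_Mapping.single (Poly_Mapping.single v 1 + Poly_Mapping.single w 1) 1 :: ('v, 'k) mpoly)" for v w
      by (simp add: indet_def mult_single)
    show "?A \<subseteq> ?B"
    proof
      fix x assume "x \<in> ?A"
      then obtain v w where x: "x = L.fr (indet v * indet w) 1" "{v, w} \<in> E" by blast
      obtain i where "i < m" "ed i = Poly_Mapping.single v 1 + Poly_Mapping.single w 1" using ed_exists[OF x(2)] by blast
      then have "x = L.fr (Poly_Mapping.single (ed i) 1) 1" using x(1) by (simp only: mult)
      moreover have "ed i \<in> ed ` {..<m}" using \<open>i < m\<close> by blast
      ultimately show "x \<in> ?B" by blast
    qed
    show "?B \<subseteq> ?A"
    proof
      fix x assume "x \<in> ?B"
      then obtain i where i: "i < m" "x = L.fr (Poly_Mapping.single (ed i) 1) 1" by blast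
      obtain v w where "{v, w} \<in> E" "ed i = Poly_Mapping.single v 1 + Poly_Mapping.single w 1" using i(1) by (rule ed_cases)
      then have "{v, w} \<in> E" "x = L.fr (indet v * indet w) 1" using i(2) by (simp_all only: mult)
      then show "x \<in> ?A" by blast
    qed
  qed
  then have "edge_ideal K V E = genideal L.R {L.fr (Poly_Mapping.single a 1) 1 | a. a \<in> ed ` {..<m}}"
    unfolding edge_ideal_def L.R_def L.fr_def by simp
  also have "\<dots> = L.J (L.msum (mons V) (ed ` {..<m}))"
    using ed_mons by (intro L.J_genideal) auto
  finally show ?thesis .
qed

lemma j_multiplicity_edge_ideal:
  fixes K :: "'k::field itself"
  assumes lim: "(\<lambda>t. ereal (real (card (\<Gamma>t t)) / real t ^ (card V - 1))) \<longlonglongrightarrow> L"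
  shows "j_multiplicity (node_ring K V) (edge_ideal K V E) = ereal (fact (card V - 1)) * L"
proof -
  interpret L: monomial_localization K V .
  let ?A = "L.msum (mons V) (ed ` {..<m})"
  have up1: "L.upset ?A" using ed_mons by (intro L.upset_msum L.upset_mons) auto
  have pow: "ideal_pow L.R (edge_ideal K V E) t = L.J (U t)" for t
    unfolding edge_ideal_eq L.J_pow[OF up1] mpow_ed ..
  have up: "L.upset (U t)" for t
    using L.upset_mpow[OF up1, of t] unfolding mpow_ed .
  have len: "module_length L.R (local_cohomology0 L.R L.max_id
      (quot_module L.R (ideal_pow L.R (edge_ideal K V E) t) (ideal_pow L.R (edge_ideal K V E) (t + 1)))) = enat (card (\<Gamma>t t))" for t
  proof -
    have sub: "U (Suc t) \<subseteq> L.sat (U t) (U (Suc t))"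
      using U_Suc_subset[of t] up[of "Suc t"] unfolding L.sat_def L.upset_def by blast
    have "module_length L.R (quot_module L.R (L.J (L.sat (U t) (U (Suc t)))) (L.J (U (Suc t)))) = enat (card (\<Gamma>t t))"
      using L.length_J_quot[OF L.upset_sat[OF up up] up sub] by (simp add: sat_U finite_\<Gamma>t)
    then show ?thesis unfolding pow by (simp add: L.local_cohomology_J[OF fin_V up up])
  qed
  have "(\<lambda>t. ereal (real (card (\<Gamma>t t))) / ereal (real t ^ (card V - 1))) \<longlonglongrightarrow> L"
  proof (rule Lim_transform_eventually[OF lim])
    \<comment> \<open>At \<open>t = 0\<close> division by zero may differ between
      \<open>real\<close> and \<open>ereal\<close>; only positive \<open>t\<close> matter.\<close>
    show "\<forall>\<^sub>F t in sequentially. ereal (real (card (\<Gamma>t t)) / real t ^ (card V - 1)) = ereal (real (card (\<Gamma>t t))) / ereal (real t ^ (card V - 1))"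
      using eventually_gt_at_top[of 0] by eventually_elim simp
  qed
  then have "lim (\<lambda>t. ereal (real (card (\<Gamma>t t))) / ereal (real t ^ (card V - 1))) = L" by (rule limI)
  then show ?thesis
    unfolding j_multiplicity_def Let_def L.R_def[symmetric] L.krull_dim_R[OF fin_V] L.the_maximal len by simp
qed

end

theorem corollary9p5:
  fixes V :: "'v set" and E :: "'v set set" and k n :: nat and q :: "nat \<Rightarrow> nat"
  assumes "simple_graph V E"
    and "card V = n"
    and "multipartite V E k q"
    and "j_multiplicity (node_ring TYPE('k::field) V) (edge_ideal TYPE('k) V E) \<noteq> 0"
  shows "2 ^ odd_tulgeity E
           \<le> j_multiplicity (node_ring TYPE('k) V) (edge_ideal TYPE('k) V E) \<and>
         j_multiplicity (node_ring TYPE('k) V) (edge_ideal TYPE('k) V E)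
           \<le> ereal (2 ^ n - 2 * (\<Sum>i=1..k. \<Sum>j=1..q i. real ((n - 1) choose (j - 1))))"
proof -
  interpret simple_graph_locale V E by unfold_locales (rule assms(1))
  obtain L where lim: "(\<lambda>t. ereal (real (card (\<Gamma>t t)) / real t ^ (card V - 1))) \<longlonglongrightarrow> L"
    using limit_exists by blast
  have j: "j_multiplicity (node_ring TYPE('k) V) (edge_ideal TYPE('k) V E) = ereal (fact (n - 1)) * L"
    using j_multiplicity_edge_ideal[OF lim, of "TYPE('k)"] assms(2) by simp
  then have "L \<noteq> 0" using assms(4) by auto
  then have lower: "ereal (2 ^ odd_tulgeity E / fact (n - 1)) \<le> L"
    using graph_lower_bound[OF lim] assms(2) by simp
  have upper: "L \<le> ereal ((2 ^ n - 2 * (\<Sum>i=1..k. \<Sum>j=1..q i. real ((n - 1) choose (j - 1)))) / fact (n - 1))"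
    using graph_upper_bound[OF assms(3) lim] assms(2) by simp
  have "ereal (fact (n - 1)) * ereal (2 ^ odd_tulgeity E / fact (n - 1)) \<le> ereal (fact (n - 1)) * L"
    using lower by (rule ereal_mult_left_mono) simp
  moreover have "ereal (fact (n - 1)) * ereal (2 ^ odd_tulgeity E / fact (n - 1)) = 2 ^ odd_tulgeity E"
    by (simp flip: ereal_power)
  moreover have "ereal (fact (n - 1)) * L
      \<le> ereal (fact (n - 1)) * ereal ((2 ^ n - 2 * (\<Sum>i=1..k. \<Sum>j=1..q i. real ((n - 1) choose (j - 1)))) / fact (n - 1))"
    using upper by (rule ereal_mult_left_mono) simp
  ultimately show ?thesis unfolding j by simp
qed

end
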